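(* (i) Let $m\in(0,4)$ and $\alpha=\frac{1}{4-m}$. Then there exist $\kappa\in(0,\sqrt{12\alpha})$ and $a>0$ such that the problem $$\alpha\,(f-yf_y)+(f^m f_{yyy})_y=0\quad\text{for } y\in(0,\infty),$$ $$f(0)=1,\quad f_y(0)=0,\quad f_{yy}(0)=\kappa,\quad f_{yyy}(0)=0,$$ $$\frac{f(y)}{y}\to a\quad\text{as } y\to\infty$$ has a solution $f$. (ii) Let $m=4$, let $b>0$ and set $\alpha=b$. Then there exist $\kappa\in(0,\sqrt{12\alpha})$ and $a>0$ such that the same problem (with $m=4$ and $\alpha=b$), that is, $$b\,(f-yf_y)+(f^4 f_{yyy})_y=0\quad\text{for } y\in(0,\infty),$$ $$f(0)=1,\ f_y(0)=0,\ f_{yy}(0)=\kappa,\ f_{yyy}(0)=0,\qquad \frac{f(y)}{y}\to a\ \text{ as } y\to\infty,$$ has a solution $f$ that satisfies $$f(y)=ay+\mathrm{Re}\,[K y^{1+z_0}]+o\big(y^{1+\mathrm{Re}(z_0)}\big)\quad\text{as } y\to\infty$$ for some $z_0,K\in\mathbb{C}$ with $\mathrm{Re}(z_0)<-1$. Here $z_0$ is the root of the polynomial $(1-z^2)(2+z)+\frac{b}{a^4}$ with the largest negative real part (i.e. among the roots with negative real part, one whose real part is largest) and, for definiteness, with $\mathrm{Im}(z_0)\ge 0$.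
   Context: Subscripts $y$ denote derivatives with respect to $y$. A solution $f$ is a smooth, positive function on $[0,\infty)$ (so that $f^m$ makes sense for real $m$). *)

theory Defs
  imports
    "HOL-Analysis.Analysis"
    "HOL-Computational_Algebra.Polynomial"
    "HOL-Library.Landau_Symbols"
begin

text \<open>
  Functions on \<open>[0,\<infinity>)\<close> are represented by functions of type \<^typ>\<open>real \<Rightarrow> real\<close> whose
  values at negative arguments are irrelevant: derivatives are taken within \<open>{0..}\<close>, hence
  two-sided at \<open>y > 0\<close> and one-sided at \<open>y = 0\<close>.
\<close>

definition dy :: "(real \<Rightarrow> real) \<Rightarrow> real \<Rightarrow> real" where
  "dy f y = vector_derivative f (at y within {0..})"

definition smooth_halfline :: "(real \<Rightarrow> real) \<Rightarrow> bool" where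
  "smooth_halfline f \<longleftrightarrow> (\<forall>n. (dy ^^ n) f differentiable_on {0..})"

definition solves_problem ::
  "real \<Rightarrow> real \<Rightarrow> real \<Rightarrow> real \<Rightarrow> (real \<Rightarrow> real) \<Rightarrow> bool" where
  "solves_problem m \<alpha> \<kappa> a f \<longleftrightarrow>
     smooth_halfline f \<and>
     (\<forall>y\<ge>0. f y > 0) \<and>
     (\<forall>y>0. \<alpha> * (f y - y * dy f y) + dy (\<lambda>x. f x powr m * (dy ^^ 3) f x) y = 0) \<and>
     f 0 = 1 \<and> dy f 0 = 0 \<and> (dy ^^ 2) f 0 = \<kappa> \<and> (dy ^^ 3) f 0 = 0 \<and>
     ((\<lambda>y. f y / y) \<longlongrightarrow> a) at_top"

definition char_poly_ba :: "real \<Rightarrow> real \<Rightarrow> complex poly" where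
  "char_poly_ba b a = [:1, 0, -1:] * [:2, 1:] + [:complex_of_real (b / a ^ 4):]"

definition leading_stable_root :: "complex poly \<Rightarrow> complex \<Rightarrow> bool" where
  "leading_stable_root p z\<^sub>0 \<longleftrightarrow>
     poly p z\<^sub>0 = 0 \<and> Re z\<^sub>0 < 0 \<and> Im z\<^sub>0 \<ge> 0 \<and>
     (\<forall>z. poly p z = 0 \<and> Re z < 0 \<longrightarrow> Re z \<le> Re z\<^sub>0)"

end

theory Submission
  imports Defs
begin

text \<open>
  Put \<open>u = f''\<close>, \<open>g = f\<^sup>m f'''\<close> and \<open>h = y f' - f\<close>. After scaling to \<open>\<alpha> = 1\<close> the equation becomes the
  system \<open>h' = y u\<close>, \<open>u' = g / f\<^sup>m\<close>, \<open>g' = h\<close>, which leaves the cones \<open>u, g, h > 0\<close> and \<open>u, g, h < 0\<close>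
  invariant, and along which \<open>\<Phi> = u g - h\<^sup>2 / (2 y)\<close> is nondecreasing. For \<open>\<kappa> = 0\<close> the orbit enters the
  negative cone, for \<open>\<kappa> = sqrt 12\<close> the positive one, and in both cases \<open>\<Phi>\<close> becomes positive. The
  conditions ``\<open>\<Phi> > 0\<close> and \<open>u > 0\<close> somewhere'' and ``\<open>\<Phi> > 0\<close> and \<open>u < 0\<close> somewhere'' are open and
  exclude each other, so by connectedness some \<open>\<kappa>\<close> in between satisfies \<open>\<Phi> \<le> 0\<close> throughout.

  For such a trapped orbit \<open>\<integral> h\<^sup>2 / y\<^sup>2\<close> is finite, hence \<open>f / y\<close>, whose derivative is \<open>h / y\<^sup>2\<close>, converges.
  At the first zero \<open>t\<close> of \<open>h\<close> an explicit estimate of \<open>\<Phi>\<close> shows that the later oscillation of \<open>f / y\<close>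
  is at most \<open>sqrt (2/3) f(t) / t\<close>; this excludes touchdown (so that truncating \<open>1 / f\<^sup>m\<close> near \<open>f = 0\<close> is
  harmless) and gives \<open>a > 0\<close>.

  For \<open>m = 4\<close> the system is autonomous in \<open>ln y\<close>, and its linearization at \<open>f = a y\<close> has the roots of
  \<open>(1 - z\<^sup>2) (2 + z) + 1 / a\<^sup>4\<close> as eigenvalues. A resonant term with a factor \<open>ln y\<close> could only come from a
  double root; it is ruled out by the bound \<open>a \<le> 11/10\<close>, which makes the two stable roots complex
  conjugate and rests on an entropy identity.
\<close>

section \<open>Initial value problems on the half-line\<close>

text \<open>The form of \<Phi> is dictated by cancellation: in its derivative the two products
  \<open>u * h\<close> drop out and only the squares \<open>g^2 / f^m\<close> and
  \<open>h^2 / (2 y^2)\<close> remain. Shooting records the sign of \<open>u\<close> once \<Phi> >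
  0, not entry into a cone, because \<Phi> \<le> u g makes \<open>u\<close> nonzero there and
  monotonicity of \<Phi> then freezes that sign. The value sqrt 12 has slack: the decisive estimate
  at y = sqrt 2 only asks for \<kappa> > 3.3.

  The obstacle is that connectedness identifies neither \<kappa> nor \<open>a\<close>, so each later
  estimate has to hold for every trapped orbit. Touchdown is excluded because 2/3 < 1. For m = 4 the
  stable roots are non-real exactly when 1 / a^4 exceeds the maximum of (z^2 - 1) (z + 2) on
  [-2, -1], about 0.631, that is for a below about 1.122; this is the origin of the target 11/10.
  The expansion starts from the weak rate y^(-1/2) supplied by the boundedness of \<Phi>, which is
  improved in small steps until it passes the decay rate of the stable modes.\<close>

lemma has_vector_derivative_halfline:
  fixes X :: "real \<Rightarrow> 'a::real_normed_vector"
  assumes "(X has_vector_derivative d) (at y within {0..b})" "y < b"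
  shows "(X has_vector_derivative d) (at y within {0..})"
proof -
  have "at y within {0..b} = at y within {0..}"
    by (rule at_within_nhd[of _ "{..<b}"]) (use assms in auto)
  then show ?thesis using assms by simp
qed

lemma antiderivative_halfline:
  fixes l :: "real \<Rightarrow> 'a::banach"
  assumes "continuous_on {0..} l" "0 \<le> y"
  shows "((\<lambda>y. integral {0..y} l) has_vector_derivative l y) (at y within {0..})"
proof (rule has_vector_derivative_halfline[of _ _ _ "y + 1"])
  show "((\<lambda>y. integral {0..y} l) has_vector_derivative l y) (at y within {0..y + 1})"
    by (rule integral_has_vector_derivative)
       (use assms continuous_on_subset in \<open>auto intro: continuous_on_subset\<close>)
qed auto

text \<open>The Picard operator is a contraction for the norm weighted by \<open>exp (- \<Lambda>)\<close> with \<open>\<Lambda>' = 2 * L\<close>.\<close>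

theorem picard_halfline:
  fixes V :: "real \<Rightarrow> 'a::banach \<Rightarrow> 'a"
  assumes contV: "continuous_on ({0..} \<times> UNIV) (\<lambda>(s, x). V s x)"
    and lip: "\<And>s x z. 0 \<le> s \<Longrightarrow> norm (V s x - V s z) \<le> L s * norm (x - z)"
    and contL: "continuous_on {0..} L"
    and zero: "\<And>s. 0 \<le> s \<Longrightarrow> V s 0 = 0"
  obtains X where "X 0 = x0"
    "\<And>y. 0 \<le> y \<Longrightarrow> (X has_vector_derivative V y (X y)) (at y within {0..})"
proof -
  define M where "M = (\<lambda>y. integral {0..y} (\<lambda>s. 2 * \<bar>L s\<bar>))"
  have contL2: "continuous_on {0..} (\<lambda>s. 2 * \<bar>L s\<bar>)"
    using contL by (intro continuous_intros)
  have M0: "M 0 = 0" by (simp add: M_def)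
  have dM: "(M has_real_derivative 2 * \<bar>L y\<bar>) (at y within {0..})" if "0 \<le> y" for y
    unfolding M_def has_real_derivative_iff_has_vector_derivative
    using antiderivative_halfline[OF contL2 that] .
  have contM: "continuous_on {0..} M"
    by (rule DERIV_continuous_on[OF dM]) simp
  have lip': "norm (V s x) \<le> \<bar>L s\<bar> * norm x" if "0 \<le> s" for s x
  proof -
    have "norm (V s x) \<le> L s * norm x" using lip[OF that, of x 0] zero[OF that] by simp
    also have "\<dots> \<le> \<bar>L s\<bar> * norm x" by (intro mult_right_mono) auto
    finally show ?thesis .
  qed
  \<comment> \<open>The solution is sought as \<open>exp (M s)\<close> times a bounded function, so
    that the weighted norm becomes the sup norm of the type of bounded continuous functions.\<close>
  define I where "I = (\<lambda>\<phi>::real \<Rightarrow>\<^sub>C 'a. \<lambda>s. V s (exp (M s) *\<^sub>R \<phi> s))"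
  have contI: "continuous_on {0..} (I \<phi>)" for \<phi>
  proof -
    have "continuous_on {0..} (\<lambda>s. (\<lambda>(s, x). V s x) (s, exp (M s) *\<^sub>R \<phi> s))"
      by (rule continuous_on_compose2[OF contV]) (auto intro!: continuous_intros contM)
    then show ?thesis by (simp add: I_def)
  qed
  have intI: "I \<phi> integrable_on {0..y}" for \<phi> y
    by (rule integrable_continuous_interval, rule continuous_on_subset[OF contI]) auto
  \<comment> \<open>The derivative of \<open>M\<close> is twice \<open>|L|\<close>; this integral
    therefore gains the factor 1/2 that becomes the contraction constant.\<close>
  have ftc: "((\<lambda>s. \<bar>L s\<bar> * exp (M s) * c) has_integral c * (exp (M y) - 1) / 2) {0..y}"
    if "0 \<le> y" for y c
  proof -
    have "((\<lambda>s. \<bar>L s\<bar> * exp (M s) * c) has_integral c * exp (M y) / 2 - c * exp (M 0) / 2) {0..y}"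
    proof (rule fundamental_theorem_of_calculus[OF that])
      fix x assume x: "x \<in> {0..y}"
      have "((\<lambda>x. c * exp (M x) / 2) has_real_derivative \<bar>L x\<bar> * exp (M x) * c) (at x within {0..y})"
        by (rule derivative_eq_intros DERIV_subset[OF dM] refl | use x in force)+
      then show "((\<lambda>x. c * exp (M x) / 2) has_vector_derivative \<bar>L x\<bar> * exp (M x) * c) (at x within {0..y})"
        by (simp add: has_real_derivative_iff_has_vector_derivative)
    qed
    then show ?thesis by (simp add: M0 field_simps)
  qed
  have bd: "norm (integral {0..y} G) \<le> c * (exp (M y) - 1) / 2"
    if "0 \<le> y" "G integrable_on {0..y}" "\<And>s. 0 \<le> s \<Longrightarrow> norm (G s) \<le> \<bar>L s\<bar> * exp (M s) * c" for y c and G :: "real \<Rightarrow> 'a"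
  proof -
    have "norm (integral {0..y} G) \<le> integral {0..y} (\<lambda>s. \<bar>L s\<bar> * exp (M s) * c)"
      by (rule integral_norm_bound_integral[OF that(2) has_integral_integrable[OF ftc[OF that(1)]]])
         (use that(3) in auto)
    then show ?thesis by (simp only: integral_unique[OF ftc[OF that(1), of c]])
  qed
  \<comment> \<open>Bounded continuous functions live on the whole line, so the operator is extended
    to negative arguments by its value at 0.\<close>
  define T0 where "T0 = (\<lambda>\<phi>::real \<Rightarrow>\<^sub>C 'a. \<lambda>y. exp (- M (max 0 y)) *\<^sub>R (x0 + integral {0..max 0 y} (I \<phi>)))"
  have bdI: "norm (I \<phi> s) \<le> \<bar>L s\<bar> * exp (M s) * norm \<phi>" if "0 \<le> s" for \<phi> s
  proof -
    have "norm (I \<phi> s) \<le> \<bar>L s\<bar> * (exp (M s) * norm (\<phi> s))"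
      using lip'[OF that, of "exp (M s) *\<^sub>R \<phi> s"] by (simp add: I_def)
    also have "\<dots> \<le> \<bar>L s\<bar> * (exp (M s) * norm \<phi>)"
      by (intro mult_left_mono norm_bounded) auto
    finally show ?thesis by (simp add: mult_ac)
  qed
  have M_nonneg: "0 \<le> M y" for y
    unfolding M_def by (cases "0 \<le> y") (auto intro!: integral_nonneg integrable_continuous_interval continuous_intros continuous_on_subset[OF contL])
  have half: "exp (- M y) * (c * (exp (M y) - 1) / 2) \<le> c / 2" if "0 \<le> c" for y c
  proof -
    have "exp (- M y) * (c * (exp (M y) - 1) / 2) = c / 2 - c * exp (- M y) / 2"
      by (simp add: field_simps exp_minus)
    then show ?thesis using that by simp
  qed
  have T0: "T0 \<phi> \<in> bcontfun" for \<phi>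
  proof (rule bcontfun_normI)
    have "continuous_on {0..} (\<lambda>y. integral {0..y} (I \<phi>))"
      unfolding continuous_on_eq_continuous_within
      using has_vector_derivative_continuous[OF antiderivative_halfline[OF contI]] by auto
    then have "continuous_on {0..} (\<lambda>y. exp (- M y) *\<^sub>R (x0 + integral {0..y} (I \<phi>)))"
      by (intro continuous_intros contM)
    then show "continuous_on UNIV (T0 \<phi>)" unfolding T0_def
      by (rule continuous_on_compose2[where f = "max 0"]) (auto intro!: continuous_intros)
    fix y :: real
    define z where "z = max 0 y"
    have z: "0 \<le> z" by (simp add: z_def)
    have "norm (T0 \<phi> y) \<le> exp (- M z) * (norm x0 + norm (integral {0..z} (I \<phi>)))"
      by (auto simp: T0_def z_def intro!: mult_left_mono norm_triangle_ineq)
    also have "\<dots> \<le> exp (- M z) * (norm x0 + norm \<phi> * (exp (M z) - 1) / 2)"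
      by (intro mult_left_mono add_left_mono bd[OF z intI] bdI) auto
    also have "\<dots> \<le> norm x0 + norm \<phi> / 2"
      using half[of "norm \<phi>" z] mult_right_mono[of "exp (- M z)" 1 "norm x0"] M_nonneg[of z]
      by (simp add: distrib_left del: divide_minus_left)
    finally show "norm (T0 \<phi> y) \<le> norm x0 + norm \<phi> / 2" .
  qed
  define T where "T = (\<lambda>\<phi>. Bcontfun (T0 \<phi>))"
  have T: "apply_bcontfun (T \<phi>) = T0 \<phi>" for \<phi>
    unfolding T_def using T0 Bcontfun_inverse by blast
  have "dist (T \<phi>) (T \<psi>) \<le> 1 / 2 * dist \<phi> \<psi>" for \<phi> \<psi>
  proof (rule dist_bound)
    fix y :: real
    define z where "z = max 0 y"
    have z: "0 \<le> z" by (simp add: z_def)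
    have "dist (T \<phi> y) (T \<psi> y) = exp (- M z) * norm (integral {0..z} (I \<phi>) - integral {0..z} (I \<psi>))"
      unfolding T T0_def z_def[symmetric] dist_norm
      by (simp flip: scaleR_diff_right)
    also have "\<dots> = exp (- M z) * norm (integral {0..z} (\<lambda>s. I \<phi> s - I \<psi> s))"
      by (simp add: integral_diff intI)
    also have "\<dots> \<le> exp (- M z) * (dist \<phi> \<psi> * (exp (M z) - 1) / 2)"
    proof (intro mult_left_mono bd[OF z] integrable_diff intI)
      fix s :: real assume s: "0 \<le> s"
      have "norm (I \<phi> s - I \<psi> s) \<le> L s * norm (exp (M s) *\<^sub>R \<phi> s - exp (M s) *\<^sub>R \<psi> s)"
        unfolding I_def by (rule lip[OF s])
      also have "\<dots> \<le> \<bar>L s\<bar> * (exp (M s) * norm (\<phi> s - \<psi> s))"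
        by (auto simp flip: scaleR_diff_right intro!: mult_right_mono)
      also have "\<dots> \<le> \<bar>L s\<bar> * (exp (M s) * dist \<phi> \<psi>)"
        using dist_bounded[of \<phi> s \<psi>] by (intro mult_left_mono) (auto simp: dist_norm)
      finally show "norm (I \<phi> s - I \<psi> s) \<le> \<bar>L s\<bar> * exp (M s) * dist \<phi> \<psi>" by (simp add: mult_ac)
    qed auto
    also have "\<dots> \<le> dist \<phi> \<psi> / 2" by (rule half) auto
    finally show "dist (T \<phi> y) (T \<psi> y) \<le> 1 / 2 * dist \<phi> \<psi>" by simp
  qed
  then obtain \<phi> where \<phi>: "T \<phi> = \<phi>"
    using banach_fix_type[of "1/2" T] by auto
  define X where "X = (\<lambda>y. x0 + integral {0..y} (I \<phi>))"
  have X: "exp (M y) *\<^sub>R \<phi> y = X y" if "0 \<le> y" for y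
  proof -
    have "\<phi> y = exp (- M y) *\<^sub>R X y"
      using T[of \<phi>] that unfolding \<phi> by (simp add: T0_def X_def)
    then show ?thesis by (simp add: exp_minus)
  qed
  show ?thesis
  proof (rule that)
    show "X 0 = x0" by (simp add: X_def)
    fix y :: real assume y: "0 \<le> y"
    have "(X has_vector_derivative I \<phi> y) (at y within {0..})"
      unfolding X_def using antiderivative_halfline[OF contI y, of \<phi>]
      by (auto intro!: derivative_eq_intros)
    then show "(X has_vector_derivative V y (X y)) (at y within {0..})"
      using X[OF y] by (simp add: I_def)
  qed
qed

section \<open>Comparison principles and Gronwall's inequality on the half-line\<close>

lemma mono_halfline:
  fixes f :: "real \<Rightarrow> real"
  assumes "0 \<le> a" "a \<le> b"
    and "\<And>x. a \<le> x \<Longrightarrow> x \<le> b \<Longrightarrow> (f has_real_derivative f' x) (at x within {0..})"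
    and "\<And>x. a < x \<Longrightarrow> x < b \<Longrightarrow> 0 \<le> f' x"
  shows "f a \<le> f b"
proof (cases "a = b")
  case False
  then have "a < b" using assms by simp
  have "\<exists>x\<in>{a<..<b}. f b - f a = f' x * (b - a)"
    using \<open>a < b\<close>
  proof (rule mvt_simple)
    fix x assume "a \<le> x" "x \<le> b"
    then have "(f has_real_derivative f' x) (at x within {a..b})"
      by (intro DERIV_subset[OF assms(3)]) (use assms(1) in auto)
    then show "(f has_derivative (*) (f' x)) (at x within {a..b})"
      by (simp add: has_field_derivative_def)
  qed
  then obtain x where "a < x" "x < b" "f b - f a = f' x * (b - a)" by auto
  then show ?thesis using assms(4)[of x] \<open>a < b\<close> by (metis diff_ge_0_iff_ge less_eq_real_def mult_nonneg_nonneg)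
qed simp

text \<open>This replaces integration in most later estimates: both sides of an integrated
  inequality are given as explicit antiderivatives. Derivatives are compared in the open interval
  only, which matters at the endpoint 0 and at first zeros.\<close>

lemma compare_halfline:
  fixes f g :: "real \<Rightarrow> real"
  assumes "0 \<le> a" "a \<le> b"
    and "\<And>x. a \<le> x \<Longrightarrow> x \<le> b \<Longrightarrow> (f has_real_derivative f' x) (at x within {0..})"
    and "\<And>x. a \<le> x \<Longrightarrow> x \<le> b \<Longrightarrow> (g has_real_derivative g' x) (at x within {0..})"
    and "\<And>x. a < x \<Longrightarrow> x < b \<Longrightarrow> f' x \<le> g' x"
  shows "f b - f a \<le> g b - g a"
  using mono_halfline[of a b "\<lambda>x. g x - f x" "\<lambda>x. g' x - f' x"] assms
  by (force intro!: derivative_eq_intros)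

lemma compare_strict_halfline:
  fixes f g :: "real \<Rightarrow> real"
  assumes "0 \<le> a" "a < b"
    and "\<And>x. a \<le> x \<Longrightarrow> x \<le> b \<Longrightarrow> (f has_real_derivative f' x) (at x within {0..})"
    and "\<And>x. a \<le> x \<Longrightarrow> x \<le> b \<Longrightarrow> (g has_real_derivative g' x) (at x within {0..})"
    and "\<And>x. a < x \<Longrightarrow> x < b \<Longrightarrow> f' x < g' x"
  shows "f b - f a < g b - g a"
proof -
  have "\<exists>x\<in>{a<..<b}. (g b - f b) - (g a - f a) = (g' x - f' x) * (b - a)"
    using \<open>a < b\<close>
  proof (rule mvt_simple)
    fix x assume x: "a \<le> x" "x \<le> b"
    have "((\<lambda>x. g x - f x) has_real_derivative g' x - f' x) (at x within {0..})"
      using assms(3,4) x by (auto intro!: derivative_eq_intros)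
    then have "((\<lambda>x. g x - f x) has_real_derivative g' x - f' x) (at x within {a..b})"
      by (rule DERIV_subset) (use assms(1) in auto)
    then show "((\<lambda>x. g x - f x) has_derivative (*) (g' x - f' x)) (at x within {a..b})"
      by (simp add: has_field_derivative_def)
  qed
  then obtain x where "a < x" "x < b" "(g b - f b) - (g a - f a) = (g' x - f' x) * (b - a)" by auto
  then show ?thesis using assms(5)[of x] \<open>a < b\<close> by (smt (verit, best) mult_pos_pos)
qed

text \<open>The squared norm is differentiable everywhere, and multiplied by
  \<open>exp (- 2 * K)\<close> it is nonincreasing.\<close>

lemma gronwall_halfline:
  fixes X :: "real \<Rightarrow> 'a::real_inner"
  assumes "\<And>y. 0 \<le> y \<Longrightarrow> (X has_vector_derivative X' y) (at y within {0..})"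
    and "\<And>y. 0 \<le> y \<Longrightarrow> norm (X' y) \<le> l y * norm (X y)"
    and "\<And>y. 0 \<le> y \<Longrightarrow> (K has_real_derivative l y) (at y within {0..})"
    and "0 \<le> y"
  shows "norm (X y) \<le> norm (X 0) * exp (K y - K 0)"
proof -
  have mono: "(X 0 \<bullet> X 0) * - exp (- 2 * K 0) \<le> (X y \<bullet> X y) * - exp (- 2 * K y)"
  proof (rule mono_halfline[OF order_refl \<open>0 \<le> y\<close>])
    fix x :: real assume x: "0 \<le> x"
    have "((\<lambda>x. X x \<bullet> X x) has_real_derivative 2 * (X x \<bullet> X' x)) (at x within {0..})"
      using bounded_bilinear.has_vector_derivative[OF bounded_bilinear_inner assms(1)[OF x] assms(1)[OF x]]
      by (simp add: has_real_derivative_iff_has_vector_derivative inner_commute)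
    then show "((\<lambda>x. (X x \<bullet> X x) * - exp (- 2 * K x)) has_real_derivative
        2 * exp (- 2 * K x) * (l x * (X x \<bullet> X x) - X x \<bullet> X' x)) (at x within {0..})"
      by (auto intro!: derivative_eq_intros assms(3)[OF x] simp: algebra_simps)
  next
    fix x :: real assume x: "0 < x"
    have "X x \<bullet> X' x \<le> norm (X x) * norm (X' x)" by (rule norm_cauchy_schwarz)
    also have "\<dots> \<le> norm (X x) * (l x * norm (X x))" using assms(2)[of x] x by (intro mult_left_mono) auto
    also have "\<dots> = l x * (X x \<bullet> X x)" by (simp add: power2_norm_eq_inner[symmetric] power2_eq_square)
    finally show "0 \<le> 2 * exp (- 2 * K x) * (l x * (X x \<bullet> X x) - X x \<bullet> X' x)" by simp
  qed
  have e1: "exp (- 2 * K y) * exp (2 * K y) = 1"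
    and e2: "exp (- 2 * K 0) * exp (2 * K y) = exp (2 * K y - 2 * K 0)"
    by (simp_all flip: exp_add)
  have e3: "exp (2 * K y - 2 * K 0) = (exp (K y - K 0))\<^sup>2"
    by (simp add: power2_eq_square flip: exp_add)
  have "(norm (X y))\<^sup>2 * exp (- 2 * K y) \<le> (norm (X 0))\<^sup>2 * exp (- 2 * K 0)"
    using mono by (simp add: power2_norm_eq_inner)
  then have "(norm (X y))\<^sup>2 * exp (- 2 * K y) * exp (2 * K y) \<le> (norm (X 0))\<^sup>2 * exp (- 2 * K 0) * exp (2 * K y)"
    by (rule mult_right_mono) simp
  then have "(norm (X y))\<^sup>2 \<le> (norm (X 0))\<^sup>2 * exp (2 * K y - 2 * K 0)"
    by (simp only: mult.assoc e1 e2 mult_1_right)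
  also have "\<dots> = (norm (X 0) * exp (K y - K 0))\<^sup>2"
    by (simp only: power_mult_distrib e3)
  finally show ?thesis by (rule power2_le_imp_le) simp
qed

section \<open>The flow with truncated mobility and its dependence on the initial curvature\<close>

lemma norm_tuple4_le: "norm (a, b, c, d) \<le> \<bar>a\<bar> + \<bar>b\<bar> + \<bar>c\<bar> + \<bar>d :: real\<bar>" for a b c d :: real
  using norm_Pair_le[of a "(b, c, d)"] norm_Pair_le[of b "(c, d)"] norm_Pair_le[of c d] by simp

lemma tuple4_le_norm:
  fixes a b c d :: real
  shows "\<bar>a\<bar> \<le> norm (a, b, c, d)" "\<bar>b\<bar> \<le> norm (a, b, c, d)" "\<bar>c\<bar> \<le> norm (a, b, c, d)" "\<bar>d\<bar> \<le> norm (a, b, c, d)"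
  using norm_fst_le[of a "(b, c, d)"] norm_snd_le[of "(b, c, d)" a] norm_fst_le[of b "(c, d)"]
    norm_snd_le[of "(c, d)" b] norm_fst_le[of c d] norm_snd_le[of d c] by auto

text \<open>The product of \<open>g\<close> and \<open>W (f)\<close> is only locally Lipschitz,
  which blocks a direct use of \<open>picard_halfline\<close>. The range {0..4} contains the
  shooting interval [0, sqrt 12], and the four continuity conclusions yield the openness needed
  there.\<close>

lemma truncated_flow:
  fixes W :: "real \<Rightarrow> real"
  assumes W: "\<And>x. 0 \<le> W x" "\<And>x. W x \<le> C" "\<And>x z. \<bar>W x - W z\<bar> \<le> C * \<bar>x - z\<bar>"
  obtains f p u g :: "real \<Rightarrow> real \<Rightarrow> real" where
    "\<And>k y. k \<in> {0..4} \<Longrightarrow> 0 \<le> y \<Longrightarrow> (f k has_real_derivative p k y) (at y within {0..})"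
    "\<And>k y. k \<in> {0..4} \<Longrightarrow> 0 \<le> y \<Longrightarrow> (p k has_real_derivative u k y) (at y within {0..})"
    "\<And>k y. k \<in> {0..4} \<Longrightarrow> 0 \<le> y \<Longrightarrow> (u k has_real_derivative g k y * W (f k y)) (at y within {0..})"
    "\<And>k y. k \<in> {0..4} \<Longrightarrow> 0 \<le> y \<Longrightarrow> (g k has_real_derivative y * p k y - f k y) (at y within {0..})"
    "\<And>k. k \<in> {0..4} \<Longrightarrow> f k 0 = 1 \<and> p k 0 = 0 \<and> u k 0 = k \<and> g k 0 = 0"
    "\<And>y. 0 \<le> y \<Longrightarrow> continuous_on {0..4} (\<lambda>k. f k y)"
    "\<And>y. 0 \<le> y \<Longrightarrow> continuous_on {0..4} (\<lambda>k. p k y)"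
    "\<And>y. 0 \<le> y \<Longrightarrow> continuous_on {0..4} (\<lambda>k. u k y)"
    "\<And>y. 0 \<le> y \<Longrightarrow> continuous_on {0..4} (\<lambda>k. g k y)"
proof -
  have C: "0 \<le> C" using W(1,2)[of 0] by linarith
  have contW: "continuous_on UNIV W"
    by (rule lipschitz_on_continuous_on[of C]) (use W(3) C in \<open>auto simp: lipschitz_on_def dist_real_def\<close>)
  text \<open>\<open>G\<close> dominates the growth of every solution, so clamping \<open>g\<close> at \<open>G\<close> makes the
    vector field Lipschitz without affecting the solutions.\<close>
  define G where "G = (\<lambda>y::real. 5 * exp ((3 + C) * y + y\<^sup>2 / 2))"
  define cl where "cl = (\<lambda>y r. max (- G y) (min (G y) r))"
  define V where "V = (\<lambda>y (X :: real \<times> real \<times> real \<times> real). case X of (a, b, c, d) \<Rightarrow>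
    (b, c, cl y d * W a, y * b - a))"
  define L where "L = (\<lambda>y. 3 + C + G y * C + y)"
  have G0: "0 \<le> G y" for y by (simp add: G_def)
  have cl_lip: "\<bar>cl y r - cl y s\<bar> \<le> \<bar>r - s\<bar>" for y r s by (auto simp: cl_def max_def min_def)
  have cl_le: "\<bar>cl y r\<bar> \<le> \<bar>r\<bar>" "\<bar>cl y r\<bar> \<le> G y" for y r using G0[of y] by (auto simp: cl_def max_def min_def)
  have lip: "norm (V y X - V y Z) \<le> L y * norm (X - Z)" if "0 \<le> y" for y X Z
  proof -
    obtain a b c d where X: "X = (a, b, c, d)" by (metis surj_pair)
    obtain a' b' c' d' where Z: "Z = (a', b', c', d')" by (metis surj_pair)
    define N where "N = norm (X - Z)"
    have N: "\<bar>a - a'\<bar> \<le> N" "\<bar>b - b'\<bar> \<le> N" "\<bar>c - c'\<bar> \<le> N" "\<bar>d - d'\<bar> \<le> N"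
      using tuple4_le_norm[where a = "a - a'" and b = "b - b'" and c = "c - c'" and d = "d - d'"] by (auto simp: N_def X Z)
    have "\<bar>cl y d * W a - cl y d' * W a'\<bar> = \<bar>(cl y d - cl y d') * W a + cl y d' * (W a - W a')\<bar>"
      by (simp add: algebra_simps)
    also have "\<dots> \<le> \<bar>cl y d - cl y d'\<bar> * \<bar>W a\<bar> + \<bar>cl y d'\<bar> * \<bar>W a - W a'\<bar>"
      using abs_triangle_ineq by (simp flip: abs_mult)
    also have "\<dots> \<le> N * C + G y * (C * N)"
    proof (intro add_mono mult_mono)
      show "\<bar>cl y d - cl y d'\<bar> \<le> N" using cl_lip[of y d d'] N by simp
      show "\<bar>W a\<bar> \<le> C" using W(1,2)[of a] by simp
      show "\<bar>W a - W a'\<bar> \<le> C * N" using W(3)[of a a'] mult_left_mono[OF N(1) C] by simp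
      show "0 \<le> N" by (simp add: N_def)
    qed (use cl_le G0 in auto)
    finally have 1: "\<bar>cl y d * W a - cl y d' * W a'\<bar> \<le> N * C + G y * (C * N)" .
    have "\<bar>(y * b - a) - (y * b' - a')\<bar> \<le> \<bar>y * (b - b')\<bar> + \<bar>a - a'\<bar>" by (simp add: algebra_simps)
    also have "\<dots> \<le> y * N + N" using N that by (intro add_mono) (auto simp: abs_mult intro: mult_left_mono)
    finally have 2: "\<bar>(y * b - a) - (y * b' - a')\<bar> \<le> y * N + N" .
    have "norm (V y X - V y Z) \<le> \<bar>b - b'\<bar> + \<bar>c - c'\<bar> + \<bar>cl y d * W a - cl y d' * W a'\<bar> + \<bar>(y * b - a) - (y * b' - a')\<bar>"
      using norm_tuple4_le by (simp add: V_def X Z)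
    also have "\<dots> \<le> N + N + (N * C + G y * (C * N)) + (y * N + N)" using N 1 2 by linarith
    also have "\<dots> = L y * N" by (simp add: L_def algebra_simps)
    finally show ?thesis by (simp add: N_def)
  qed
  \<comment> \<open>Clamping only shrinks \<open>g\<close>, so this growth rate does not involve
    \<open>G\<close>, and defining \<open>G\<close> from it is not circular.\<close>
  have grow: "norm (V y X) \<le> (3 + C + y) * norm X" if "0 \<le> y" for y X
  proof -
    obtain a b c d where X: "X = (a, b, c, d)" by (metis surj_pair)
    define N where "N = norm X"
    have N: "\<bar>a\<bar> \<le> N" "\<bar>b\<bar> \<le> N" "\<bar>c\<bar> \<le> N" "\<bar>d\<bar> \<le> N"
      using tuple4_le_norm[where a = a and b = b and c = c and d = d] by (auto simp: N_def X)
    have "\<bar>cl y d * W a\<bar> \<le> N * C"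
      unfolding abs_mult using cl_le(1)[of y d] N W(1,2)[of a] by (intro mult_mono) auto
    moreover have "\<bar>y * b - a\<bar> \<le> y * N + N"
    proof -
      have "\<bar>y * b\<bar> \<le> y * N" using N that by (auto simp: abs_mult intro: mult_left_mono)
      then show ?thesis using N by linarith
    qed
    moreover have "norm (V y X) \<le> \<bar>b\<bar> + \<bar>c\<bar> + \<bar>cl y d * W a\<bar> + \<bar>y * b - a\<bar>"
      using norm_tuple4_le by (simp add: V_def X)
    ultimately show ?thesis using N by (simp add: N_def[symmetric] algebra_simps)
  qed
  have contL: "continuous_on {0..} L" unfolding L_def G_def by (intro continuous_intros) auto
  have contV: "continuous_on ({0..} \<times> UNIV) (\<lambda>(s, X). V s X)"
    unfolding V_def case_prod_unfold cl_def G_def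
    by (intro continuous_intros continuous_on_compose2[OF contW]) auto
  have "\<exists>X. X 0 = (1, 0, k, 0) \<and> (\<forall>y\<ge>0. (X has_vector_derivative V y (X y)) (at y within {0..}))" for k
    by (rule picard_halfline[OF contV lip contL, of "(1, 0, k, 0)"]) (auto simp: V_def zero_prod_def cl_def max_def min_def dest: order_antisym[OF _ G0])
  then obtain X where X0: "\<And>k. X k 0 = (1, 0, k, 0)"
    and dX: "\<And>k y. 0 \<le> y \<Longrightarrow> (X k has_vector_derivative V y (X k y)) (at y within {0..})"
    by metis
  have bd: "norm (X k y) \<le> G y" if "k \<in> {0..4}" "0 \<le> y" for k y
  proof -
    have "norm (X k y) \<le> norm (X k 0) * exp (((3 + C) * y + y\<^sup>2 / 2) - ((3 + C) * 0 + 0\<^sup>2 / 2))"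
      by (rule gronwall_halfline[OF dX grow _ that(2)]) (auto intro!: derivative_eq_intros)
    \<comment> \<open>The factor 5: the initial state (1, 0, k, 0) has norm at most 1 + 4.\<close>
    also have "\<dots> \<le> 5 * exp ((3 + C) * y + y\<^sup>2 / 2)"
      using norm_tuple4_le[of 1 0 k 0] that by (auto simp: X0 intro!: mult_right_mono)
    finally show ?thesis by (simp add: G_def)
  qed
  define K where "K = (\<lambda>y. integral {0..y} L)"
  have dK: "(K has_real_derivative L y) (at y within {0..})" if "0 \<le> y" for y
    unfolding K_def has_real_derivative_iff_has_vector_derivative
    using antiderivative_halfline[OF contL that] .
  \<comment> \<open>Gronwall for the difference of two solutions shows that the flow is Lipschitz in
    \<open>k\<close> at each fixed \<open>y\<close>.\<close>
  have cont: "continuous_on {0..4} (\<lambda>k. X k y)" if y: "0 \<le> y" for y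
  proof (rule lipschitz_on_continuous_on[of "exp (K y - K 0)"], rule lipschitz_onI)
    fix k j
    have "norm (X k y - X j y) \<le> norm (X k 0 - X j 0) * exp (K y - K 0)"
      by (rule gronwall_halfline[where X = "\<lambda>y. X k y - X j y" and X' = "\<lambda>y. V y (X k y) - V y (X j y)" and l = L])
         (use y in \<open>auto intro!: derivative_eq_intros dX lip dK\<close>)
    also have "norm (X k 0 - X j 0) \<le> \<bar>k - j\<bar>"
      using norm_tuple4_le[of 0 0 "k - j" 0] by (simp add: X0)
    finally show "dist (X k y) (X j y) \<le> exp (K y - K 0) * dist k j"
      by (simp add: dist_norm mult_ac mult_right_mono)
  qed simp
  define f where "f = (\<lambda>k y. fst (X k y))"
  define p where "p = (\<lambda>k y. fst (snd (X k y)))"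
  define u where "u = (\<lambda>k y. fst (snd (snd (X k y))))"
  define g where "g = (\<lambda>k y. snd (snd (snd (X k y))))"
  have X: "X k y = (f k y, p k y, u k y, g k y)" for k y by (simp add: f_def p_def u_def g_def)
  have cl_id: "cl y (g k y) = g k y" if "k \<in> {0..4}" "0 \<le> y" for k y
    using tuple4_le_norm(4)[where a = "f k y" and b = "p k y" and c = "u k y" and d = "g k y"] bd[OF that]
    by (simp add: X cl_def max_def min_def abs_le_iff)
  have V: "V y (X k y) = (p k y, u k y, g k y * W (f k y), y * p k y - f k y)"
    if "k \<in> {0..4}" "0 \<le> y" for k y
    using cl_id[OF that] by (simp add: V_def X)
  note D1 = bounded_linear.has_vector_derivative[OF bounded_linear_fst]
  note D2 = bounded_linear.has_vector_derivative[OF bounded_linear_snd]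
  show ?thesis
  proof (rule that)
    fix k y :: real assume k: "k \<in> {0..4}" and y: "0 \<le> y"
    note D = dX[OF y, of k, unfolded V[OF k y]]
    show "(f k has_real_derivative p k y) (at y within {0..})"
      using D1[OF D] by (simp add: f_def has_real_derivative_iff_has_vector_derivative)
    show "(p k has_real_derivative u k y) (at y within {0..})"
      using D1[OF D2[OF D]] by (simp add: p_def has_real_derivative_iff_has_vector_derivative)
    show "(u k has_real_derivative g k y * W (f k y)) (at y within {0..})"
      using D1[OF D2[OF D2[OF D]]] by (simp add: u_def has_real_derivative_iff_has_vector_derivative)
    show "(g k has_real_derivative y * p k y - f k y) (at y within {0..})"
      using D2[OF D2[OF D2[OF D]]] by (simp add: g_def has_real_derivative_iff_has_vector_derivative)
  next
    fix k :: real
    show "f k 0 = 1 \<and> p k 0 = 0 \<and> u k 0 = k \<and> g k 0 = 0" by (simp add: X0 f_def p_def u_def g_def)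
  qed (auto simp: f_def p_def u_def g_def intro!: continuous_on_fst continuous_on_snd cont)
qed

section \<open>Shooting\<close>

lemma first_zero:
  fixes \<phi> :: "real \<Rightarrow> real"
  assumes "continuous_on {a..b} \<phi>" "a \<le> b" "0 < \<phi> a" "\<phi> b \<le> 0"
  obtains t where "a < t" "t \<le> b" "\<phi> t = 0" "\<And>s. a \<le> s \<Longrightarrow> s < t \<Longrightarrow> 0 < \<phi> s"
proof -
  define S where "S = {s \<in> {a..b}. \<phi> s \<le> 0}"
  have "closed S"
    using continuous_closed_preimage[OF assms(1), of "{..0}"] by (simp add: S_def vimage_def Int_def)
  have S: "b \<in> S" "bdd_below S" using assms by (auto simp: S_def intro: bdd_belowI[of _ a])
  define t where "t = Inf S"
  have "t \<in> S" unfolding t_def using S \<open>closed S\<close> by (intro closed_contains_Inf) auto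
  have less: "0 < \<phi> s" if "a \<le> s" "s < t" for s
    using cInf_lower[of s S] S that \<open>t \<in> S\<close> by (force simp: S_def t_def)
  have "\<phi> t = 0"
  proof (rule ccontr)
    assume "\<phi> t \<noteq> 0"
    then have "\<phi> t < 0" using \<open>t \<in> S\<close> by (simp add: S_def)
    moreover have "continuous_on {a..t} \<phi>"
      using continuous_on_subset[OF assms(1)] \<open>t \<in> S\<close> by (auto simp: S_def)
    ultimately obtain s where "a \<le> s" "s \<le> t" "\<phi> s = 0"
      using IVT2'[of \<phi> t 0 a] assms(3) \<open>t \<in> S\<close> by (auto simp: S_def)
    then show False using less[of s] \<open>\<phi> t < 0\<close> by (cases "s = t") auto
  qed
  moreover have "a < t" using \<open>t \<in> S\<close> \<open>\<phi> t = 0\<close> assms(3) by (cases "a = t") (auto simp: S_def)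
  ultimately show ?thesis using that less \<open>t \<in> S\<close> by (auto simp: S_def)
qed

text \<open>The weight is a positive function of \<open>y\<close> not tied to \<open>f\<close>, so
  that the same facts serve the truncated weight and the true one,
  \<open>f y powr - m\<close>.\<close>

locale weighted_film =
  fixes f p u g w :: "real \<Rightarrow> real" and \<kappa> :: real
  assumes df: "0 \<le> y \<Longrightarrow> (f has_real_derivative p y) (at y within {0..})"
    and dp: "0 \<le> y \<Longrightarrow> (p has_real_derivative u y) (at y within {0..})"
    and du: "0 \<le> y \<Longrightarrow> (u has_real_derivative g y * w y) (at y within {0..})"
    and dg: "0 \<le> y \<Longrightarrow> (g has_real_derivative y * p y - f y) (at y within {0..})"
    and w_pos: "0 \<le> y \<Longrightarrow> 0 < w y"
    and init: "f 0 = 1" "p 0 = 0" "u 0 = \<kappa>" "g 0 = 0"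
begin

definition h where "h y = y * p y - f y"
text \<open>Division by 0 gives the value 0 to the quotient at \<open>y = 0\<close>, whereas its
  limit is infinite because \<open>h 0 = -1\<close>. Facts about \<Phi> are therefore restricted to
  positive \<open>y\<close>.\<close>

definition \<Phi> where "\<Phi> y = u y * g y - (h y)\<^sup>2 / (2 * y)"

lemma h0: "h 0 = -1" by (simp add: h_def init)

lemma dg': "0 \<le> y \<Longrightarrow> (g has_real_derivative h y) (at y within {0..})"
  using dg by (simp add: h_def)

lemma dh: "0 \<le> y \<Longrightarrow> (h has_real_derivative y * u y) (at y within {0..})"
  unfolding h_def by (auto intro!: derivative_eq_intros df dp)

lemma d\<Phi>: "0 < y \<Longrightarrow> (\<Phi> has_real_derivative (g y)\<^sup>2 * w y + (h y)\<^sup>2 / (2 * y\<^sup>2)) (at y within {0..})"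
  unfolding \<Phi>_def
  by (auto intro!: derivative_eq_intros du dg' dh simp: field_simps power2_eq_square)

lemma dF: "0 < y \<Longrightarrow> ((\<lambda>y. f y / y) has_real_derivative h y / y\<^sup>2) (at y within {0..})"
  by (auto intro!: derivative_eq_intros df simp: h_def field_simps power2_eq_square)

lemma cont:
  "continuous_on {0..} f" "continuous_on {0..} p" "continuous_on {0..} u"
  "continuous_on {0..} g" "continuous_on {0..} h"
  by (rule DERIV_continuous_on, erule atLeast_iff[THEN iffD1, THEN df] atLeast_iff[THEN iffD1, THEN dp]
      atLeast_iff[THEN iffD1, THEN du] atLeast_iff[THEN iffD1, THEN dg] atLeast_iff[THEN iffD1, THEN dh])+

lemmas cont_on = continuous_on_subset[OF cont(1)] continuous_on_subset[OF cont(2)]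
  continuous_on_subset[OF cont(3)] continuous_on_subset[OF cont(4)] continuous_on_subset[OF cont(5)]

lemma \<Phi>_mono: "0 < a \<Longrightarrow> a \<le> b \<Longrightarrow> \<Phi> a \<le> \<Phi> b"
  by (rule mono_halfline[of a b]) (auto intro!: d\<Phi> add_nonneg_nonneg mult_nonneg_nonneg less_imp_le[OF w_pos])

text \<open>The sign \<sigma> treats both cones at once. While \<open>\<sigma> * h\<close> is
  positive, \<open>\<sigma> * g\<close> grows, hence \<open>\<sigma> * u\<close>, hence
  \<open>\<sigma> * h\<close> itself, so at a first zero of \<open>h\<close> it would still be at
  least its positive starting value.\<close>

lemma cone:
  assumes \<sigma>: "\<sigma> = 1 \<or> \<sigma> = -1" and a: "0 < a" "0 < \<sigma> * u a" "0 < \<sigma> * g a" "0 < \<sigma> * h a" and "a \<le> b"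
  shows "\<sigma> * u a \<le> \<sigma> * u b \<and> \<sigma> * h a \<le> \<sigma> * h b"
proof -
  have *: "\<sigma> * u a \<le> \<sigma> * u t \<and> \<sigma> * h a \<le> \<sigma> * h t"
    if t: "a \<le> t" "\<And>s. a \<le> s \<Longrightarrow> s < t \<Longrightarrow> 0 < \<sigma> * h s" for t
  proof -
    have g: "\<sigma> * g a \<le> \<sigma> * g s" if "a \<le> s" "s \<le> t" for s
      by (rule mono_halfline[of a s _ "\<lambda>x. \<sigma> * h x"])
        (use a that t(2) in \<open>auto intro!: derivative_eq_intros dg' less_imp_le\<close>)
    have u: "\<sigma> * u a \<le> \<sigma> * u s" if "a \<le> s" "s \<le> t" for s
    proof (rule mono_halfline[of a s _ "\<lambda>x. (\<sigma> * g x) * w x"])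
      fix x assume x: "a < x" "x < s"
      then have "0 \<le> \<sigma> * g x" using g[of x] a that by auto
      then show "0 \<le> \<sigma> * g x * w x" using w_pos[of x] a x by auto
    qed (use a that in \<open>auto intro!: derivative_eq_intros du\<close>)
    have "\<sigma> * h a \<le> \<sigma> * h t"
    proof (rule mono_halfline[of a t _ "\<lambda>x. x * (\<sigma> * u x)"])
      fix x assume x: "a < x" "x < t"
      then have "0 \<le> \<sigma> * u x" using u[of x] a by auto
      then show "0 \<le> x * (\<sigma> * u x)" using a x by auto
    qed (use a t in \<open>auto intro!: derivative_eq_intros dh\<close>)
    then show ?thesis using u t by auto
  qed
  have "0 < \<sigma> * h s" if "a \<le> s" for s
  proof (rule ccontr)
    assume "\<not> 0 < \<sigma> * h s"
    moreover have "continuous_on {a..s} (\<lambda>y. \<sigma> * h y)"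
      using a by (intro continuous_intros cont_on(5)) auto
    ultimately obtain t where t: "a < t" "\<sigma> * h t = 0" "\<And>s. a \<le> s \<Longrightarrow> s < t \<Longrightarrow> 0 < \<sigma> * h s"
      using first_zero[of a s "\<lambda>y. \<sigma> * h y"] \<open>a \<le> s\<close> a by auto
    have "\<sigma> * h a \<le> \<sigma> * h t" using *[of t] t by auto
    then show False using t(2) a(4) by linarith
  qed
  then show ?thesis using * \<open>a \<le> b\<close> by auto
qed

text \<open>In a cone \<open>h\<close> grows at least linearly,
  \<open>\<sigma> * h y \<ge> d * y\<close>, so the derivative of \<Phi> stays above the constant
  d^2 / 2.\<close>

lemma cone_imp_\<Phi>_pos:
  assumes \<sigma>: "\<sigma> = 1 \<or> \<sigma> = -1" and a: "0 < a" "0 < \<sigma> * u a" "0 < \<sigma> * g a" "0 < \<sigma> * h a"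
  obtains y where "a \<le> y" "0 < \<Phi> y" "0 < \<sigma> * u y"
proof -
  note c = cone[OF assms]
  define d where "d = min (\<sigma> * h a / a) (a * (\<sigma> * u a))"
  have d: "0 < d" "d \<le> \<sigma> * h a / a" "d \<le> a * (\<sigma> * u a)" using a by (auto simp: d_def)
  have lin: "d * y \<le> \<sigma> * h y" if "a \<le> y" for y
  proof -
    have "d * y - d * a \<le> \<sigma> * h y - \<sigma> * h a"
    proof (rule compare_halfline[where f' = "\<lambda>_. d" and g' = "\<lambda>x. x * (\<sigma> * u x)"])
      fix x assume "a < x"
      then have "a * (\<sigma> * u a) \<le> x * (\<sigma> * u x)" using c[of x] a mult_mono[of a x "\<sigma> * u a" "\<sigma> * u x"] by linarith
      then show "d \<le> x * (\<sigma> * u x)" using d by simp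
    qed (use a that in \<open>auto intro!: derivative_eq_intros dh\<close>)
    moreover have "d * a \<le> \<sigma> * h a" using d(2) a by (simp add: field_simps)
    ultimately show ?thesis by simp
  qed
  have low: "d\<^sup>2 / 2 * y - d\<^sup>2 / 2 * a \<le> \<Phi> y - \<Phi> a" if "a \<le> y" for y
  proof (rule compare_halfline[where f' = "\<lambda>_. d\<^sup>2 / 2" and g' = "\<lambda>y. (g y)\<^sup>2 * w y + (h y)\<^sup>2 / (2 * y\<^sup>2)"])
    fix x assume x: "a < x"
    then have "(d * x)\<^sup>2 \<le> (\<sigma> * h x)\<^sup>2" using lin[of x] d a by (intro power_mono) auto
    moreover have "(\<sigma> * h x)\<^sup>2 = (h x)\<^sup>2" using \<sigma> by auto
    ultimately have "(d * x)\<^sup>2 \<le> (h x)\<^sup>2" by simp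
    then have "d\<^sup>2 / 2 \<le> (h x)\<^sup>2 / (2 * x\<^sup>2)" using a x by (simp add: field_simps power_mult_distrib)
    moreover have "0 \<le> (g x)\<^sup>2 * w x" using w_pos[of x] a x by simp
    ultimately show "d\<^sup>2 / 2 \<le> (g x)\<^sup>2 * w x + (h x)\<^sup>2 / (2 * x\<^sup>2)" by simp
  qed (use a that in \<open>auto intro!: derivative_eq_intros d\<Phi>\<close>)
  define y where "y = a + 2 * (\<bar>\<Phi> a\<bar> + 1) / d\<^sup>2"
  have y: "a \<le> y" using d by (simp add: y_def)
  have "d\<^sup>2 / 2 * y - d\<^sup>2 / 2 * a = \<bar>\<Phi> a\<bar> + 1" using d by (simp add: y_def field_simps)
  then have "0 < \<Phi> y" using low[OF y] by linarith
  then show ?thesis using that y c[OF y] a by force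
qed

section \<open>The two extreme shooting parameters\<close>

lemma early_g_neg: "\<exists>\<delta>>0. \<forall>y. 0 < y \<and> y \<le> \<delta> \<longrightarrow> g y < 0 \<and> h y < 0"
proof -
  have "\<exists>\<delta>>0. \<forall>y\<in>{0..}. dist y 0 < \<delta> \<longrightarrow> dist (h y) (h 0) < 1"
    using cont(5) unfolding continuous_on_iff by (metis atLeast_iff order_refl zero_less_one)
  then obtain \<delta> where "\<delta> > 0" "\<forall>y\<in>{0..}. y < \<delta> \<longrightarrow> \<bar>h y + 1\<bar> < 1"
    by (auto simp: dist_real_def h0)
  then have \<delta>: "\<delta> > 0" "\<And>y. 0 \<le> y \<Longrightarrow> y < \<delta> \<Longrightarrow> h y < 0" by (force simp: abs_less_iff)+
  have "g y < 0" if "0 < y" "y \<le> \<delta> / 2" for y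
    using compare_strict_halfline[of 0 y g h "\<lambda>_. 0" "\<lambda>_. 0"] that \<delta>
    by (auto simp: init dg')
  then show ?thesis using \<delta> by (intro exI[of _ "\<delta> / 2"]) auto
qed

text \<open>Since \<open>u\<close> starts at 0 and its derivative \<open>g * w\<close> is negative
  immediately, the orbit is in the negative cone right after 0.\<close>

lemma \<kappa>_zero:
  assumes "\<kappa> = 0"
  shows "\<exists>y>0. 0 < \<Phi> y \<and> u y < 0"
proof -
  obtain \<delta> where \<delta>: "\<delta> > 0" "\<And>y. 0 < y \<Longrightarrow> y \<le> \<delta> \<Longrightarrow> g y < 0 \<and> h y < 0" using early_g_neg by blast
  have "u \<delta> < 0"
    using compare_strict_halfline[of 0 \<delta> u "\<lambda>y. g y * w y" "\<lambda>_. 0" "\<lambda>_. 0"] \<delta> assms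
    by (auto simp: init du mult_neg_pos w_pos)
  then obtain y where "\<delta> \<le> y" "0 < \<Phi> y" "0 < - 1 * u y"
    using cone_imp_\<Phi>_pos[of "-1" \<delta>] \<delta> by auto
  then show ?thesis using \<delta> by (intro exI[of _ y]) auto
qed

text \<open>As long as \<open>u > 0\<close>, integration gives \<open>f \<ge> 1\<close>,
  \<open>h \<ge> -1\<close> and \<open>g \<ge> - r\<close>, hence \<open>u' \<ge> - r\<close>. The
  resulting bound keeps \<open>u\<close> above \<kappa> - 1 up to sqrt 2, so the assumption
  \<open>u > 0\<close> reproduces itself.\<close>

lemma \<kappa>_large_phase:
  assumes w1: "\<And>y. 0 \<le> y \<Longrightarrow> 1 \<le> f y \<Longrightarrow> w y \<le> 1"
    and \<kappa>: "\<kappa> = sqrt 12" and t: "0 \<le> t" "t \<le> sqrt 2" "\<And>s. 0 \<le> s \<Longrightarrow> s \<le> t \<Longrightarrow> g s \<le> 0"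
  shows "\<kappa> - t\<^sup>2 / 2 \<le> u t"
proof -
  have k: "3 < \<kappa>" unfolding \<kappa> by (rule real_less_rsqrt) simp
  have low: "\<kappa> - s\<^sup>2 / 2 \<le> u s"
    if s: "0 \<le> s" "s \<le> t" and pos: "\<And>r. 0 \<le> r \<Longrightarrow> r < s \<Longrightarrow> 0 < u r" for s
  proof -
    have p: "0 \<le> p r" if "0 \<le> r" "r \<le> s" for r
      using compare_halfline[of 0 r "\<lambda>_. 0" "\<lambda>_. 0" p u] that pos by (auto simp: init less_imp_le dp)
    have f: "1 \<le> f r" if "0 \<le> r" "r \<le> s" for r
      using compare_halfline[of 0 r "\<lambda>_. 0" "\<lambda>_. 0" f p] that p by (auto simp: init df)
    have h: "-1 \<le> h r" if "0 \<le> r" "r \<le> s" for r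
      using compare_halfline[of 0 r "\<lambda>_. 0" "\<lambda>_. 0" h "\<lambda>r. r * u r"] that pos
      by (auto simp: h0 less_imp_le dh)
    have g: "- r \<le> g r" if "0 \<le> r" "r \<le> s" for r
      using compare_halfline[of 0 r "\<lambda>r. - r" "\<lambda>_. -1" g h] that h DERIV_minus[OF DERIV_ident]
      by (auto simp: init dg')
    have "- (s\<^sup>2 / 2) - - (0\<^sup>2 / 2) \<le> u s - u 0"
    proof (rule compare_halfline[where f' = "\<lambda>r. - r" and g' = "\<lambda>r. g r * w r"])
      fix r assume r: "0 < r" "r < s"
      have "w r \<le> 1" "0 < w r" using w1[of r] f[of r] w_pos[of r] r by auto
      moreover have "g r \<le> 0" "- r \<le> g r" using t(3)[of r] g[of r] r s by auto
      ultimately show "- r \<le> g r * w r" using mult_left_mono_neg[of "w r" 1 "g r"] by linarith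
    qed (use s in \<open>auto intro!: derivative_eq_intros du\<close>)
    then show ?thesis by (simp add: init)
  qed
  have sq: "s\<^sup>2 \<le> 2" if "0 \<le> s" "s \<le> t" for s
    using power_mono[of s "sqrt 2" 2] that t by simp
  have "0 < u s" if s: "0 \<le> s" "s \<le> t" for s
  proof (rule ccontr)
    assume us: "\<not> 0 < u s"
    obtain r where r: "0 < r" "r \<le> s" "u r = 0" "\<And>x. 0 \<le> x \<Longrightarrow> x < r \<Longrightarrow> 0 < u x"
      by (rule first_zero[OF cont_on(3), of 0 s]) (use s k us in \<open>auto simp: init\<close>)
    then have "\<kappa> - r\<^sup>2 / 2 \<le> 0" using low[of r] r s by auto
    then show False using sq[of r] r s k by auto
  qed
  then show ?thesis using low[of t] t by auto
qed

lemma \<kappa>_large: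
  assumes w1: "\<And>y. 0 \<le> y \<Longrightarrow> 1 \<le> f y \<Longrightarrow> w y \<le> 1" and \<kappa>: "\<kappa> = sqrt 12"
  shows "\<exists>y>0. 0 < \<Phi> y \<and> 0 < u y"
proof -
  have k: "3 < \<kappa>" "\<kappa>\<^sup>2 = 12" unfolding \<kappa> by (auto intro: real_less_rsqrt)
  have k': "3.4 < \<kappa>" unfolding \<kappa> by (rule real_less_rsqrt) (simp add: power2_eq_square)
  note low = \<kappa>_large_phase[OF w1 \<kappa>]
  have "\<exists>y. 0 \<le> y \<and> y \<le> sqrt 2 \<and> 0 < g y"
  proof (rule ccontr)
    assume "\<not> ?thesis"
    then have neg: "g y \<le> 0" if "0 \<le> y" "y \<le> sqrt 2" for y using that by force
    then have u: "\<kappa> - y\<^sup>2 / 2 \<le> u y" if "0 \<le> y" "y \<le> sqrt 2" for y using low[of y] that by auto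
    have h: "-1 + \<kappa> * y\<^sup>2 / 2 - y^4 / 8 \<le> h y" if y: "0 \<le> y" "y \<le> sqrt 2" for y
    proof -
      have "(\<kappa> * y\<^sup>2 / 2 - y^4 / 8) - (\<kappa> * 0\<^sup>2 / 2 - 0^4 / 8) \<le> h y - h 0"
      proof (rule compare_halfline[where f' = "\<lambda>r. r * (\<kappa> - r\<^sup>2 / 2)" and g' = "\<lambda>r. r * u r"])
        fix r assume "0 < r" "r < y"
        then show "r * (\<kappa> - r\<^sup>2 / 2) \<le> r * u r" using u[of r] y by (intro mult_left_mono) auto
      qed (use y in \<open>auto intro!: derivative_eq_intros dh simp: algebra_simps power2_eq_square power3_eq_cube\<close>)
      then show ?thesis by (simp add: h0)
    qed
    define y where "y = sqrt 2"
    have y: "0 \<le> y" "0 < y" "y\<^sup>2 = 2" by (auto simp: y_def)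
    \<comment> \<open>The lower bound on \<open>u\<close> is integrated through \<open>h\<close> to
      \<open>g\<close>. At y^2 = 2 the result is y (\<kappa> / 3 - 11/10), which is
      positive.\<close>
    have "(- y + \<kappa> * y^3 / 6 - y^5 / 40) - (- 0 + \<kappa> * 0^3 / 6 - 0^5 / 40) \<le> g y - g 0"
    proof (rule compare_halfline[where f' = "\<lambda>y. -1 + \<kappa> * y\<^sup>2 / 2 - y^4 / 8" and g' = h])
      show "\<And>x. 0 < x \<Longrightarrow> x < y \<Longrightarrow> - 1 + \<kappa> * x\<^sup>2 / 2 - x ^ 4 / 8 \<le> h x" using h by (auto simp: y_def)
    qed (use y in \<open>auto intro!: derivative_eq_intros dg'\<close>)
    moreover have "- y + \<kappa> * y^3 / 6 - y^5 / 40 = y * (-1 + \<kappa> * y\<^sup>2 / 6 - (y\<^sup>2)\<^sup>2 / 40)"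
      by (simp add: algebra_simps power2_eq_square power3_eq_cube eval_nat_numeral)
    moreover have "0 < y * (-1 + \<kappa> * y\<^sup>2 / 6 - (y\<^sup>2)\<^sup>2 / 40)"
      using k' by (intro mult_pos_pos y) (simp add: y)
    ultimately show False using neg[of y] y by (simp add: init y_def)
  qed
  then obtain y where y: "0 \<le> y" "y \<le> sqrt 2" "0 < g y" by blast
  obtain \<delta> where \<delta>: "\<delta> > 0" "\<And>y. 0 < y \<Longrightarrow> y \<le> \<delta> \<Longrightarrow> g y < 0 \<and> h y < 0" using early_g_neg by blast
  have dy: "\<delta> < y" using \<delta>(2)[of y] y init by (cases "y = 0") force+
  obtain t where t': "\<delta> < t" "t \<le> y" "- g t = 0" "\<And>s. \<delta> \<le> s \<Longrightarrow> s < t \<Longrightarrow> 0 < - g s"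
    by (rule first_zero[OF continuous_on_minus[OF cont_on(4)], of \<delta> y])
       (use \<delta> y dy in auto)
  then have t: "\<delta> < t" "t \<le> y" "g t = 0" "\<And>s. \<delta> \<le> s \<Longrightarrow> s < t \<Longrightarrow> g s < 0" by auto
  have neg: "g s < 0" if "0 < s" "s < t" for s using \<delta>(2)[of s] t(4)[of s] that by force
  have neg': "g s \<le> 0" if "0 \<le> s" "s \<le> t" for s
    using neg[of s] that t(3) init by (cases "s = 0 \<or> s = t") auto
  have u: "0 < u s" if "0 \<le> s" "s \<le> t" for s
  proof -
    have "\<kappa> - s\<^sup>2 / 2 \<le> u s" using low[of s] neg' that y t by auto
    moreover have "s\<^sup>2 \<le> 2" using power_mono[of s "sqrt 2" 2] that t y by simp
    ultimately show ?thesis using k by simp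
  qed
  \<comment> \<open>Otherwise \<open>h\<close>, increasing because \<open>u > 0\<close>, would be
    nonpositive on all of [0, t], and \<open>g\<close> could not return from
    \<open>g \<delta> < 0\<close> to 0.\<close>
  have "0 < h t"
  proof (rule ccontr)
    assume "\<not> 0 < h t"
    then have hs: "h s \<le> 0" if "0 \<le> s" "s \<le> t" for s
      using mono_halfline[of s t h "\<lambda>y. y * u y"] that u \<open>\<not> 0 < h t\<close> by (auto simp: dh less_imp_le)
    have "g t - g \<delta> \<le> 0 - 0"
      by (rule compare_halfline[where f' = h and g' = "\<lambda>_. 0"]) (use \<delta> t hs in \<open>auto simp: dg'\<close>)
    then show False using t(3) \<delta>(2)[of \<delta>] \<delta>(1) by auto
  qed
  have "t > 0" using t \<delta> by simp
  have ev: "\<exists>\<delta>>0. \<forall>y\<in>{0..}. dist y t < \<delta> \<longrightarrow> 0 < \<phi> y" if "continuous_on {0..} \<phi>" "0 < \<phi> t" for \<phi> :: "real \<Rightarrow> real"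
  proof -
    have "\<exists>\<delta>>0. \<forall>y\<in>{0..}. dist y t < \<delta> \<longrightarrow> dist (\<phi> y) (\<phi> t) < \<phi> t"
      using that \<open>t > 0\<close> unfolding continuous_on_iff by (metis atLeast_iff less_eq_real_def)
    then show ?thesis using that(2) by (auto simp: dist_real_def abs_less_iff)
  qed
  obtain a b where a: "0 < a" "\<And>y. 0 \<le> y \<Longrightarrow> dist y t < a \<Longrightarrow> 0 < h y"
    and b: "0 < b" "\<And>y. 0 \<le> y \<Longrightarrow> dist y t < b \<Longrightarrow> 0 < u y"
    using ev[OF cont(5) \<open>0 < h t\<close>] ev[OF cont(3) u[of t]] \<open>t > 0\<close> by auto
  \<comment> \<open>At \<open>t\<close> itself \<open>g\<close> vanishes; the cone is entered
    slightly later, while \<open>h\<close> and \<open>u\<close> are still positive.\<close>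
  define r where "r = t + min a b / 2"
  have r: "t < r" "\<And>s. t \<le> s \<Longrightarrow> s \<le> r \<Longrightarrow> dist s t < a \<and> dist s t < b"
    using a b by (auto simp: r_def dist_real_def)
  have "0 < g r"
    using compare_strict_halfline[of t r "\<lambda>_. 0" "\<lambda>_. 0" g h] r a(2) t(3) \<open>t > 0\<close>
    by (auto simp: dg')
  moreover have "0 < h r" "0 < u r" using a(2)[of r] b(2)[of r] r \<open>t > 0\<close> by auto
  ultimately obtain y where "r \<le> y" "0 < \<Phi> y" "0 < 1 * u y"
    using cone_imp_\<Phi>_pos[of 1 r] r \<open>t > 0\<close> by auto
  then show ?thesis using r \<open>t > 0\<close> by (intro exI[of _ y]) auto
qed

text \<open>A zero of \<open>u\<close> would make \<Phi> nonpositive. By monotonicity \<Phi> is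
  positive from the smaller of the two points on, so \<open>u\<close> has no zero there and keeps
  its sign.\<close>

lemma \<Phi>_pos_sign:
  assumes "0 < a" "0 < \<Phi> a" "0 < b" "0 < \<Phi> b"
  shows "0 < u a \<longleftrightarrow> 0 < u b"
proof -
  have nz: "u y \<noteq> 0" if "min a b \<le> y" for y
  proof
    assume "u y = 0"
    have "0 < \<Phi> (min a b)" using assms by (auto simp: min_def)
    also have "\<dots> \<le> \<Phi> y" using assms that by (intro \<Phi>_mono) auto
    also have "\<dots> \<le> 0" using \<open>u y = 0\<close> assms that by (auto simp: \<Phi>_def)
    finally show False by simp
  qed
  have *: "0 < u s \<longleftrightarrow> 0 < u t" if "min a b \<le> s" "s \<le> t" for s t
  proof (rule ccontr)
    assume c: "\<not> ?thesis"
    have co: "continuous_on {s..t} u" using that assms by (intro cont_on) auto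
    have "\<exists>y\<ge>s. y \<le> t \<and> u y = 0"
    proof (cases "0 < u s")
      case True
      then have "u t \<le> 0" using c by auto
      then show ?thesis using IVT2'[of u t 0 s, OF _ _ that(2) co] True by auto
    next
      case False
      then have "0 \<le> u t" using c by auto
      then show ?thesis using IVT'[of u s 0 t, OF _ _ that(2) co] False by auto
    qed
    then show False using nz that by (metis order_trans)
  qed
  show ?thesis
  proof (cases "a \<le> b")
    case True
    then show ?thesis by (intro *) auto
  next
    case False
    then have "0 < u b \<longleftrightarrow> 0 < u a" by (intro *) auto
    then show ?thesis by simp
  qed
qed

end

lemma shooting:
  fixes W :: "real \<Rightarrow> real"
  assumes W: "\<And>x. 0 < W x" "\<And>x. W x \<le> C" "\<And>x z. \<bar>W x - W z\<bar> \<le> C * \<bar>x - z\<bar>"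
    "\<And>x. 1 \<le> x \<Longrightarrow> W x \<le> 1"
  obtains f p u g \<kappa> where "0 < \<kappa>" "\<kappa> < sqrt 12" "weighted_film f p u g (\<lambda>y. W (f y)) \<kappa>"
    "\<And>y. 0 < y \<Longrightarrow> weighted_film.\<Phi> f p u g y \<le> 0"
proof -
  obtain f p u g where flow:
    "\<And>k y. k \<in> {0..4} \<Longrightarrow> 0 \<le> y \<Longrightarrow> (f k has_real_derivative p k y) (at y within {0..})"
    "\<And>k y. k \<in> {0..4} \<Longrightarrow> 0 \<le> y \<Longrightarrow> (p k has_real_derivative u k y) (at y within {0..})"
    "\<And>k y. k \<in> {0..4} \<Longrightarrow> 0 \<le> y \<Longrightarrow> (u k has_real_derivative g k y * W (f k y)) (at y within {0..})"
    "\<And>k y. k \<in> {0..4} \<Longrightarrow> 0 \<le> y \<Longrightarrow> (g k has_real_derivative y * p k y - f k y) (at y within {0..})"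
    "\<And>k. k \<in> {0..4} \<Longrightarrow> f k 0 = 1 \<and> p k 0 = 0 \<and> u k 0 = k \<and> g k 0 = 0"
    and flow_cont: "\<And>y. 0 \<le> y \<Longrightarrow> continuous_on {0..4} (\<lambda>k. f k y)"
    "\<And>y. 0 \<le> y \<Longrightarrow> continuous_on {0..4} (\<lambda>k. p k y)"
    "\<And>y. 0 \<le> y \<Longrightarrow> continuous_on {0..4} (\<lambda>k. u k y)"
    "\<And>y. 0 \<le> y \<Longrightarrow> continuous_on {0..4} (\<lambda>k. g k y)"
    by (rule truncated_flow[of W C]) (use W in \<open>auto intro: less_imp_le\<close>)
  have film: "weighted_film (f k) (p k) (u k) (g k) (\<lambda>y. W (f k y)) k" if "k \<in> {0..4}" for k
    using flow[OF that] W by unfold_locales auto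
  define P where "P = (\<lambda>k. weighted_film.\<Phi> (f k) (p k) (u k) (g k))"
  define I where "I = {0..sqrt 12}"
  have "sqrt 12 \<le> 4" by (rule real_le_lsqrt) auto
  then have I: "I \<subseteq> {0..4}" by (auto simp: I_def)
  have P: "P k y = u k y * g k y - (y * p k y - f k y)\<^sup>2 / (2 * y)" if "k \<in> I" for k y
    using weighted_film.\<Phi>_def[OF film] weighted_film.h_def[OF film] I that by (auto simp: P_def)
  have contP: "continuous_on I (\<lambda>k. P k y)" if "0 < y" for y
  proof -
    have "continuous_on I (\<lambda>k. u k y * g k y - (y * p k y - f k y)\<^sup>2 / (2 * y))"
      using that I by (intro continuous_intros continuous_on_subset[OF flow_cont(1)]
          continuous_on_subset[OF flow_cont(2)] continuous_on_subset[OF flow_cont(3)]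
          continuous_on_subset[OF flow_cont(4)]) auto
    then show ?thesis using P by (simp cong: continuous_on_cong)
  qed
  define A where "A = (\<Union>y\<in>{0<..}. {k \<in> I. 0 < P k y \<and> u k y < 0})"
  define B where "B = (\<Union>y\<in>{0<..}. {k \<in> I. 0 < P k y \<and> 0 < u k y})"
  \<comment> \<open>At one fixed \<open>y\<close> the condition is open in \<open>k\<close> by
    continuous dependence, and unions over \<open>y\<close> stay open. The factor \<open>s\<close>
    is -1 for \<open>A\<close> and 1 for \<open>B\<close>.\<close>
  have *: "openin (top_of_set I) {k \<in> I. 0 < P k y \<and> 0 < s * u k y}" if "0 < y" for y s :: real
  proof -
    have "openin (top_of_set I) (I \<inter> (\<lambda>k. (P k y, s * u k y)) -` ({0<..} \<times> {0<..}))"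
      using that I by (intro continuous_openin_preimage_gen open_Times continuous_on_Pair contP continuous_intros
          continuous_on_subset[OF flow_cont(3)]) auto
    also have "I \<inter> (\<lambda>k. (P k y, s * u k y)) -` ({0<..} \<times> {0<..}) = {k \<in> I. 0 < P k y \<and> 0 < s * u k y}" by auto
    finally show ?thesis .
  qed
  have "openin (top_of_set I) A" unfolding A_def
    using *[of _ "-1"] by (intro openin_Union) auto
  moreover have "openin (top_of_set I) B" unfolding B_def
    using *[of _ 1] by (intro openin_Union) auto
  moreover have "A \<inter> B = {}"
  proof -
    have False if "k \<in> I" "0 < a" "0 < P k a" "u k a < 0" "0 < b" "0 < P k b" "0 < u k b" for k a b
      using weighted_film.\<Phi>_pos_sign[OF film, of k a b] that I by (auto simp: P_def)
    then show ?thesis by (auto simp: A_def B_def)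
  qed
  moreover have "0 \<in> A"
    using weighted_film.\<kappa>_zero[OF film[of 0]] by (auto simp: A_def P_def I_def)
  moreover have "sqrt 12 \<in> B"
    using weighted_film.\<kappa>_large[OF film[of "sqrt 12"]] I W(4) by (auto simp: B_def P_def I_def)
  ultimately have "\<not> I \<subseteq> A \<union> B"
    using connected_Icc[of 0 "sqrt 12"] unfolding connected_openin I_def[symmetric] by blast
  then obtain k where k: "k \<in> I" "k \<notin> A" "k \<notin> B" by blast
  have "P k y \<le> 0" if "0 < y" for y
  proof (rule ccontr)
    assume pos: "\<not> P k y \<le> 0"
    moreover have "u k y \<noteq> 0"
    proof
      assume "u k y = 0"
      then have "P k y = - ((y * p k y - f k y)\<^sup>2 / (2 * y))" using P[OF k(1), of y] by simp
      also have "\<dots> \<le> 0" using that by simp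
      finally show False using pos by simp
    qed
    ultimately show False using k that by (force simp: A_def B_def)
  qed
  moreover have "k \<noteq> 0" "k \<noteq> sqrt 12" using k \<open>0 \<in> A\<close> \<open>sqrt 12 \<in> B\<close> by auto
  ultimately show ?thesis
    using that[of k "f k" "p k" "u k" "g k"] film[of k] k(1) I by (auto simp: P_def I_def)
qed

section \<open>Trapped orbits\<close>

text \<open>The minimum of \<open>r * A + B / r\<close> over \<open>r\<close> is 2 sqrt (A B).
  Inserting \<open>r = x / (2 * A)\<close> gives the same conclusion without a square root;
  \<open>A = 0\<close> needs a separate, sufficiently large \<open>r\<close>.\<close>

lemma le_of_forall_scaling:
  fixes x A B :: real
  assumes "0 \<le> A" "0 \<le> B" and le: "\<And>r. 0 < r \<Longrightarrow> x \<le> r * A + B / r" and "0 \<le> x"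
  shows "x\<^sup>2 \<le> 4 * A * B"
proof (cases "x = 0")
  case False
  then have x: "0 < x" using assms by simp
  show ?thesis
  proof (cases "A = 0")
    case True
    have "x \<le> B / ((2 * B + 1) / x)" using le[of "(2 * B + 1) / x"] True x \<open>0 \<le> B\<close> by simp
    then have "x * (2 * B + 1) \<le> x * B" using \<open>0 \<le> B\<close> x by (simp add: field_simps)
    then show ?thesis using x \<open>0 \<le> B\<close> by simp
  next
    case False
    then have A: "0 < A" using assms by simp
    have "x \<le> x / 2 + 2 * A * B / x" using le[of "x / (2 * A)"] A x by (simp add: field_simps)
    then show ?thesis using x by (simp add: field_simps power2_eq_square)
  qed
qed (use assms in simp)

text \<open>The tail bound makes the values at integers a Cauchy sequence and then carries both
  limit and rate over to real arguments.\<close>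

lemma tail_bound_limit:
  fixes G \<epsilon> :: "real \<Rightarrow> real"
  assumes tail: "\<And>a b. 1 \<le> a \<Longrightarrow> a \<le> b \<Longrightarrow> \<bar>G b - G a\<bar> \<le> \<epsilon> a"
    and \<epsilon>: "(\<epsilon> \<longlongrightarrow> 0) at_top"
  shows "\<exists>L. (G \<longlongrightarrow> L) at_top \<and> (\<forall>y\<ge>1. \<bar>G y - L\<bar> \<le> \<epsilon> y)"
proof -
  define X where "X = (\<lambda>n. G (real (Suc n)))"
  have "Cauchy X"
  proof (rule CauchyI')
    fix e :: real assume "0 < e"
    then have "eventually (\<lambda>y. \<epsilon> y < e) at_top" using \<epsilon> order_tendstoD(2) by fastforce
    then obtain N where N: "\<And>y. N \<le> y \<Longrightarrow> \<epsilon> y < e" by (auto simp: eventually_at_top_linorder)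
    show "\<exists>M. \<forall>m\<ge>M. \<forall>n>m. dist (X m) (X n) < e"
    proof (intro exI[of _ "nat \<lceil>N\<rceil>"] allI impI)
      fix m n assume "nat \<lceil>N\<rceil> \<le> m" "m < n"
      then have "N \<le> real (Suc m)" by linarith
      then show "dist (X m) (X n) < e"
        using N[of "real (Suc m)"] tail[of "real (Suc m)" "real (Suc n)"] \<open>m < n\<close>
        unfolding X_def by (simp add: dist_real_def abs_minus_commute)
    qed
  qed
  then obtain L where L: "X \<longlonglongrightarrow> L" using Cauchy_convergent_iff convergent_def by blast
  have rate: "\<bar>G y - L\<bar> \<le> \<epsilon> y" if "1 \<le> y" for y
  proof -
    have "\<bar>L - G y\<bar> \<le> \<epsilon> y"
    proof (rule tendsto_upperbound)
      show "(\<lambda>n. \<bar>X n - G y\<bar>) \<longlonglongrightarrow> \<bar>L - G y\<bar>" by (intro tendsto_intros L)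
      have "eventually (\<lambda>n. y \<le> real (Suc n)) sequentially"
        by (rule eventually_sequentiallyI[of "nat \<lceil>y\<rceil>"]) linarith
      then show "\<forall>\<^sub>F n in sequentially. \<bar>X n - G y\<bar> \<le> \<epsilon> y"
        by eventually_elim (use tail that in \<open>auto simp: X_def\<close>)
    qed simp
    then show ?thesis by (simp add: abs_minus_commute)
  qed
  have "(G \<longlongrightarrow> L) at_top"
  proof (rule Lim_transform2)
    show "((\<lambda>_. L) \<longlongrightarrow> L) at_top" by simp
    show "((\<lambda>y. L - G y) \<longlongrightarrow> 0) at_top"
    proof (rule Lim_null_comparison[OF _ \<epsilon>])
      show "\<forall>\<^sub>F y in at_top. norm (L - G y) \<le> \<epsilon> y"
        using eventually_ge_at_top[of 1] by eventually_elim (use rate in \<open>auto simp: abs_minus_commute\<close>)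
    qed
  qed
  then show ?thesis using rate by blast
qed

locale trapped_film = weighted_film +
  assumes \<kappa>_pos: "0 < \<kappa>" and \<Phi>_nonpos: "0 < y \<Longrightarrow> \<Phi> y \<le> 0"
begin

lemma no_cone:
  assumes "\<sigma> = 1 \<or> \<sigma> = -1" "0 < y" "0 < \<sigma> * u y" "0 < \<sigma> * g y" "0 < \<sigma> * h y"
  shows False
proof -
  obtain z where "y \<le> z" "0 < \<Phi> z" using cone_imp_\<Phi>_pos[OF assms] by blast
  then show False using \<Phi>_nonpos[of z] assms(2) by simp
qed

text \<open>The pointwise arithmetic-geometric mean inequality replaces Cauchy--Schwarz for
  \<open>\<integral> h y / y\<^sup>2\<close>, with \<open>\<Phi>\<close> controlling \<open>\<integral> (h y)\<^sup>2 / y\<^sup>2\<close>.\<close>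

lemma slope_oscillation:
  assumes "0 < a" "a \<le> b"
  shows "(f b / b - f a / a)\<^sup>2 \<le> 2 * - \<Phi> a / a"
proof -
  have *: "\<sigma> * (f b / b - f a / a) \<le> r * - \<Phi> a + (1 / (2 * a)) / r" if \<sigma>: "\<sigma>\<^sup>2 = 1" and r: "0 < r" for \<sigma> r
  proof -
    have "\<sigma> * (f b / b) - \<sigma> * (f a / a) \<le> (r * \<Phi> b - 1 / (2 * r * b)) - (r * \<Phi> a - 1 / (2 * r * a))"
    proof (rule compare_halfline[where f' = "\<lambda>y. \<sigma> * (h y / y\<^sup>2)" and
          g' = "\<lambda>y. r * ((g y)\<^sup>2 * w y + (h y)\<^sup>2 / (2 * y\<^sup>2)) + 1 / (2 * r * y\<^sup>2)"])
      fix x assume x: "a < x"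
      have "0 \<le> (r * h x - \<sigma>)\<^sup>2" by simp
      then have "2 * r * \<sigma> * h x \<le> r\<^sup>2 * (h x)\<^sup>2 + 1" using \<sigma> by (simp add: power2_eq_square algebra_simps)
      then have "2 * r * \<sigma> * h x / (2 * r * x\<^sup>2) \<le> (r\<^sup>2 * (h x)\<^sup>2 + 1) / (2 * r * x\<^sup>2)"
        using r by (intro divide_right_mono) auto
      moreover have "2 * r * \<sigma> * h x / (2 * r * x\<^sup>2) = \<sigma> * (h x / x\<^sup>2)" using r by simp
      moreover have "(r\<^sup>2 * (h x)\<^sup>2 + 1) / (2 * r * x\<^sup>2) = r * ((h x)\<^sup>2 / (2 * x\<^sup>2)) + 1 / (2 * r * x\<^sup>2)"
        using r x assms by (simp add: field_simps power2_eq_square)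
      moreover have "0 \<le> r * ((g x)\<^sup>2 * w x)" using r x assms w_pos[of x] by simp
      ultimately show "\<sigma> * (h x / x\<^sup>2) \<le> r * ((g x)\<^sup>2 * w x + (h x)\<^sup>2 / (2 * x\<^sup>2)) + 1 / (2 * r * x\<^sup>2)"
        by (simp add: distrib_left)
    next
      fix x assume x: "a \<le> x"
      then have "0 < x" using assms by simp
      then show "((\<lambda>y. \<sigma> * (f y / y)) has_real_derivative \<sigma> * (h x / x\<^sup>2)) (at x within {0..})"
        by (intro DERIV_cmult dF)
      show "((\<lambda>y. r * \<Phi> y - 1 / (2 * r * y)) has_real_derivative
          r * ((g x)\<^sup>2 * w x + (h x)\<^sup>2 / (2 * x\<^sup>2)) + 1 / (2 * r * x\<^sup>2)) (at x within {0..})"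
        using \<open>0 < x\<close> r by (auto intro!: derivative_eq_intros d\<Phi> simp: field_simps power2_eq_square)
    qed (use assms in auto)
    also have "\<dots> \<le> r * - \<Phi> a + 1 / (2 * r * a)"
    proof -
      have "r * \<Phi> b \<le> 0" "0 \<le> 1 / (2 * r * b)"
        using \<Phi>_nonpos[of b] assms r by (auto simp: mult_le_0_iff)
      then show ?thesis by linarith
    qed
    finally show ?thesis by (simp add: algebra_simps)
  qed
  have "\<bar>f b / b - f a / a\<bar>\<^sup>2 \<le> 4 * (- \<Phi> a) * (1 / (2 * a))"
  proof (rule le_of_forall_scaling)
    fix r :: real assume "0 < r"
    then show "\<bar>f b / b - f a / a\<bar> \<le> r * - \<Phi> a + 1 / (2 * a) / r"
      using *[of 1 r] *[of "-1" r] by (simp add: abs_le_iff)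
  qed (use \<Phi>_nonpos assms in auto)
  then show ?thesis by simp
qed

text \<open>Before the first zero of \<open>h\<close> one has \<open>g < 0\<close>, so a negative
  value of \<open>u\<close> would put the orbit into the negative cone, which a trapped orbit cannot
  enter. Hence \<open>u\<close> is nonnegative and nonincreasing, and \<open>p\<close> and
  \<open>f\<close> follow by integration from 0.\<close>

lemma phase:
  assumes t: "0 < t" and neg: "\<And>s. 0 \<le> s \<Longrightarrow> s < t \<Longrightarrow> h s < 0"
  shows phase_g: "0 < s \<Longrightarrow> s \<le> t \<Longrightarrow> g s < 0"
    and phase_u: "0 \<le> s \<Longrightarrow> s \<le> t \<Longrightarrow> 0 \<le> u s"
    and phase_u_mono: "0 \<le> s \<Longrightarrow> s \<le> r \<Longrightarrow> r \<le> t \<Longrightarrow> u r \<le> u s"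
    and phase_f: "0 \<le> s \<Longrightarrow> s \<le> t \<Longrightarrow> 1 \<le> f s"
    and phase_p: "0 < s \<Longrightarrow> s \<le> t \<Longrightarrow> s * u s < p s"
proof -
  show g: "g s < 0" if "0 < s" "s \<le> t" for s
    using compare_strict_halfline[of 0 s g h "\<lambda>_. 0" "\<lambda>_. 0"] that neg by (auto simp: init dg')
  have u': "0 \<le> u s" if "0 \<le> s" "s < t" for s
  proof (rule ccontr)
    assume "\<not> 0 \<le> u s"
    moreover have "s \<noteq> 0" using calculation \<kappa>_pos init by auto
    ultimately show False using no_cone[of "-1" s] g[of s] neg[of s] that by auto
  qed
  show u: "0 \<le> u s" if "0 \<le> s" "s \<le> t" for s
  proof (rule ccontr)
    assume c: "\<not> 0 \<le> u s"
    then have "s = t" using u'[of s] that by force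
    have "\<exists>x\<ge>0. x \<le> t \<and> u x = u t / 2"
      using c \<kappa>_pos t \<open>s = t\<close> by (intro IVT2' cont_on(3)) (auto simp: init)
    then obtain x where x: "0 \<le> x" "x \<le> t" "u x = u t / 2" by blast
    then show False using u'[of x] c \<open>s = t\<close> by (cases "x = t") auto
  qed
  show "u r \<le> u s" if "0 \<le> s" "s \<le> r" "r \<le> t" for s r
  proof -
    have "u r - u s \<le> 0 - 0"
    proof (rule compare_halfline[where f = u and g = "\<lambda>_. 0" and f' = "\<lambda>y. g y * w y" and g' = "\<lambda>_. 0"])
      fix x assume "s < x" "x < r"
      then show "g x * w x \<le> 0" using g[of x] w_pos[of x] that by (auto simp: mult_le_0_iff)
    qed (use that in \<open>auto simp: du\<close>)
    then show ?thesis by simp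
  qed
  have p: "0 \<le> p s" if "0 \<le> s" "s \<le> t" for s
    using compare_halfline[of 0 s "\<lambda>_. 0" "\<lambda>_. 0" p u] that u by (auto simp: init dp)
  show "1 \<le> f s" if "0 \<le> s" "s \<le> t" for s
    using compare_halfline[of 0 s "\<lambda>_. 0" "\<lambda>_. 0" f p] that p by (auto simp: init df)
  show "s * u s < p s" if s: "0 < s" "s \<le> t" for s
  proof -
    have "0 - 0 < (p s - s * u s) - (p 0 - 0 * u 0)"
    proof (rule compare_strict_halfline[where f = "\<lambda>_. 0" and g = "\<lambda>s. p s - s * u s" and
          f' = "\<lambda>_. 0" and g' = "\<lambda>s. - s * (g s * w s)"])
      fix x assume "0 < x" "x < s"
      then have "0 < x * (- g x * w x)" using g[of x] s w_pos[of x] by (intro mult_pos_pos) auto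
      then show "0 < - x * (g x * w x)" by simp
    qed (use s in \<open>auto intro!: derivative_eq_intros dp du\<close>)
    then show ?thesis by (simp add: init)
  qed
qed

lemma turn_cases:
  obtains "\<And>s. 0 \<le> s \<Longrightarrow> h s < 0"
  | t where "0 < t" "h t = 0" "\<And>s. 0 \<le> s \<Longrightarrow> s < t \<Longrightarrow> h s < 0"
proof (cases "\<forall>s\<ge>0. h s < 0")
  case False
  then obtain b where b: "0 \<le> b" "0 \<le> h b" by force
  obtain t where "0 < t" "- h t = 0" "\<And>s. 0 \<le> s \<Longrightarrow> s < t \<Longrightarrow> 0 < - h s"
    by (rule first_zero[OF continuous_on_minus[OF cont_on(5)], of 0 b]) (use b h0 in auto)
  then show thesis using that(2)[of t] by auto
qed (use that(1) in auto)

text \<open>At \<open>t\<close> the quadratic term of \<Phi> vanishes and \<Phi> is the product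
  \<open>u t * g t\<close>. Integrating \<open>u s \<ge> u t\<close> twice bounds
  \<open>- g t\<close> in terms of \<open>u t\<close>, so only one unknown is left.\<close>

lemma turn:
  assumes t: "0 < t" "h t = 0" and neg: "\<And>s. 0 \<le> s \<Longrightarrow> s < t \<Longrightarrow> h s < 0"
  shows turn_f: "2 \<le> f t"
    and turn_g: "- t \<le> g t"
    and turn_osc: "t \<le> y \<Longrightarrow> (f y / y - f t / t)\<^sup>2 \<le> 2 / 3 * (f t / t)\<^sup>2"
proof -
  note ph = phase[OF t(1) neg, simplified]
  \<comment> \<open>This function starts at 1 and has derivative \<open>(p - s * u) / 2\<close>,
    nonnegative by \<open>phase_p\<close>; hence \<open>t * p t \<ge> 2\<close>, and
    \<open>f t = t * p t\<close> at a zero of \<open>h\<close>.\<close>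
  have "0 / 2 * p 0 - h 0 \<le> t / 2 * p t - h t"
  proof (rule mono_halfline[where f = "\<lambda>s. s / 2 * p s - h s" and f' = "\<lambda>s. (p s - s * u s) / 2"])
    fix x assume "0 < x" "x < t"
    then show "0 \<le> (p x - x * u x) / 2" using ph(5)[of x] by simp
  qed (use t in \<open>auto intro!: derivative_eq_intros dp dh simp: field_simps\<close>)
  then have "2 \<le> t * p t" using h0 t by simp
  then show f: "2 \<le> f t" using t by (simp add: h_def)
  have ul: "u t \<le> u s" if "0 \<le> s" "s \<le> t" for s using ph(3)[of s t] that by simp
  have hl: "-1 + u t * s\<^sup>2 / 2 \<le> h s" if "0 \<le> s" "s \<le> t" for s
  proof -
    have "u t * s\<^sup>2 / 2 - u t * 0\<^sup>2 / 2 \<le> h s - h 0"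
    proof (rule compare_halfline[where f = "\<lambda>s. u t * s\<^sup>2 / 2" and g = h and f' = "\<lambda>s. s * u t" and g' = "\<lambda>s. s * u s"])
      fix x assume "0 < x" "x < s"
      then show "x * u t \<le> x * u x" using ul[of x] that by (intro mult_left_mono) auto
    qed (use that in \<open>auto intro!: derivative_eq_intros dh\<close>)
    then show ?thesis by (simp add: h0)
  qed
  have gl: "- t + u t * t^3 / 6 \<le> g t"
  proof -
    have "(- t + u t * t^3 / 6) - (- 0 + u t * 0^3 / 6) \<le> g t - g 0"
      by (rule compare_halfline[where f = "\<lambda>s. - s + u t * s^3 / 6" and g = g and
          f' = "\<lambda>s. -1 + u t * s\<^sup>2 / 2" and g' = h])
        (use t hl in \<open>auto intro!: derivative_eq_intros dg'\<close>)
    then show ?thesis by (simp add: init)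
  qed
  have ut: "0 \<le> u t" using ph(2)[of t] t by simp
  have "0 \<le> u t * t^3 / 6" using ut t by simp
  then show "- t \<le> g t" using gl by linarith
  \<comment> \<open>Curvature at \<open>t\<close> in scale-free form. The bound by 1 is
    \<open>hl\<close> at \<open>t\<close>, where \<open>h t = 0\<close>; on [0, 1] the function z -
    z^2 / 3 is largest at 1, whence the constant 2/3.\<close>
  define z where "z = u t * t\<^sup>2 / 2"
  have z: "0 \<le> z" "z \<le> 1" using hl[of t] t ut by (auto simp: z_def)
  show "(f y / y - f t / t)\<^sup>2 \<le> 2 / 3 * (f t / t)\<^sup>2" if "t \<le> y"
  proof -
    have "(f y / y - f t / t)\<^sup>2 \<le> 2 * - \<Phi> t / t" using slope_oscillation[of t y] t that by simp
    also have "\<dots> = 2 * u t * - g t / t" by (simp add: \<Phi>_def t)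
    also have "\<dots> \<le> 2 * u t * (t - u t * t^3 / 6) / t"
      using gl ut t by (intro divide_right_mono mult_left_mono) auto
    also have "\<dots> = 4 * (z - z\<^sup>2 / 3) / t\<^sup>2"
      using t by (simp add: z_def field_simps power2_eq_square power3_eq_cube)
    also have "\<dots> \<le> 4 * (2 / 3) / t\<^sup>2"
    proof (intro divide_right_mono mult_left_mono)
      have "0 \<le> (1 - z) * (2 - z)" using z by (intro mult_nonneg_nonneg) auto
      then show "z - z\<^sup>2 / 3 \<le> 2 / 3" by (simp add: algebra_simps power2_eq_square)
    qed auto
    also have "\<dots> = 2 / 3 * (2 / t)\<^sup>2" by (simp add: power_divide)
    also have "\<dots> \<le> 2 / 3 * (f t / t)\<^sup>2"
      using f t by (intro mult_left_mono power_mono divide_right_mono) auto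
    finally show ?thesis .
  qed
qed

text \<open>41/50 is a rational number slightly above sqrt (2/3), and 9/50 and 91/50 are 1 - 41/50
  and 1 + 41/50.\<close>

lemma turn_slope_bounds:
  assumes t: "0 < t" "h t = 0" and neg: "\<And>s. 0 \<le> s \<Longrightarrow> s < t \<Longrightarrow> h s < 0" and "t \<le> y"
  shows "(9/50) * (f t / t) \<le> f y / y" "f y / y \<le> (91/50) * (f t / t)"
proof -
  have F: "0 < f t / t" using turn_f[OF t neg] t by simp
  have "(f y / y - f t / t)\<^sup>2 \<le> 2 / 3 * (f t / t)\<^sup>2" by (rule turn_osc[OF t neg \<open>t \<le> y\<close>])
  also have "\<dots> \<le> (41/50)\<^sup>2 * (f t / t)\<^sup>2" by (intro mult_right_mono) (simp_all add: power2_eq_square)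
  also have "\<dots> = ((41/50) * (f t / t))\<^sup>2" by (rule power_mult_distrib[symmetric])
  finally have "\<bar>f y / y - f t / t\<bar> \<le> (41/50) * (f t / t)"
    using F by (simp add: abs_le_square_iff[symmetric])
  then show "(9/50) * (f t / t) \<le> f y / y" "f y / y \<le> (91/50) * (f t / t)" by (auto simp: abs_le_iff)
qed

text \<open>Before the turn \<open>f \<ge> 1\<close>; after it
  \<open>f y \<ge> (9/25) * (y / t)\<close>, because \<open>f t \<ge> 2\<close>. The level 1/3 is
  what must stay above the later truncation level 1/4.\<close>

lemma f_lower:
  assumes "0 \<le> y"
  shows "1 / 3 \<le> f y"
proof (rule turn_cases)
  assume "\<And>s. 0 \<le> s \<Longrightarrow> h s < 0"
  then show ?thesis using phase_f[of "y + 1" y] assms by auto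
next
  fix t assume t: "0 < t" "h t = 0" "\<And>s. 0 \<le> s \<Longrightarrow> s < t \<Longrightarrow> h s < 0"
  show ?thesis
  proof (cases "y \<le> t")
    case True
    then show ?thesis using phase_f[of t y] t assms by auto
  next
    case False
    have "(9/25) / t \<le> (9/50) * (f t / t)" using turn_f[OF t] t by (simp add: field_simps)
    also have "\<dots> \<le> f y / y" using turn_slope_bounds(1)[OF t, of y] False by simp
    finally have "(9/25) * (y / t) \<le> f y" using False t by (simp add: field_simps)
    moreover have "1 \<le> y / t" using False t by simp
    ultimately show ?thesis by linarith
  qed
qed

text \<open>The last conclusion is \<open>slope_oscillation\<close> with its right endpoint sent to
  infinity; it is later evaluated at a zero of \<open>u\<close>.\<close>

lemma slope_limit:
  obtains a C where "0 < a" "((\<lambda>y. f y / y) \<longlongrightarrow> a) at_top"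
    "\<And>y. 1 \<le> y \<Longrightarrow> \<bar>f y / y - a\<bar> \<le> C / sqrt y"
    "\<And>y. 0 < y \<Longrightarrow> (a - f y / y)\<^sup>2 \<le> 2 * - \<Phi> y / y"
proof -
  define C where "C = sqrt (2 * - \<Phi> 1)"
  have osc: "\<bar>f b / b - f a / a\<bar> \<le> C / sqrt a" if "1 \<le> a" "a \<le> b" for a b
  proof -
    have "(f b / b - f a / a)\<^sup>2 \<le> 2 * - \<Phi> a / a" using slope_oscillation that by simp
    also have "\<dots> \<le> 2 * - \<Phi> 1 / a" using \<Phi>_mono[of 1 a] that by (intro divide_right_mono) auto
    finally show ?thesis
      unfolding C_def real_sqrt_divide[symmetric] by (simp add: real_le_rsqrt)
  qed
  have lim0: "((\<lambda>y. C / sqrt y) \<longlongrightarrow> 0) at_top"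
    by (intro tendsto_divide_0[OF tendsto_const] filterlim_at_top_imp_at_infinity sqrt_at_top)
  obtain a where lim: "((\<lambda>y. f y / y) \<longlongrightarrow> a) at_top"
    and rate: "\<And>y. 1 \<le> y \<Longrightarrow> \<bar>f y / y - a\<bar> \<le> C / sqrt y"
    using tail_bound_limit[of "\<lambda>y. f y / y", OF osc lim0] by blast
  have sq: "(a - f y / y)\<^sup>2 \<le> 2 * - \<Phi> y / y" if "0 < y" for y
  proof (rule tendsto_upperbound)
    show "((\<lambda>x. (f x / x - f y / y)\<^sup>2) \<longlongrightarrow> (a - f y / y)\<^sup>2) at_top" by (intro tendsto_intros lim)
    show "\<forall>\<^sub>F x in at_top. (f x / x - f y / y)\<^sup>2 \<le> 2 * - \<Phi> y / y"
      using eventually_ge_at_top[of y] by eventually_elim (use slope_oscillation[of y] that in auto)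
  qed simp
  have lower: "c \<le> a" if "\<And>y. b \<le> y \<Longrightarrow> c \<le> f y / y" for b c
    by (rule tendsto_lowerbound[OF lim]) (use that in \<open>auto simp: eventually_at_top_linorder\<close>)
  have "0 < a"
  proof (rule turn_cases)
    fix t assume t: "0 < t" "h t = 0" "\<And>s. 0 \<le> s \<Longrightarrow> s < t \<Longrightarrow> h s < 0"
    have "0 < (9/50) * (f t / t)" using turn_f[OF t] t by simp
    also have "\<dots> \<le> a" by (rule lower[of t]) (use turn_slope_bounds(1)[OF t] in auto)
    finally show ?thesis .
  next
    \<comment> \<open>Without a turn \<open>f\<close> is convex on the whole half-line, so its
      positive slope at 1 forces linear growth.\<close>
    assume neg: "\<And>s. 0 \<le> s \<Longrightarrow> h s < 0"
    have u: "0 \<le> u s" if "0 \<le> s" for s using phase_u[of "s + 1" s] neg that by auto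
    have p: "0 < p 1" using phase_p[of 1 1] neg u[of 1] by auto
    have pm: "p 1 \<le> p s" if "1 \<le> s" for s
      by (rule mono_halfline[of 1 s p u]) (use that u in \<open>auto simp: dp\<close>)
    have "p 1 / 2 \<le> f y / y" if "2 \<le> y" for y
    proof -
      have "p 1 * y - p 1 * 1 \<le> f y - f 1"
        by (rule compare_halfline[where f = "\<lambda>y. p 1 * y" and g = f and f' = "\<lambda>_. p 1" and g' = p])
           (use that pm in \<open>auto intro!: derivative_eq_intros df\<close>)
      moreover have "1 \<le> f 1" using phase_f[of 1 1] neg by auto
      moreover have "p 1 * 2 \<le> p 1 * y" using p that by (intro mult_left_mono) auto
      ultimately have "p 1 * y / 2 \<le> f y" by linarith
      then show ?thesis using that by (simp add: field_simps)
    qed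
    then have "p 1 / 2 \<le> a" by (rule lower)
    then show ?thesis using p by simp
  qed
  then show ?thesis using that lim rate sq by blast
qed

end

section \<open>An upper bound for the limiting slope when m = 4\<close>

context trapped_film begin

lemma phase_u_strict:
  assumes t: "0 < t" and neg: "\<And>s. 0 \<le> s \<Longrightarrow> s < t \<Longrightarrow> h s < 0" and s: "0 \<le> s" "s < t"
  shows "0 < u s"
proof -
  have "u t - u s < 0 - 0"
  proof (rule compare_strict_halfline[where f = u and g = "\<lambda>_. 0" and f' = "\<lambda>y. g y * w y" and g' = "\<lambda>_. 0"])
    fix x assume "s < x" "x < t"
    then show "g x * w x < 0" using phase_g[OF t neg, of x] w_pos[of x] s by (auto simp: mult_neg_pos)
  qed (use s in \<open>auto simp: du\<close>)
  then show ?thesis using phase_u[OF t neg, of t] t by simp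
qed

lemma phase_p_pos:
  assumes t: "0 < t" and neg: "\<And>s. 0 \<le> s \<Longrightarrow> s < t \<Longrightarrow> h s < 0"
  shows "0 < p t" "-1 < h t"
proof -
  have "0 \<le> t * u t" using phase_u[OF t neg, of t] t by simp
  then show "0 < p t" using phase_p[OF t neg, of t] t by linarith
  have "0 - 0 < h t - h 0"
  proof (rule compare_strict_halfline[where f = "\<lambda>_. 0" and g = h and f' = "\<lambda>_. 0" and g' = "\<lambda>y. y * u y"])
    fix x assume "0 < x" "x < t"
    then show "0 < x * u x" using phase_u_strict[OF t neg, of x] by simp
  qed (use t in \<open>auto simp: dh\<close>)
  then show "-1 < h t" by (simp add: h0)
qed

end

locale quartic_film = trapped_film +
  assumes w_eq: "0 \<le> y \<Longrightarrow> w y = 1 / (f y)^4"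
begin

lemma f_pos: "0 \<le> y \<Longrightarrow> 0 < f y"
  using f_lower[of y] by linarith

text \<open>The second bound is the tangent line of the convex function \<open>f\<close> at
  \<open>Y\<close>.\<close>

lemma convex_bounds:
  assumes Y: "0 < Y" and u: "\<And>s. 0 \<le> s \<Longrightarrow> s \<le> Y \<Longrightarrow> 0 \<le> u s" and s: "0 \<le> s" "s \<le> Y"
  shows "1 \<le> f s" "p Y * s - h Y \<le> f s"
proof -
  have p: "0 \<le> p x" if "0 \<le> x" "x \<le> Y" for x
    using compare_halfline[of 0 x "\<lambda>_. 0" "\<lambda>_. 0" p u] that u by (auto simp: init dp)
  show "1 \<le> f s"
    using compare_halfline[of 0 s "\<lambda>_. 0" "\<lambda>_. 0" f p] s p by (auto simp: init df)
  have pY: "p x \<le> p Y" if "0 \<le> x" "x \<le> Y" for x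
    by (rule mono_halfline[of x Y p u]) (use that u in \<open>auto simp: dp\<close>)
  have "f Y - f s \<le> p Y * Y - p Y * s"
    by (rule compare_halfline[where f = f and g = "\<lambda>x. p Y * x" and f' = p and g' = "\<lambda>_. p Y"])
       (use s pY in \<open>auto intro!: derivative_eq_intros df\<close>)
  then show "p Y * s - h Y \<le> f s" by (simp add: h_def algebra_simps)
qed

text \<open>The quantity \<open>p u + g / (3 f\<^sup>3) + y / (6 f\<^sup>2)\<close> has derivative \<open>u\<^sup>2 - 1 / (6 f\<^sup>2)\<close> (entropy
  dissipation for the mobility \<open>f\<^sup>4\<close>). The integral of \<open>u\<^sup>2\<close> is bounded below by testing
  against the positive part of \<open>\<lambda> - \<mu> y\<close>, that of \<open>1 / f\<^sup>2\<close> above by convexity.\<close>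

lemma entropy_bound:
  assumes Y: "0 < Y" and u: "\<And>s. 0 \<le> s \<Longrightarrow> s \<le> Y \<Longrightarrow> 0 \<le> u s"
    and gY: "g Y \<le> 0" and pY: "0 < p Y" and hY: "-1 < h Y"
  shows "4 * (p Y)^4 / 9 \<le> (1 + h Y) * ((p Y)\<^sup>2 * u Y + (2 + h Y + h Y / (f Y)\<^sup>2) / 6)"
proof -
  define P where "P = p Y"
  define H where "H = h Y"
  \<comment> \<open>\<open>P\<close> and \<open>x\<close> are the integrals of \<open>u\<close> and
    of \<open>s * u s\<close> over [0, Y], because \<open>p 0 = 0\<close>, \<open>h' = y * u\<close>
    and \<open>h 0 = -1\<close>.\<close>
  define x where "x = 1 + H"
  have P: "0 < P" and x: "0 < x" using pY hY by (auto simp: P_def H_def x_def)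
  note cb = convex_bounds[OF Y u, folded P_def H_def]
  have f0: "f s \<noteq> 0" if "0 \<le> s" for s using f_pos[OF that] by simp
  have fY: "P * Y - H = f Y" by (simp add: P_def H_def h_def mult.commute)
  define Iu where "Iu = (\<lambda>y. integral {0..y} (\<lambda>s. (u s)\<^sup>2))"
  define If where "If = (\<lambda>y. integral {0..y} (\<lambda>s. 1 / (f s)\<^sup>2))"
  have dIu: "(Iu has_real_derivative (u y)\<^sup>2) (at y within {0..})" if "0 \<le> y" for y
    unfolding Iu_def has_real_derivative_iff_has_vector_derivative
    by (rule antiderivative_halfline) (use that in \<open>auto intro!: continuous_intros cont\<close>)
  have dIf: "(If has_real_derivative 1 / (f y)\<^sup>2) (at y within {0..})" if "0 \<le> y" for y
    unfolding If_def has_real_derivative_iff_has_vector_derivative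
    by (rule antiderivative_halfline) (use that f0 in \<open>auto intro!: continuous_intros cont\<close>)
  have [simp]: "Iu 0 = 0" "If 0 = 0" by (auto simp: Iu_def If_def)
  define E where "E = (\<lambda>y. p y * u y + g y / (3 * (f y)^3) + y / (6 * (f y)\<^sup>2))"
  have dE: "(E has_real_derivative (u y)\<^sup>2 - 1 / ((f y)\<^sup>2 * 6)) (at y within {0..})" if "0 \<le> y" for y
  proof -
    have "(E has_real_derivative u y * u y + p y * (g y * w y)
        + (h y * (3 * (f y)^3) - g y * (3 * (3 * (f y)\<^sup>2 * p y))) / (3 * (f y)^3)\<^sup>2
        + (1 * (6 * (f y)\<^sup>2) - y * (6 * (2 * f y * p y))) / (6 * (f y)\<^sup>2)\<^sup>2) (at y within {0..})"
      unfolding E_def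
      by (auto intro!: derivative_eq_intros dp du dg' df that simp: f0 that power2_eq_square mult_ac)
    moreover have "u y * u y + p y * (g y * w y)
        + (h y * (3 * (f y)^3) - g y * (3 * (3 * (f y)\<^sup>2 * p y))) / (3 * (f y)^3)\<^sup>2
        + (1 * (6 * (f y)\<^sup>2) - y * (6 * (2 * f y * p y))) / (6 * (f y)\<^sup>2)\<^sup>2 = (u y)\<^sup>2 - 1 / ((f y)\<^sup>2 * 6)"
      using f0[OF that] unfolding w_eq[OF that] h_def
      by (simp add: divide_simps) (simp add: algebra_simps eval_nat_numeral)
    ultimately show ?thesis by simp
  qed
  have "(Iu Y - If Y / 6) - (Iu 0 - If 0 / 6) \<le> E Y - E 0"
    by (rule compare_halfline[where f = "\<lambda>y. Iu y - If y / 6" and g = E and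
          f' = "\<lambda>y. (u y)\<^sup>2 - 1 / ((f y)\<^sup>2 * 6)" and g' = "\<lambda>y. (u y)\<^sup>2 - 1 / ((f y)\<^sup>2 * 6)"])
       (use Y in \<open>auto intro!: derivative_eq_intros dIu dIf dE\<close>)
  then have "Iu Y \<le> E Y + If Y / 6" by (simp add: E_def init)
  also have "E Y \<le> P * u Y + Y / (6 * (f Y)\<^sup>2)"
    using gY f_pos[of Y] Y by (simp add: E_def P_def divide_nonpos_pos)
  finally have upper: "Iu Y \<le> P * u Y + Y / (6 * (f Y)\<^sup>2) + If Y / 6" by simp
  have If_le: "If Y \<le> (2 + H - 1 / f Y) / P"
  proof -
    \<comment> \<open>The point where the tangent line at \<open>Y\<close> has height 1: to its left
      \<open>f \<ge> 1\<close> is the better lower bound, to its right the tangent.\<close>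
    define c where "c = x / P"
    have "1 \<le> f Y" using cb(1)[of Y] Y by simp
    then have c: "0 < c" "c \<le> Y" using P x fY by (auto simp: c_def x_def field_simps)
    have "If c - If 0 \<le> c - 0"
      by (rule compare_halfline[where f = If and g = "\<lambda>x. x" and f' = "\<lambda>y. 1 / (f y)\<^sup>2" and g' = "\<lambda>_. 1"])
         (use c cb(1) in \<open>auto intro!: derivative_eq_intros dIf simp: divide_le_eq_1\<close>)
    moreover have "If Y - If c \<le> - 1 / (P * (P * Y - H)) - - 1 / (P * (P * c - H))"
    proof (rule compare_halfline[where f = If and g = "\<lambda>s. - 1 / (P * (P * s - H))" and
            f' = "\<lambda>y. 1 / (f y)\<^sup>2" and g' = "\<lambda>s. 1 / (P * s - H)\<^sup>2"])
      fix s assume s: "c \<le> s" "s \<le> Y"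
      have "1 \<le> P * s - H" using s P by (simp add: c_def x_def field_simps)
      then show "((\<lambda>s. - 1 / (P * (P * s - H))) has_real_derivative 1 / (P * s - H)\<^sup>2) (at s within {0..})"
        using P by (auto intro!: derivative_eq_intros simp: divide_simps power2_eq_square)
    next
      fix s assume s: "c < s" "s < Y"
      have "1 \<le> P * s - H" using s P by (simp add: c_def x_def field_simps)
      then show "1 / (f s)\<^sup>2 \<le> 1 / (P * s - H)\<^sup>2"
        using cb(2)[of s] s c by (intro divide_left_mono power_mono mult_pos_pos) auto
    qed (use c in \<open>auto intro!: dIf\<close>)
    moreover have "P * c - H = 1" using P by (simp add: c_def x_def)
    ultimately have "If Y \<le> c - 1 / (P * f Y) + 1 / P" by (simp add: fY)
    also have "\<dots> = (2 + H - 1 / f Y) / P" using P f0[of Y] Y by (simp add: c_def x_def field_simps)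
    finally show ?thesis .
  qed
  \<comment> \<open>These values maximize 2 (l P - \<mu> x) - l^3 / (3 \<mu>), the lower bound that
    the test function gives for the integral of u^2; the maximum is 4 P^3 / (9 x).\<close>
  define l where "l = 2 * P\<^sup>2 / (3 * x)"
  define \<mu> where "\<mu> = 2 * P^3 / (9 * x\<^sup>2)"
  have l: "0 < l" and \<mu>: "0 < \<mu>" using P x by (auto simp: l_def \<mu>_def)
  define T where "T = (\<lambda>y. 2 * (l * p y - \<mu> * (1 + h y)))"
  define S where "S = (\<lambda>y. (l - \<mu> * y)^3 / (3 * \<mu>))"
  have dT: "(T has_real_derivative 2 * (u y * (l - \<mu> * y))) (at y within {0..})" if "0 \<le> y" for y
    unfolding T_def by (auto intro!: derivative_eq_intros dp dh that simp: algebra_simps)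
  have dS: "(S has_real_derivative - ((l - \<mu> * y)\<^sup>2)) (at y within {0..})" for y
    unfolding S_def using \<mu> by (auto intro!: derivative_eq_intros simp: field_simps power2_eq_square power3_eq_cube)
  have TS: "(T b + S b) - (T 0 + S 0) \<le> Iu b - Iu 0" if "0 \<le> b" for b
  proof (rule compare_halfline[where f = "\<lambda>y. T y + S y" and g = Iu and
        f' = "\<lambda>y. 2 * (u y * (l - \<mu> * y)) + - ((l - \<mu> * y)\<^sup>2)" and g' = "\<lambda>y. (u y)\<^sup>2"])
    fix y
    have "2 * (a * c) + - (c\<^sup>2) \<le> a\<^sup>2" for a c :: real
      using zero_le_power2[of "a - c"] by (simp add: power2_diff)
    then show "2 * (u y * (l - \<mu> * y)) + - ((l - \<mu> * y)\<^sup>2) \<le> (u y)\<^sup>2" .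
  qed (use that in \<open>auto intro!: dIu DERIV_cong[OF DERIV_add[OF dT dS]]\<close>)
  have T0: "T 0 = 0" by (simp add: T_def init h0)
  have "T Y - S 0 \<le> Iu Y"
  proof (cases "\<mu> * Y \<le> l")
    case True
    then have "0 \<le> S Y" using \<mu> by (simp add: S_def)
    then show ?thesis using TS[of Y] T0 Y by simp
  next
    case False
    \<comment> \<open>Past its zero \<open>b\<close> the test function is replaced by 0. There
      \<open>T\<close> can only decrease, because \<open>u\<close> is nonnegative.\<close>
    define b where "b = l / \<mu>"
    have b: "0 < b" "b < Y" "\<mu> * b = l" using l \<mu> False by (auto simp: b_def field_simps)
    have "T Y - T b \<le> Iu Y - Iu b"
    proof (rule compare_halfline[where f = T and g = Iu and
          f' = "\<lambda>y. 2 * (u y * (l - \<mu> * y))" and g' = "\<lambda>y. (u y)\<^sup>2"])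
      fix y assume y: "b < y" "y < Y"
      then have "l \<le> \<mu> * y" using b \<mu> by (simp flip: b(3))
      then have "u y * (l - \<mu> * y) \<le> 0" using u[of y] y b by (simp add: mult_le_0_iff)
      then show "2 * (u y * (l - \<mu> * y)) \<le> (u y)\<^sup>2" by (smt (verit) zero_le_power2)
    qed (use b(1,2) in \<open>auto intro!: dT dIu\<close>)
    moreover have "S b = 0" using b by (simp add: S_def)
    ultimately show ?thesis using TS[of b] b T0 by simp
  qed
  moreover have "T Y - S 0 = 4 * P^3 / (9 * x)"
  proof -
    have "T Y = 2 * (l * P - \<mu> * x)" by (simp add: T_def P_def x_def H_def)
    moreover have "l * P = 2 * P^3 / (3 * x)" "\<mu> * x = 2 * P^3 / (9 * x)"
      using x by (simp_all add: l_def \<mu>_def power2_eq_square power3_eq_cube)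
    moreover have "S 0 = 4 * P^3 / (9 * x)"
      using P x by (simp add: S_def l_def \<mu>_def field_simps eval_nat_numeral)
    ultimately have "T Y - S 0 = 2 * (2 * P^3 / (3 * x) - 2 * P^3 / (9 * x)) - 4 * P^3 / (9 * x)" by simp
    also have "\<dots> = 4 * P^3 / (9 * x)" using x by (simp add: field_simps)
    finally show ?thesis .
  qed
  ultimately have "4 * P^3 / (9 * x) \<le> Iu Y" by simp
  also note upper
  also have "P * u Y + Y / (6 * (f Y)\<^sup>2) + If Y / 6 \<le> P * u Y + Y / (6 * (f Y)\<^sup>2) + (2 + H - 1 / f Y) / P / 6"
    by (intro add_left_mono divide_right_mono If_le) simp
  also have "\<dots> = (P\<^sup>2 * u Y + (2 + H + H / (f Y)\<^sup>2) / 6) / P"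
  proof -
    \<comment> \<open>The point \<open>Y\<close> is eliminated through
      \<open>P * Y - H = f Y\<close>.\<close>
    have "P * v + y / (6 * \<phi>\<^sup>2) + (2 + H - 1 / \<phi>) / P / 6 = (P\<^sup>2 * v + (2 + H + H / \<phi>\<^sup>2) / 6) / P"
      if "P * y - H = \<phi>" "\<phi> \<noteq> 0" for v y \<phi>
    proof -
      have y: "y = (\<phi> + H) / P" using P that by (simp add: field_simps)
      show ?thesis unfolding y using P that(2) by (simp add: field_simps power2_eq_square)
    qed
    then show ?thesis using fY f0[of Y] Y by simp
  qed
  finally have "4 * P^3 / (9 * x) * (x * P) \<le> (P\<^sup>2 * u Y + (2 + H + H / (f Y)\<^sup>2) / 6) / P * (x * P)"
    using P x by (intro mult_right_mono) auto
  moreover have "4 * P^3 / (9 * x) * (x * P) = 4 * P^4 / 9" using x by (simp add: eval_nat_numeral)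
  moreover have "(P\<^sup>2 * u Y + (2 + H + H / (f Y)\<^sup>2) / 6) / P * (x * P)
      = x * (P\<^sup>2 * u Y + (2 + H + H / (f Y)\<^sup>2) / 6)" using P by simp
  ultimately have "4 * P^4 / 9 \<le> x * (P\<^sup>2 * u Y + (2 + H + H / (f Y)\<^sup>2) / 6)" by (simp only:)
  then show ?thesis by (simp only: P_def H_def x_def)
qed

text \<open>29/20 = 1.45 lies just below (11/10)^4 = 1.4641.\<close>

lemma le_by_fourth_power:
  assumes "(x::real)^4 \<le> 29/20"
  shows "x \<le> 11/10"
proof (rule ccontr)
  assume "\<not> x \<le> 11/10"
  then have "(11/10)^4 < x^4" by (intro power_strict_mono) auto
  then show False using assms by (simp add: power_divide)
qed

text \<open>Here -1 < h < 0, so \<open>p\<close> has the same limit as \<open>f y / y\<close>, and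
  \<open>u y < p y / y\<close> removes the curvature term of \<open>entropy_bound\<close>. In the
  limit 4 a^4 / 9 \<le> 1/3.\<close>

lemma slope_bound_no_turn:
  assumes lim: "((\<lambda>y. f y / y) \<longlongrightarrow> a) at_top" and neg: "\<And>s. 0 \<le> s \<Longrightarrow> h s < 0"
  shows "a \<le> 11/10"
proof -
  have le: "4 * (p y)^4 / 9 \<le> (p y)^3 * (1 / y) + 1 / 3" if "1 \<le> y" for y
  proof -
    have y: "0 < y" using that by simp
    have neg': "\<And>s. 0 \<le> s \<Longrightarrow> s < y \<Longrightarrow> h s < 0" using neg by simp
    note P = phase_p_pos[OF y neg']
    have u: "0 \<le> u s" if "0 \<le> s" "s \<le> y" for s using phase_u[OF y neg'] that by simp
    have f: "1 \<le> f y" using phase_f[OF y neg'] y by simp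
    have "4 * (p y)^4 / 9 \<le> (1 + h y) * ((p y)\<^sup>2 * u y + (2 + h y + h y / (f y)\<^sup>2) / 6)"
      by (rule entropy_bound) (use y P u phase_g[OF y neg', of y] in \<open>auto\<close>)
    also have "\<dots> \<le> (1 + h y) * ((p y)\<^sup>2 * u y + 1 / 3)"
    proof (intro mult_left_mono add_left_mono)
      have "h y / (f y)\<^sup>2 \<le> 0" using neg[of y] y f by (simp add: divide_nonpos_pos)
      then have "h y + h y / (f y)\<^sup>2 \<le> 0" using neg[OF less_imp_le[OF y]] by (intro add_nonpos_nonpos) auto
      moreover have "(2 + a + b) / 6 \<le> 1 / 3" if "a + b \<le> 0" for a b :: real using that by simp
      ultimately show "(2 + h y + h y / (f y)\<^sup>2) / 6 \<le> 1 / 3" by blast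
    qed (use P in auto)
    also have "\<dots> \<le> 1 * ((p y)\<^sup>2 * u y + 1 / 3)"
      by (rule mult_right_mono) (use neg[of y] y u[of y] in auto)
    also have "(p y)\<^sup>2 * u y \<le> (p y)\<^sup>2 * (p y / y)"
      using phase_p[OF y neg', of y] y by (intro mult_left_mono) (auto simp: field_simps)
    finally show ?thesis by (simp add: power2_eq_square power3_eq_cube)
  qed
  have inv: "((\<lambda>y::real. 1 / y) \<longlongrightarrow> 0) at_top"
    using tendsto_inverse_0_at_top[OF filterlim_ident] by (simp add: inverse_eq_divide)
  have "((\<lambda>y. h y * (1 / y)) \<longlongrightarrow> 0) at_top"
  proof (rule Lim_null_comparison[OF _ inv])
    show "\<forall>\<^sub>F y in at_top. norm (h y * (1 / y)) \<le> 1 / y"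
      using eventually_gt_at_top[of 0]
    proof eventually_elim
      fix y :: real assume y: "0 < y"
      have "-1 < h y" "h y < 0" using phase_p_pos(2)[OF y] neg y by auto
      then show "norm (h y * (1 / y)) \<le> 1 / y"
        using y mult_right_mono[of "- h y" 1 "1 / y"] by (simp add: abs_mult)
    qed
  qed
  then have "((\<lambda>y. f y / y + h y * (1 / y)) \<longlongrightarrow> a + 0) at_top" by (intro tendsto_add lim)
  moreover have "\<forall>\<^sub>F y in at_top. f y / y + h y * (1 / y) = p y"
    using eventually_gt_at_top[of 0] by eventually_elim (simp add: h_def field_simps)
  ultimately have p: "(p \<longlongrightarrow> a) at_top" by (simp add: tendsto_cong)
  have "4 * a^4 / 9 \<le> a^3 * 0 + 1 / 3"
  proof (rule tendsto_le)
    show "((\<lambda>y. (p y)^3 * (1 / y) + 1 / 3) \<longlongrightarrow> a^3 * 0 + 1 / 3) at_top" by (intro tendsto_intros p inv)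
    show "((\<lambda>y. 4 * (p y)^4 / 9) \<longlongrightarrow> 4 * a^4 / 9) at_top" by (intro tendsto_intros p) auto
    show "\<forall>\<^sub>F y in at_top. 4 * (p y)^4 / 9 \<le> (p y)^3 * (1 / y) + 1 / 3"
      using eventually_ge_at_top[of 1] by eventually_elim (rule le)
  qed simp
  then show ?thesis by (intro le_by_fourth_power) simp
qed

text \<open>If \<open>u\<close> stayed positive after \<open>t\<close>, then \<open>h\<close> would
  stay above a positive constant, \<open>g\<close> would become positive, and the orbit would enter
  the positive cone. The same exclusion keeps \<open>g \<le> 0\<close> until \<open>u\<close>
  vanishes.\<close>

lemma second_phase:
  assumes t: "0 < t" "h t = 0" and neg: "\<And>s. 0 \<le> s \<Longrightarrow> s < t \<Longrightarrow> h s < 0"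
  obtains \<tau> where "t \<le> \<tau>" "u \<tau> = 0" "\<And>s. 0 \<le> s \<Longrightarrow> s \<le> \<tau> \<Longrightarrow> 0 \<le> u s"
    "\<And>s. t \<le> s \<Longrightarrow> s \<le> \<tau> \<Longrightarrow> 0 \<le> h s" "\<And>s. t \<le> s \<Longrightarrow> s \<le> \<tau> \<Longrightarrow> g s \<le> 0"
proof (cases "u t = 0")
  case True
  show ?thesis
  proof (rule that[of t])
    show "0 \<le> u s" if "0 \<le> s" "s \<le> t" for s using phase_u[OF t(1) neg] that by simp
    show "g s \<le> 0" if "t \<le> s" "s \<le> t" for s
    proof -
      have "s = t" using that by simp
      then show ?thesis using phase_g[OF t(1) neg, of t] t by simp
    qed
    show "0 \<le> h s" if "t \<le> s" "s \<le> t" for s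
    proof -
      have "s = t" using that by simp
      then show ?thesis using t by simp
    qed
  qed (use True in auto)
next
  case False
  then have ut: "0 < u t" using phase_u[OF t(1) neg, of t] t by simp
  have h_pos: "0 < h s" if "t < s" "\<And>r. t \<le> r \<Longrightarrow> r < s \<Longrightarrow> 0 < u r" for s
  proof -
    have "0 - 0 < h s - h t"
      by (rule compare_strict_halfline[where f = "\<lambda>_. 0" and g = h and f' = "\<lambda>_. 0" and g' = "\<lambda>y. y * u y"])
         (use that t in \<open>auto simp: dh\<close>)
    then show ?thesis using t by simp
  qed
  have "\<exists>b\<ge>t. u b \<le> 0"
  proof (rule ccontr)
    assume "\<not> ?thesis"
    then have up: "0 < u s" if "t \<le> s" for s using that by force
    define c where "c = h (t + 1)"
    have c: "0 < c" unfolding c_def using h_pos[of "t + 1"] up by simp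
    have hc: "c \<le> h s" if "t + 1 \<le> s" for s
      unfolding c_def by (rule mono_halfline[where f' = "\<lambda>y. y * u y"]) (use that t up in \<open>auto simp: dh less_imp_le\<close>)
    define y where "y = t + 1 + (\<bar>g (t + 1)\<bar> + 1) / c"
    have y: "t + 1 \<le> y" using c by (simp add: y_def)
    have "c * y - c * (t + 1) \<le> g y - g (t + 1)"
      by (rule compare_halfline[where f = "\<lambda>y. c * y" and g = g and f' = "\<lambda>_. c" and g' = h])
         (use y t hc in \<open>auto intro!: derivative_eq_intros dg'\<close>)
    moreover have "c * y - c * (t + 1) = \<bar>g (t + 1)\<bar> + 1" using c by (simp add: y_def field_simps)
    ultimately have "0 < g y" by linarith
    then show False using no_cone[of 1 y] y up[of y] hc[of y] c t by auto
  qed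
  then obtain b where b: "t \<le> b" "u b \<le> 0" by blast
  obtain \<tau> where \<tau>: "t < \<tau>" "u \<tau> = 0" "\<And>s. t \<le> s \<Longrightarrow> s < \<tau> \<Longrightarrow> 0 < u s"
    by (rule first_zero[OF cont_on(3), of t b]) (use b ut t in auto)
  have hp: "0 < h s" if "t < s" "s \<le> \<tau>" for s using h_pos[of s] \<tau> that by auto
  have gn: "g s \<le> 0" if "t < s" "s < \<tau>" for s
  proof (rule ccontr)
    assume "\<not> g s \<le> 0"
    then show False using no_cone[of 1 s] that \<tau>(3)[of s] hp[of s] t by auto
  qed
  have gt: "g t < 0" using phase_g[OF t(1) neg, of t] t by simp
  have g\<tau>: "g \<tau> \<le> 0"
  proof (rule ccontr)
    assume c: "\<not> g \<tau> \<le> 0"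
    have "\<exists>s\<ge>t. s \<le> \<tau> \<and> g s = g \<tau> / 2"
      using c gt \<tau> t by (intro IVT' cont_on(4)) auto
    then obtain s where s: "t \<le> s" "s \<le> \<tau>" "g s = g \<tau> / 2" by blast
    then show False using gn[of s] c gt by (cases "s = t \<or> s = \<tau>") auto
  qed
  show ?thesis
  proof (rule that[of \<tau>])
    show "0 \<le> u s" if "0 \<le> s" "s \<le> \<tau>" for s
      using phase_u[OF t(1) neg, of s] \<tau>(3)[of s] \<tau>(2) that by (cases "s \<le> t"; cases "s = \<tau>") auto
    show "0 \<le> h s" if "t \<le> s" "s \<le> \<tau>" for s using hp[of s] t that by (cases "s = t") auto
    show "g s \<le> 0" if "t \<le> s" "s \<le> \<tau>" for s
      using gn[of s] g\<tau> gt that by (cases "s = t \<or> s = \<tau>") auto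
  qed (use \<tau> in auto)
qed

text \<open>Since \<open>h \<ge> 0\<close>, the slope \<open>f y / y\<close> is nondecreasing on
  [t, \<tau>], so the weight is at most (F y)^(-4). With \<open>- g \<le> t\<close> this bounds
  \<open>u\<close> by a multiple of y^(-3), which is integrated to bound \<open>h\<close> and
  \<open>p\<close>.\<close>

lemma second_phase_bounds:
  assumes t: "0 < t" "h t = 0" and neg: "\<And>s. 0 \<le> s \<Longrightarrow> s < t \<Longrightarrow> h s < 0"
    and \<tau>: "t \<le> \<tau>" "u \<tau> = 0" "\<And>s. 0 \<le> s \<Longrightarrow> s \<le> \<tau> \<Longrightarrow> 0 \<le> u s"
    "\<And>s. t \<le> s \<Longrightarrow> s \<le> \<tau> \<Longrightarrow> 0 \<le> h s" "\<And>s. t \<le> s \<Longrightarrow> s \<le> \<tau> \<Longrightarrow> g s \<le> 0"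
    and F: "F = f t / t"
  shows "h \<tau> \<le> 1 / (3 * F^4)" "p \<tau> \<le> F + 1 / (12 * F^3)" "F \<le> p \<tau>" "2 \<le> f \<tau>"
proof -
  have F0: "0 < F" using turn_f[OF t neg] t F by simp
  have Ft: "f t = F * t" using F t by simp
  have fl: "F * y \<le> f y" if "t \<le> y" "y \<le> \<tau>" for y
  proof -
    have "f t / t \<le> f y / y"
    proof (rule mono_halfline[where f = "\<lambda>y. f y / y" and f' = "\<lambda>y. h y / y\<^sup>2"])
      fix x assume "t < x" "x < y"
      then show "0 \<le> h x / x\<^sup>2" using \<tau>(4)[of x] that by simp
    qed (use that t in \<open>auto intro!: dF\<close>)
    then have "F \<le> f y / y" using F by simp
    then show ?thesis using that t by (simp add: pos_le_divide_eq)
  qed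
  have "F * t \<le> F * \<tau>" using F0 \<tau> by simp
  then show "2 \<le> f \<tau>" using fl[of \<tau>] turn_f[OF t neg] \<tau> t Ft by simp
  have gl: "- t \<le> g y" if "t \<le> y" "y \<le> \<tau>" for y
  proof -
    have "g t \<le> g y" by (rule mono_halfline[where f' = h]) (use that t \<tau> in \<open>auto simp: dg'\<close>)
    then show ?thesis using turn_g[OF t neg] by simp
  qed
  have u_le: "u y \<le> t / (3 * F^4) / y^3" if y: "t \<le> y" "y \<le> \<tau>" for y
  proof -
    \<comment> \<open>Integration backwards from \<open>\<tau>\<close>, where \<open>u\<close>
      vanishes: the added term compensates \<open>g * w\<close>, using \<open>g \<le> 0\<close> and
      \<open>h \<ge> 0\<close>.\<close>
    have "u y + g y / (3 * F^4 * y^3) \<le> u \<tau> + g \<tau> / (3 * F^4 * \<tau>^3)"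
    proof (rule mono_halfline[where f = "\<lambda>y. u y + g y / (3 * F^4 * y^3)" and
          f' = "\<lambda>y. g y * w y + (h y / (3 * F^4 * y^3) - g y / (F^4 * y^4))"])
      fix x assume x: "y \<le> x" "x \<le> \<tau>"
      then have "0 < x" using y t by simp
      then show "((\<lambda>y. u y + g y / (3 * F^4 * y^3)) has_real_derivative
          g x * w x + (h x / (3 * F^4 * x^3) - g x / (F^4 * x^4))) (at x within {0..})"
        using F0 by (auto intro!: derivative_eq_intros du dg' simp: field_simps eval_nat_numeral)
    next
      fix x assume x: "y < x" "x < \<tau>"
      then have x0: "0 < x" using y t by simp
      have "w x = 1 / (f x)^4" using w_eq x0 by simp
      also have "\<dots> \<le> 1 / (F * x)^4"
        using fl[of x] x y F0 x0 f_pos[of x] by (intro divide_left_mono power_mono) auto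
      also have "\<dots> = 1 / (F^4 * x^4)" by (simp add: power_mult_distrib)
      finally have "g x * (1 / (F^4 * x^4)) \<le> g x * w x"
        using \<tau>(5)[of x] x y by (intro mult_left_mono_neg) auto
      moreover have "0 \<le> h x / (3 * F^4 * x^3)" using \<tau>(4)[of x] x y x0 F0 by simp
      ultimately show "0 \<le> g x * w x + (h x / (3 * F^4 * x^3) - g x / (F^4 * x^4))" by simp
    qed (use y t in auto)
    moreover have "g \<tau> / (3 * F^4 * \<tau>^3) \<le> 0"
      using \<tau>(5)[of \<tau>] \<tau>(1) t F0 by (intro divide_nonpos_pos) auto
    ultimately have "u y \<le> - g y / (3 * F^4 * y^3)" using \<tau>(2) by simp
    also have "\<dots> \<le> t / (3 * F^4 * y^3)"
      using gl[of y] y t F0 by (intro divide_right_mono) auto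
    finally show ?thesis by simp
  qed
  define c where "c = t / (3 * F^4)"
  have c: "0 < c" using t F0 by (simp add: c_def)
  have "h \<tau> - h t \<le> - c / \<tau> - - c / t"
  proof (rule compare_halfline[where f = h and g = "\<lambda>y. - c / y" and f' = "\<lambda>y. y * u y" and g' = "\<lambda>y. c / y\<^sup>2"])
    fix x assume x: "t < x" "x < \<tau>"
    then have "x * u x \<le> x * (c / x^3)" using u_le[of x] t by (intro mult_left_mono) (auto simp: c_def)
    also have "\<dots> = c / x\<^sup>2" using x t by (simp add: power2_eq_square power3_eq_cube)
    finally show "x * u x \<le> c / x\<^sup>2" .
  qed (use t \<tau> in \<open>auto intro!: derivative_eq_intros dh simp: power2_eq_square\<close>)
  also have "\<dots> \<le> c / t" using c t \<tau> by simp
  also have "\<dots> = 1 / (3 * F^4)" using t by (simp add: c_def)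
  finally show "h \<tau> \<le> 1 / (3 * F^4)" using t by simp
  have "p \<tau> - p t \<le> - c / (2 * \<tau>\<^sup>2) - - c / (2 * t\<^sup>2)"
  proof (rule compare_halfline[where f = p and g = "\<lambda>y. - c / (2 * y\<^sup>2)" and f' = u and g' = "\<lambda>y. c / y^3"])
    fix x assume x: "t < x" "x < \<tau>"
    then show "u x \<le> c / x^3" using u_le[of x] by (auto simp: c_def)
  qed (use t \<tau> in \<open>auto intro!: derivative_eq_intros dp simp: field_simps eval_nat_numeral\<close>)
  also have "\<dots> \<le> c / (2 * t\<^sup>2)" using c t \<tau> by simp
  also have "\<dots> = 1 / (6 * F^4) * (1 / t)" using t F0 by (simp add: c_def power2_eq_square)
  also have "\<dots> \<le> 1 / (6 * F^4) * (F / 2)"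
  proof (rule mult_left_mono)
    show "1 / t \<le> F / 2" using turn_f[OF t neg] t F by (simp add: field_simps)
  qed (use F0 in auto)
  also have "\<dots> = 1 / (12 * F^3)" using F0 by (simp add: eval_nat_numeral)
  finally have "p \<tau> \<le> p t + 1 / (12 * F^3)" by simp
  moreover have "t * p t = t * F" using t F by (simp add: h_def)
  then have pt: "p t = F" using t by simp
  ultimately show "p \<tau> \<le> F + 1 / (12 * F^3)" by simp
  have "p t \<le> p \<tau>" by (rule mono_halfline[where f' = u]) (use t \<tau> in \<open>auto simp: dp\<close>)
  then show "F \<le> p \<tau>" using pt by simp
qed

text \<open>At the zero \<tau> of \<open>u\<close> one has \<Phi> = - h^2 / (2 \<tau>) exactly, so
  the oscillation bound reads |a - f / \<tau>| \<le> h / \<tau> and gives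
  \<open>a \<le> p \<tau>\<close>. It remains to bound \<open>p \<tau>\<close>, unless
  \<open>F\<close> is small.\<close>

theorem slope_bound:
  assumes lim: "((\<lambda>y. f y / y) \<longlongrightarrow> a) at_top"
    and osc: "\<And>y. 0 < y \<Longrightarrow> (a - f y / y)\<^sup>2 \<le> 2 * - \<Phi> y / y"
  shows "a \<le> 11/10"
proof (rule turn_cases)
  assume "\<And>s. 0 \<le> s \<Longrightarrow> h s < 0"
  then show ?thesis by (rule slope_bound_no_turn[OF lim])
next
  fix t assume t: "0 < t" "h t = 0" and neg: "\<And>s. 0 \<le> s \<Longrightarrow> s < t \<Longrightarrow> h s < 0"
  define F where "F = f t / t"
  have "\<exists>\<tau>. t \<le> \<tau> \<and> u \<tau> = 0 \<and> (\<forall>s. 0 \<le> s \<and> s \<le> \<tau> \<longrightarrow> 0 \<le> u s) \<and>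
      (\<forall>s. t \<le> s \<and> s \<le> \<tau> \<longrightarrow> 0 \<le> h s) \<and> (\<forall>s. t \<le> s \<and> s \<le> \<tau> \<longrightarrow> g s \<le> 0)"
    by (rule second_phase[OF t]) (use neg in blast)+
  then obtain \<tau> where \<tau>: "t \<le> \<tau>" "u \<tau> = 0" "\<And>s. 0 \<le> s \<Longrightarrow> s \<le> \<tau> \<Longrightarrow> 0 \<le> u s"
    "\<And>s. t \<le> s \<Longrightarrow> s \<le> \<tau> \<Longrightarrow> 0 \<le> h s" "\<And>s. t \<le> s \<Longrightarrow> s \<le> \<tau> \<Longrightarrow> g s \<le> 0"
    by blast
  have b: "h \<tau> \<le> 1 / (3 * F^4)" "p \<tau> \<le> F + 1 / (12 * F^3)" "F \<le> p \<tau>" "2 \<le> f \<tau>"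
    by (rule second_phase_bounds[OF t _ \<tau>(1,2) _ _ _ F_def]; blast intro: neg \<tau>)+
  have "0 < \<tau>" using t \<tau> by simp
  have F0: "0 < F" using turn_f[OF t neg] t by (simp add: F_def)
  have "(a - f \<tau> / \<tau>)\<^sup>2 \<le> (h \<tau> / \<tau>)\<^sup>2"
    using osc[OF \<open>0 < \<tau>\<close>] \<open>0 < \<tau>\<close> by (simp add: \<Phi>_def \<tau>(2) power2_eq_square)
  moreover have "0 \<le> h \<tau> / \<tau>" using \<tau>(4)[of \<tau>] \<tau>(1) \<open>0 < \<tau>\<close> by simp
  ultimately have "a - f \<tau> / \<tau> \<le> h \<tau> / \<tau>" by (rule power2_le_imp_le)
  then have ap: "a \<le> p \<tau>" using \<open>0 < \<tau>\<close> by (simp add: h_def field_simps)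
  \<comment> \<open>For small \<open>F\<close> the oscillation after the turn suffices, as (91/50)
    (3/5) = 1.092. In the middle range the integrated bound on \<open>p \<tau>\<close> works; for
    large \<open>F\<close> it does not, and the entropy estimate takes over.\<close>
  consider "F \<le> 3/5" | "3/5 \<le> F" "F \<le> 1" | "1 \<le> F" by linarith
  then show ?thesis
  proof cases
    case 1
    have "a \<le> 91/50 * F"
      by (rule tendsto_upperbound[OF lim])
         (use turn_slope_bounds(2)[OF t neg] in \<open>auto simp: F_def eventually_at_top_linorder\<close>)
    then show ?thesis using 1 by simp
  next
    case 2
    \<comment> \<open>A product that is nonnegative on [3/5, 1] and whose expansion has no F^2 term;
      it leaves 11/10 F^3 - F^4 \<ge> 3/25 - F / 50 \<ge> 1/10.\<close>
    have "0 \<le> (F - 3/5) * (1 - F) * (F\<^sup>2 + F / 2 + 1/5)"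
      using 2 by (intro mult_nonneg_nonneg add_nonneg_nonneg) auto
    also have "\<dots> = 11/10 * F^3 - F^4 + F / 50 - 3/25"
      by (simp add: field_simps eval_nat_numeral)
    finally have "F^4 + 1/12 \<le> 11/10 * F^3" using 2 by simp
    then have "F + 1 / (12 * F^3) \<le> 11/10" using F0 by (simp add: field_simps eval_nat_numeral)
    then show ?thesis using ap b(2) by linarith
  next
    case 3
    have H: "0 \<le> h \<tau>" using \<tau>(4)[of \<tau>] \<tau>(1) by simp
    have "1 / (3 * F^4) \<le> 1 / 3" using 3 by (simp add: divide_simps)
    then have H': "h \<tau> \<le> 1/3" using b(1) by simp
    have "4 * (p \<tau>)^4 / 9 \<le> (1 + h \<tau>) * ((p \<tau>)\<^sup>2 * u \<tau> + (2 + h \<tau> + h \<tau> / (f \<tau>)\<^sup>2) / 6)"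
    proof (rule entropy_bound[OF \<open>0 < \<tau>\<close> \<tau>(3)])
      show "g \<tau> \<le> 0" using \<tau>(5)[of \<tau>] \<tau>(1) by simp
      show "0 < p \<tau>" "-1 < h \<tau>" using F0 b(3) H by linarith+
    qed
    \<comment> \<open>The curvature term is gone because \<open>u \<tau> = 0\<close>; the numbers
      amount to p^4 \<le> 29/24.\<close>
    also have "\<dots> \<le> (4/3) * ((2 + 1/3 + (1/3) / 2\<^sup>2) / 6)"
    proof -
      have "h \<tau> / (f \<tau>)\<^sup>2 \<le> (1/3) / 2\<^sup>2" by (intro frac_le power_mono) (use H H' b(4) in auto)
      then have 1: "(2 + h \<tau> + h \<tau> / (f \<tau>)\<^sup>2) / 6 \<le> (2 + 1/3 + (1/3) / 2\<^sup>2) / 6"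
        using H' by (intro divide_right_mono add_mono) auto
      have "0 \<le> h \<tau> / (f \<tau>)\<^sup>2" using H by simp
      then have "0 \<le> (2 + h \<tau> + h \<tau> / (f \<tau>)\<^sup>2) / 6"
        using H by (intro divide_nonneg_nonneg add_nonneg_nonneg) auto
      then show ?thesis using 1 H H' \<tau>(2) by (intro mult_mono) auto
    qed
    finally have "p \<tau> \<le> 11/10" by (intro le_by_fourth_power) simp
    then show ?thesis using ap by simp
  qed
qed

end

section \<open>Linearization at infinity for m = 4\<close>

text \<open>The exponent 0 would integrate to a logarithm. Avoiding it is what later forces care
  near the exponent \<open>s\<close>.\<close>

lemma powr_increment:
  fixes G :: "real \<Rightarrow> real"
  assumes dG: "\<And>y. 1 \<le> y \<Longrightarrow> (G has_real_derivative G' y) (at y within {0..})"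
    and bd: "\<And>y. 1 \<le> y \<Longrightarrow> \<bar>G' y\<bar> \<le> C * y powr (r - 1)"
    and "r \<noteq> 0" "1 \<le> a" "a \<le> b"
  shows "\<bar>G b - G a\<bar> \<le> C / r * b powr r - C / r * a powr r"
proof -
  define k where "k = C / r"
  have d: "((\<lambda>y. k * y powr r) has_real_derivative C * y powr (r - 1)) (at y within {0..})" if "1 \<le> y" for y
    using that \<open>r \<noteq> 0\<close> unfolding k_def
    by (auto intro!: derivative_eq_intros has_field_derivative_at_within[OF has_real_derivative_powr])
  have "G b - G a \<le> k * b powr r - k * a powr r"
    by (rule compare_halfline[where f = G and g = "\<lambda>y. k * y powr r" and f' = G' and g' = "\<lambda>y. C * y powr (r - 1)"])
       (use assms(4,5) in \<open>auto intro!: d dG order_trans[OF abs_ge_self bd]\<close>)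
  moreover have "- G b - - G a \<le> k * b powr r - k * a powr r"
    by (rule compare_halfline[where f = "\<lambda>y. - G y" and g = "\<lambda>y. k * y powr r" and
          f' = "\<lambda>y. - G' y" and g' = "\<lambda>y. C * y powr (r - 1)"])
       (use assms(4,5) in \<open>auto intro!: d DERIV_minus dG order_trans[OF abs_ge_minus_self bd]\<close>)
  ultimately show ?thesis by (simp add: abs_le_iff k_def)
qed

lemma powr_growth:
  fixes G :: "real \<Rightarrow> real"
  assumes dG: "\<And>y. 1 \<le> y \<Longrightarrow> (G has_real_derivative G' y) (at y within {0..})"
    and bd: "\<And>y. 1 \<le> y \<Longrightarrow> \<bar>G' y\<bar> \<le> C * y powr (r - 1)" and r: "0 < r"
  shows "\<exists>D. \<forall>y\<ge>1. \<bar>G y\<bar> \<le> D * y powr r"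
proof (intro exI allI impI)
  fix y :: real assume y: "1 \<le> y"
  have C: "0 \<le> C" using bd[of 1] by simp
  have "\<bar>G y - G 1\<bar> \<le> C / r * y powr r - C / r * 1 powr r"
    by (rule powr_increment[OF dG bd]) (use y r in auto)
  then have "\<bar>G y - G 1\<bar> \<le> C / r * y powr r - C / r" by simp
  moreover have "0 \<le> C / r" using C r by simp
  moreover have "\<bar>G 1\<bar> * 1 \<le> \<bar>G 1\<bar> * y powr r" using y r by (intro mult_left_mono) (auto intro: ge_one_powr_ge_zero)
  ultimately show "\<bar>G y\<bar> \<le> (\<bar>G 1\<bar> + C / r) * y powr r" by (simp add: distrib_right)
qed

lemma powr_decay:
  fixes G :: "real \<Rightarrow> real"
  assumes dG: "\<And>y. 1 \<le> y \<Longrightarrow> (G has_real_derivative G' y) (at y within {0..})"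
    and bd: "\<And>y. 1 \<le> y \<Longrightarrow> \<bar>G' y\<bar> \<le> C * y powr (r - 1)" and r: "r < 0"
  shows "\<exists>L. (G \<longlongrightarrow> L) at_top \<and> (\<forall>y\<ge>1. \<bar>G y - L\<bar> \<le> - C / r * y powr r)"
proof (rule tail_bound_limit)
  fix a b :: real assume ab: "1 \<le> a" "a \<le> b"
  have "0 \<le> C" using bd[of 1] by simp
  then have "C / r * b powr r \<le> 0" using r by (simp add: mult_le_0_iff divide_le_0_iff)
  moreover have "\<bar>G b - G a\<bar> \<le> C / r * b powr r - C / r * a powr r"
    by (rule powr_increment[OF dG bd]) (use ab r in auto)
  ultimately show "\<bar>G b - G a\<bar> \<le> - C / r * a powr r" by simp
next
  show "((\<lambda>y. - C / r * y powr r) \<longlongrightarrow> 0) at_top"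
    by (intro tendsto_mult_right_zero tendsto_neg_powr r filterlim_ident)
qed

lemma difference_fourth_powers: "i^4 - j^4 = (i - j) * ((i + j) * (i\<^sup>2 + j\<^sup>2))" for i j :: real
  by (simp add: algebra_simps eval_nat_numeral)

text \<open>Splitting off the root \<open>r\<close> leaves a quadratic with roots -s \<plusminus> i
  \<omega>, and \<omega>^2 > 0 means 8 < 3 r^2 + 4 r. If this failed, then r < 11/10 and 1 / a^4
  \<le> 0.651, whereas a \<le> 11/10 forces more than 0.66.\<close>

lemma characteristic_roots:
  fixes a :: real
  assumes a: "0 < a" "a \<le> 11/10"
  obtains r s \<omega> where "1 < r" "s = (2 + r) / 2" "0 < \<omega>" "\<omega>\<^sup>2 = r\<^sup>2 + 2 * r - 1 - s\<^sup>2"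
    "(r\<^sup>2 - 1) * (r + 2) = 1 / a^4"
proof -
  define B where "B = 1 / a^4"
  have "a^4 \<le> (11/10)^4" using a by (intro power_mono) auto
  then have "1 / (11/10)^4 \<le> B" unfolding B_def using a by (intro divide_left_mono) auto
  then have B: "33/50 < B" by (simp add: power_divide)
  define \<phi> where "\<phi> = (\<lambda>x::real. (x\<^sup>2 - 1) * (x + 2))"
  have "\<phi> (1 + B) = B * ((2 + B) * (3 + B))" by (simp add: \<phi>_def power2_eq_square algebra_simps)
  moreover have "B * 1 \<le> B * ((2 + B) * (3 + B))"
    using B mult_mono[of 1 "2 + B" 1 "3 + B"] by (intro mult_left_mono) auto
  ultimately have "\<phi> 1 \<le> B" "B \<le> \<phi> (1 + B)" using B by (auto simp: \<phi>_def)
  then have "\<exists>x\<ge>1. x \<le> 1 + B \<and> \<phi> x = B"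
    by (intro IVT') (use B in \<open>auto simp: \<phi>_def intro!: continuous_intros\<close>)
  then obtain r where r: "1 \<le> r" "\<phi> r = B" by blast
  have "r \<noteq> 1" using r B by (auto simp: \<phi>_def)
  have pos: "8 < 3 * r\<^sup>2 + 4 * r"
  proof (rule ccontr)
    assume c: "\<not> ?thesis"
    have "r < 11/10"
    proof (rule ccontr)
      assume "\<not> r < 11/10"
      then have "(11/10)\<^sup>2 \<le> r\<^sup>2" "11/10 \<le> r" by (auto intro!: power_mono)
      then show False using c by (simp add: power_divide)
    qed
    then have "r\<^sup>2 \<le> (11/10)\<^sup>2" "r \<le> 11/10" using r by (auto intro!: power_mono)
    then have "\<phi> r \<le> ((11/10)\<^sup>2 - 1) * (11/10 + 2)"
      unfolding \<phi>_def using r by (intro mult_mono) auto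
    then show False using r B by (simp add: power_divide)
  qed
  define s where "s = (2 + r) / 2"
  define \<omega> where "\<omega> = sqrt (r\<^sup>2 + 2 * r - 1 - s\<^sup>2)"
  have "0 < r\<^sup>2 + 2 * r - 1 - s\<^sup>2" using pos by (simp add: s_def power2_eq_square field_simps)
  then have "0 < \<omega>" "\<omega>\<^sup>2 = r\<^sup>2 + 2 * r - 1 - s\<^sup>2" by (auto simp: \<omega>_def)
  then show ?thesis using that[of r s \<omega>] r \<open>r \<noteq> 1\<close> by (auto simp: s_def B_def \<phi>_def)
qed

lemma abs_cos_sin_combination_le:
  fixes x z t :: real
  shows "\<bar>x * cos t + z * sin t\<bar> \<le> \<bar>x\<bar> + \<bar>z\<bar>"
    and "\<bar>x * cos t - z * sin t\<bar> \<le> \<bar>x\<bar> + \<bar>z\<bar>"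
proof -
  have "\<bar>x * cos t\<bar> \<le> \<bar>x\<bar>" "\<bar>z * sin t\<bar> \<le> \<bar>z\<bar>" by (auto simp: abs_mult mult_left_le)
  then show "\<bar>x * cos t + z * sin t\<bar> \<le> \<bar>x\<bar> + \<bar>z\<bar>" "\<bar>x * cos t - z * sin t\<bar> \<le> \<bar>x\<bar> + \<bar>z\<bar>"
    by linarith+
qed

locale spectral_film = quartic_film +
  fixes a r s \<omega> C\<^sub>0 :: real
  assumes a_pos: "0 < a" and r_gt: "1 < r" and s_def: "s = (2 + r) / 2" and \<omega>_pos: "0 < \<omega>"
    and \<omega>_sq: "\<omega>\<^sup>2 = r\<^sup>2 + 2 * r - 1 - s\<^sup>2" and r_root: "(r\<^sup>2 - 1) * (r + 2) = 1 / a^4"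
    and slope: "1 \<le> y \<Longrightarrow> \<bar>f y / y - a\<bar> \<le> C\<^sub>0 / sqrt y"
begin

text \<open>With \<open>v = h / y\<close>, \<open>v\<^sub>1 = y v'\<close> and \<open>q = g / y\<^sup>2\<close> the system becomes autonomous in \<open>ln y\<close>, up to
  the error \<open>e\<close>; \<open>\<rho>\<close> and \<open>X + \<i> Y\<close> are its coordinates along the eigenvalues \<open>r\<close> and
  \<open>- s + \<i> \<omega>\<close> of the linearization at \<open>f = a y\<close>.\<close>

definition "v y = h y / y"
definition "v\<^sub>1 y = y * u y - v y"
definition "q y = g y / y\<^sup>2"
definition "W y = (y / f y)^4"
definition "e y = (W y - 1 / a^4) * q y"
text \<open>In the coordinates (\<open>v\<close>, \<open>v\<^sub>1\<close>, \<open>q\<close>) the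
  linearized matrix has the left eigenvector (z, 1, z^2 - 1) for an eigenvalue z. The choice z = r
  gives \<open>\<rho>\<close>, and z = -s + i \<omega> gives \<open>X\<close> and \<open>Y\<close>
  as real and imaginary parts.\<close>

definition "\<rho> y = r * v y + v\<^sub>1 y + (r\<^sup>2 - 1) * q y"
definition "X y = - s * v y + v\<^sub>1 y + (s\<^sup>2 - \<omega>\<^sup>2 - 1) * q y"
definition "Y y = \<omega> * v y - 2 * s * \<omega> * q y"
text \<open>\<open>P\<close> + i \<open>Q\<close> is y^(s - i \<omega>) (\<open>X\<close> + i
  \<open>Y\<close>), which is constant for the linear equation; only the error \<open>e\<close>
  drives it.\<close>

definition "P y = y powr s * (X y * cos (\<omega> * ln y) + Y y * sin (\<omega> * ln y))"
definition "Q y = y powr s * (Y y * cos (\<omega> * ln y) - X y * sin (\<omega> * ln y))"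

section \<open>Derivatives along the eigendirections\<close>

lemma s_gt: "3 / 2 < s" using r_gt by (simp add: s_def)

lemma dv: "0 < y \<Longrightarrow> (v has_real_derivative v\<^sub>1 y / y) (at y within {0..})"
  unfolding v_def v\<^sub>1_def by (auto intro!: derivative_eq_intros dh simp: field_simps power2_eq_square)

lemma dq: "0 < y \<Longrightarrow> (q has_real_derivative (v y - 2 * q y) / y) (at y within {0..})"
  unfolding q_def v_def by (auto intro!: derivative_eq_intros dg' simp: field_simps power2_eq_square)

lemma gw: "0 < y \<Longrightarrow> g y * w y = W y * q y / y\<^sup>2"
  using f_pos[of y] by (simp add: w_eq W_def q_def power_divide eval_nat_numeral)

lemma dv\<^sub>1: "0 < y \<Longrightarrow> (v\<^sub>1 has_real_derivative (v y + W y * q y) / y) (at y within {0..})"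
  unfolding v\<^sub>1_def
  by (auto intro!: derivative_eq_intros du dv simp: gw field_simps power2_eq_square v\<^sub>1_def)

lemma d\<rho>:
  assumes y: "0 < y"
  shows "(\<rho> has_real_derivative (r * \<rho> y + e y) / y) (at y within {0..})"
proof -
  have d: "(\<rho> has_real_derivative r * (v\<^sub>1 y / y) + (v y + W y * q y) / y + (r\<^sup>2 - 1) * ((v y - 2 * q y) / y)) (at y within {0..})"
    unfolding \<rho>_def by (auto intro!: derivative_eq_intros dv dv\<^sub>1 dq y simp: mult_ac)
  have "r * v\<^sub>1 y + (v y + W y * q y) + (r\<^sup>2 - 1) * (v y - 2 * q y) = r * \<rho> y + e y"
    unfolding \<rho>_def e_def r_root[symmetric] by (simp add: algebra_simps power2_eq_square)
  then have "r * (v\<^sub>1 y / y) + (v y + W y * q y) / y + (r\<^sup>2 - 1) * ((v y - 2 * q y) / y) = (r * \<rho> y + e y) / y"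
    by (metis (no_types, lifting) add_divide_distrib times_divide_eq_right)
  then show ?thesis using d by simp
qed

lemma dX:
  assumes y: "0 < y"
  shows "(X has_real_derivative (- s * X y - \<omega> * Y y + e y) / y) (at y within {0..})"
proof -
  have d: "(X has_real_derivative - s * (v\<^sub>1 y / y) + (v y + W y * q y) / y + (s\<^sup>2 - \<omega>\<^sup>2 - 1) * ((v y - 2 * q y) / y)) (at y within {0..})"
    unfolding X_def by (auto intro!: derivative_eq_intros dv dv\<^sub>1 dq y simp: mult_ac)
  have "- s * v\<^sub>1 y + (v y + W y * q y) + (s\<^sup>2 - \<omega>\<^sup>2 - 1) * (v y - 2 * q y) = - s * X y - \<omega> * Y y + e y"
  proof -
    \<comment> \<open>The real part of the characteristic equation at -s + i \<omega>, with 1 / a^4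
      expressed through \<open>r\<close>.\<close>
    have "(r\<^sup>2 - 1) * (r + 2) - 2 * (s\<^sup>2 - \<omega>\<^sup>2 - 1) = - s * (s\<^sup>2 - \<omega>\<^sup>2 - 1) + 2 * s * \<omega>\<^sup>2"
      unfolding \<omega>_sq s_def by (simp add: field_simps power2_eq_square)
    then have "((r\<^sup>2 - 1) * (r + 2) - 2 * (s\<^sup>2 - \<omega>\<^sup>2 - 1)) * q y = (- s * (s\<^sup>2 - \<omega>\<^sup>2 - 1) + 2 * s * \<omega>\<^sup>2) * q y" by simp
    then show ?thesis
      unfolding X_def Y_def e_def r_root[symmetric] by (simp add: algebra_simps power2_eq_square)
  qed
  then have "- s * (v\<^sub>1 y / y) + (v y + W y * q y) / y + (s\<^sup>2 - \<omega>\<^sup>2 - 1) * ((v y - 2 * q y) / y)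
      = (- s * X y - \<omega> * Y y + e y) / y"
    by (metis (no_types, lifting) add_divide_distrib times_divide_eq_right)
  then show ?thesis using d by simp
qed

lemma dY:
  assumes y: "0 < y"
  shows "(Y has_real_derivative (- s * Y y + \<omega> * X y) / y) (at y within {0..})"
proof -
  have d: "(Y has_real_derivative \<omega> * (v\<^sub>1 y / y) - 2 * s * \<omega> * ((v y - 2 * q y) / y)) (at y within {0..})"
    unfolding Y_def by (auto intro!: derivative_eq_intros dv dv\<^sub>1 dq y simp: mult_ac)
  have "\<omega> * v\<^sub>1 y - 2 * s * \<omega> * (v y - 2 * q y) = - s * Y y + \<omega> * X y"
  proof -
    \<comment> \<open>The imaginary part of the characteristic equation, divided by
      \<omega>.\<close>
    have "4 * s = 3 * s\<^sup>2 - \<omega>\<^sup>2 - 1"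
      unfolding \<omega>_sq s_def by (simp add: field_simps power2_eq_square)
    then have "4 * s * (\<omega> * q y) = (3 * s\<^sup>2 - \<omega>\<^sup>2 - 1) * (\<omega> * q y)" by simp
    then show ?thesis
      unfolding X_def Y_def by (simp add: algebra_simps power2_eq_square)
  qed
  then have "\<omega> * (v\<^sub>1 y / y) - 2 * s * \<omega> * ((v y - 2 * q y) / y) = (- s * Y y + \<omega> * X y) / y"
    by (metis (no_types, lifting) diff_divide_distrib times_divide_eq_right)
  then show ?thesis using d by simp
qed

lemma dP:
  assumes y: "0 < y"
  shows "(P has_real_derivative y powr (s - 1) * e y * cos (\<omega> * ln y)) (at y within {0..})"
proof -
  have p: "((\<lambda>y. y powr s) has_real_derivative s * y powr (s - 1)) (at y within {0..})"
    using has_field_derivative_at_within[OF has_real_derivative_powr[OF y]] .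
  define c where "c = cos (\<omega> * ln y)"
  define n where "n = sin (\<omega> * ln y)"
  have "(P has_real_derivative s * y powr (s - 1) * (X y * c + Y y * n) + y powr s *
      ((- s * X y - \<omega> * Y y + e y) / y * c - X y * (n * (\<omega> * (1 / y)))
       + ((- s * Y y + \<omega> * X y) / y * n + Y y * (c * (\<omega> * (1 / y)))))) (at y within {0..})"
    unfolding P_def c_def n_def using y
    by (auto intro!: derivative_eq_intros dX[OF y] dY[OF y] p simp: mult_ac)
  moreover have "y powr s = y * y powr (s - 1)" using y by (simp add: powr_mult_base)
  then have "s * y powr (s - 1) * (X y * c + Y y * n) + y powr s *
      ((- s * X y - \<omega> * Y y + e y) / y * c - X y * (n * (\<omega> * (1 / y)))
       + ((- s * Y y + \<omega> * X y) / y * n + Y y * (c * (\<omega> * (1 / y))))) = y powr (s - 1) * e y * c"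
    using y by (simp add: field_simps)
  ultimately show ?thesis by (simp add: c_def)
qed

lemma dQ:
  assumes y: "0 < y"
  shows "(Q has_real_derivative - (y powr (s - 1) * e y * sin (\<omega> * ln y))) (at y within {0..})"
proof -
  have p: "((\<lambda>y. y powr s) has_real_derivative s * y powr (s - 1)) (at y within {0..})"
    using has_field_derivative_at_within[OF has_real_derivative_powr[OF y]] .
  define c where "c = cos (\<omega> * ln y)"
  define n where "n = sin (\<omega> * ln y)"
  have "(Q has_real_derivative s * y powr (s - 1) * (Y y * c - X y * n) + y powr s *
      ((- s * Y y + \<omega> * X y) / y * c - Y y * (n * (\<omega> * (1 / y)))
       - ((- s * X y - \<omega> * Y y + e y) / y * n + X y * (c * (\<omega> * (1 / y)))))) (at y within {0..})"
    unfolding Q_def c_def n_def using y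
    by (auto intro!: derivative_eq_intros dX[OF y] dY[OF y] p simp: mult_ac)
  moreover have "y powr s = y * y powr (s - 1)" using y by (simp add: powr_mult_base)
  then have "s * y powr (s - 1) * (Y y * c - X y * n) + y powr s *
      ((- s * Y y + \<omega> * X y) / y * c - Y y * (n * (\<omega> * (1 / y)))
       - ((- s * X y - \<omega> * Y y + e y) / y * n + X y * (c * (\<omega> * (1 / y))))) = - (y powr (s - 1) * e y * n)"
    using y by (simp add: field_simps)
  ultimately show ?thesis by (simp add: n_def)
qed

section \<open>A priori bounds along the orbit\<close>

lemma C\<^sub>0_nonneg: "0 \<le> C\<^sub>0" using slope[of 1] by simp

lemma slope_tendsto: "((\<lambda>y. f y / y) \<longlongrightarrow> a) at_top"
proof (rule Lim_transform2)
  show "((\<lambda>_. a) \<longlongrightarrow> a) at_top" by simp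
  have "((\<lambda>y. C\<^sub>0 / sqrt y) \<longlongrightarrow> 0) at_top"
    by (intro tendsto_divide_0[OF tendsto_const] filterlim_at_top_imp_at_infinity sqrt_at_top)
  then show "((\<lambda>y. a - f y / y) \<longlongrightarrow> 0) at_top"
    by (rule Lim_null_comparison[rotated])
       (use eventually_ge_at_top[of 1] in eventually_elim, use slope in \<open>auto simp: abs_minus_commute\<close>)
qed

lemma slope_lower: "\<exists>c>0. \<forall>y\<ge>1. c \<le> f y / y"
proof -
  have "eventually (\<lambda>y. a / 2 < f y / y) at_top"
    using order_tendstoD(1)[OF slope_tendsto, of "a / 2"] a_pos by simp
  then obtain N where N: "\<And>y. N \<le> y \<Longrightarrow> a / 2 < f y / y" by (auto simp: eventually_at_top_linorder)
  define M where "M = max N 1"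
  have "min (a / 2) (1 / (3 * M)) \<le> f y / y" if y: "1 \<le> y" for y
  proof (cases "N \<le> y")
    case False
    have "1 / (3 * M) = (1 / 3) / M" by simp
    also have "\<dots> \<le> f y / y" using f_lower[of y] y False by (intro frac_le) (auto simp: M_def)
    finally show ?thesis by simp
  next
    case True
    show ?thesis by (rule order_trans[OF min.cobounded1 less_imp_le[OF N[OF True]]])
  qed
  then show ?thesis using a_pos by (intro exI[of _ "min (a / 2) (1 / (3 * M))"]) (auto simp: M_def)
qed

lemma W_bound: "\<exists>C. \<forall>y\<ge>1. \<bar>W y - 1 / a^4\<bar> \<le> C * y powr (- (1/2))"
proof -
  obtain c where c: "0 < c" "\<And>y. 1 \<le> y \<Longrightarrow> c \<le> f y / y" using slope_lower by blast
  define k where "k = max (1 / c) (1 / a)"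
  have k: "0 < k" "1 / a \<le> k" using c a_pos by (auto simp: k_def less_max_iff_disj)
  show ?thesis
  proof (intro exI allI impI)
    fix y :: real assume y: "1 \<le> y"
    define F where "F = f y / y"
    have F: "c \<le> F" "0 < F" "1 / F \<le> k" using c y frac_le[of 1 1 c F] by (auto simp: F_def k_def intro: less_le_trans)
    have "W y = (1 / F)^4" by (simp add: W_def F_def)
    then have "\<bar>W y - 1 / a^4\<bar> = \<bar>(1/F)^4 - (1/a)^4\<bar>" by (simp add: power_divide)
    also have "(1/F)^4 - (1/a)^4 = (1/F - 1/a) * ((1/F + 1/a) * ((1/F)\<^sup>2 + (1/a)\<^sup>2))"
      by (rule difference_fourth_powers)
    also have "\<bar>\<dots>\<bar> = \<bar>1/F - 1/a\<bar> * ((1/F + 1/a) * ((1/F)\<^sup>2 + (1/a)\<^sup>2))"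
      using F a_pos by (simp add: abs_mult)
    also have "\<dots> \<le> (\<bar>F - a\<bar> * (k * k)) * ((k + k) * (k\<^sup>2 + k\<^sup>2))"
    proof (intro mult_mono add_mono power_mono)
      have "1/F - 1/a = - ((F - a) * (1/F * (1/a)))" using F a_pos by (simp add: field_simps)
      then have "\<bar>1/F - 1/a\<bar> = \<bar>F - a\<bar> * (1/F * (1/a))" using F a_pos by (simp add: abs_mult)
      also have "\<dots> \<le> \<bar>F - a\<bar> * (k * k)" using F k a_pos by (intro mult_left_mono mult_mono) auto
      finally show "\<bar>1/F - 1/a\<bar> \<le> \<bar>F - a\<bar> * (k * k)" .
    qed (use F k a_pos in auto)
    also have "\<dots> = 4 * k^5 * \<bar>F - a\<bar>" by (simp add: eval_nat_numeral)
    also have "\<dots> \<le> 4 * k^5 * (C\<^sub>0 * y powr (- (1/2)))"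
    proof (rule mult_left_mono)
      have "C\<^sub>0 / sqrt y = C\<^sub>0 * y powr (- (1/2))" using y by (simp add: powr_minus_divide powr_half_sqrt)
      then show "\<bar>F - a\<bar> \<le> C\<^sub>0 * y powr (- (1/2))" using slope[OF y] by (simp add: F_def)
    qed (use k in simp)
    finally show "\<bar>W y - 1 / a^4\<bar> \<le> 4 * k^5 * C\<^sub>0 * y powr (- (1/2))" by simp
  qed
qed

text \<open>Boundedness of \<Phi> controls the integral of h^2 / y^2, and \<open>g' = h\<close>, so
  a weighted Young inequality gives growth of \<open>g\<close> at most like y^(3/2).\<close>

lemma q_bound: "\<exists>C. \<forall>y\<ge>1. \<bar>q y\<bar> \<le> C * y powr (- (1/2))"
proof (intro exI allI impI)
  fix y :: real assume y: "1 \<le> y"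
  \<comment> \<open>The weight is fixed for each endpoint \<open>y\<close>; the power 3/2 balances
    \<open>l * - \<Phi> 1\<close> against \<open>y^3 / (6 * l)\<close>.\<close>
  define l where "l = y powr (3/2)"
  have l: "1 \<le> l" using y by (auto simp: l_def intro: ge_one_powr_ge_zero)
  have l2: "y^3 = l * l" using y by (simp add: l_def powr_add[symmetric])
  have *: "\<sigma> * g y - \<sigma> * g 1 \<le> l * (- \<Phi> 1 + 1/6)" if \<sigma>: "\<sigma>\<^sup>2 = 1" for \<sigma>
  proof -
    have "\<sigma> * g y - \<sigma> * g 1 \<le> (l * \<Phi> y + y^3 / (6 * l)) - (l * \<Phi> 1 + 1^3 / (6 * l))"
    proof (rule compare_halfline[where f = "\<lambda>y. \<sigma> * g y" and g = "\<lambda>y. l * \<Phi> y + y^3 / (6 * l)" and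
          f' = "\<lambda>y. \<sigma> * h y" and g' = "\<lambda>y. l * ((g y)\<^sup>2 * w y + (h y)\<^sup>2 / (2 * y\<^sup>2)) + y\<^sup>2 / (2 * l)"])
      fix x :: real assume x: "1 < x"
      have "0 \<le> (l * (h x / x) - \<sigma> * x)\<^sup>2 / (2 * l)" using l by simp
      also have "\<dots> = l * ((h x)\<^sup>2 / (2 * x\<^sup>2)) - \<sigma> * h x + \<sigma>\<^sup>2 * x\<^sup>2 / (2 * l)"
        using l x by (simp add: field_simps power2_eq_square)
      finally have "\<sigma> * h x \<le> l * ((h x)\<^sup>2 / (2 * x\<^sup>2)) + x\<^sup>2 / (2 * l)" using \<sigma> by simp
      moreover have "0 \<le> l * ((g x)\<^sup>2 * w x)" using l w_pos[of x] x by simp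
      ultimately show "\<sigma> * h x \<le> l * ((g x)\<^sup>2 * w x + (h x)\<^sup>2 / (2 * x\<^sup>2)) + x\<^sup>2 / (2 * l)"
        by (simp add: distrib_left)
    next
      fix x :: real assume x: "1 \<le> x"
      show "((\<lambda>y. l * \<Phi> y + y^3 / (6 * l)) has_real_derivative
          l * ((g x)\<^sup>2 * w x + (h x)\<^sup>2 / (2 * x\<^sup>2)) + x\<^sup>2 / (2 * l)) (at x within {0..})"
        using x l by (auto intro!: derivative_eq_intros d\<Phi>)
    qed (use y in \<open>auto intro!: derivative_eq_intros dg'\<close>)
    also have "\<dots> \<le> l * - \<Phi> 1 + y^3 / (6 * l)"
    proof -
      have "l * \<Phi> y \<le> 0" "0 \<le> 1^3 / (6 * l)"
        using \<Phi>_nonpos[of y] y l by (auto simp: mult_le_0_iff)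
      then show ?thesis by linarith
    qed
    also have "\<dots> = l * (- \<Phi> 1 + 1/6)" using l by (simp add: l2 field_simps)
    finally show ?thesis .
  qed
  define K where "K = - \<Phi> 1 + 1/6"
  have "\<bar>g y\<bar> \<le> \<bar>g 1\<bar> + l * K" using *[of 1] *[of "-1"] by (simp add: K_def abs_le_iff) linarith
  also have "\<dots> \<le> (\<bar>g 1\<bar> + K) * l" using mult_left_mono[OF l, of "\<bar>g 1\<bar>"] by (simp add: algebra_simps)
  finally have "\<bar>g y\<bar> / y\<^sup>2 \<le> (\<bar>g 1\<bar> + K) * l / y\<^sup>2" by (rule divide_right_mono) simp
  moreover have "l / y\<^sup>2 = y powr (- (1/2))"
    using y powr_diff[of y "3/2" 2] by (simp add: l_def)
  ultimately show "\<bar>q y\<bar> \<le> (\<bar>g 1\<bar> + K) * y powr (- (1/2))" by (simp add: q_def flip: times_divide_eq_right)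
qed

text \<open>The derivative of \<open>u\<close> is \<open>W * q / y^2\<close>, of order y^(-5/2), so
  \<open>u\<close> converges at the rate y^(-3/2); the limit still has to be shown to be 0.\<close>

lemma u_bound: "\<exists>C. \<forall>y\<ge>1. \<bar>u y\<bar> \<le> C * y powr (- (3/2))"
proof -
  obtain C1 where C1: "\<And>y. 1 \<le> y \<Longrightarrow> \<bar>q y\<bar> \<le> C1 * y powr (- (1/2))" using q_bound by blast
  obtain C2 where C2: "\<And>y. 1 \<le> y \<Longrightarrow> \<bar>W y - 1 / a^4\<bar> \<le> C2 * y powr (- (1/2))" using W_bound by blast
  have C2': "0 \<le> C2" using C2[of 1] by simp
  define D where "D = C2 + 1 / a^4"
  have W: "\<bar>W y\<bar> \<le> D" if "1 \<le> y" for y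
  proof -
    have "C2 * y powr (- (1/2)) \<le> C2 * 1"
      using that C2' by (intro mult_left_mono) (auto simp: powr_minus intro!: inverse_le_1_iff[THEN iffD2] ge_one_powr_ge_zero)
    moreover have "0 \<le> 1 / a^4" by simp
    ultimately show ?thesis using C2[OF that] unfolding D_def by linarith
  qed
  have "\<exists>L. (u \<longlongrightarrow> L) at_top \<and> (\<forall>y\<ge>1. \<bar>u y - L\<bar> \<le> - (D * C1) / (- (3/2)) * y powr (- (3/2)))"
  proof (rule powr_decay)
    fix y :: real assume y: "1 \<le> y"
    show "(u has_real_derivative g y * w y) (at y within {0..})" using du y by simp
    have "\<bar>g y * w y\<bar> = \<bar>W y\<bar> * \<bar>q y\<bar> * (1 / y\<^sup>2)" using gw[of y] y by (simp add: abs_mult)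
    also have "\<dots> \<le> D * (C1 * y powr (- (1/2))) * (1 / y\<^sup>2)"
      using W[OF y] C1[OF y] by (intro mult_mono) auto
    also have "1 / y\<^sup>2 = y powr (- 2)" using y by (simp add: powr_minus_divide)
    also have "D * (C1 * y powr (- (1/2))) * y powr (- 2) = D * C1 * (y powr (- (1/2)) * y powr (- 2))"
      by (simp add: mult.assoc)
    also have "\<dots> = D * C1 * y powr (- (3/2) - 1)" by (simp flip: powr_add)
    finally show "\<bar>g y * w y\<bar> \<le> D * C1 * y powr (- (3/2) - 1)" .
  qed simp
  then obtain L where L: "(u \<longlongrightarrow> L) at_top" "\<And>y. 1 \<le> y \<Longrightarrow> \<bar>u y - L\<bar> \<le> - (D * C1) / (- (3/2)) * y powr (- (3/2))"
    by blast
  \<comment> \<open>A nonzero limit of \<open>u\<close> makes \<open>h\<close> grow quadratically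
    and \<open>f y / y\<close> linearly, against the bounded slope.\<close>
  have "L = 0"
  proof (rule ccontr)
    assume "L \<noteq> 0"
    define \<sigma> where "\<sigma> = sgn L"
    have \<sigma>: "\<sigma> * L = \<bar>L\<bar>" "\<bar>\<sigma>\<bar> = 1" using \<open>L \<noteq> 0\<close> by (auto simp: \<sigma>_def sgn_if)
    define c where "c = \<bar>L\<bar> / 2"
    have c: "0 < c" using \<open>L \<noteq> 0\<close> by (simp add: c_def)
    have "((\<lambda>y. \<sigma> * u y) \<longlongrightarrow> \<sigma> * L) at_top" by (intro tendsto_intros L)
    then have "eventually (\<lambda>y. c < \<sigma> * u y) at_top"
      using \<sigma> c by (intro order_tendstoD(1)) (auto simp: c_def)
    then obtain N\<^sub>0 where N0: "\<And>y. N\<^sub>0 \<le> y \<Longrightarrow> c < \<sigma> * u y" by (auto simp: eventually_at_top_linorder)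
    define N where "N = max N\<^sub>0 1"
    have N: "1 \<le> N" "\<And>y. N \<le> y \<Longrightarrow> c < \<sigma> * u y" using N0 by (auto simp: N_def)
    define k where "k = \<sigma> * h N - c * N\<^sup>2 / 2"
    have h: "k + c * y\<^sup>2 / 2 \<le> \<sigma> * h y" if "N \<le> y" for y
    proof -
      have "c * y\<^sup>2 / 2 - c * N\<^sup>2 / 2 \<le> \<sigma> * h y - \<sigma> * h N"
      proof (rule compare_halfline[where f = "\<lambda>y. c * y\<^sup>2 / 2" and g = "\<lambda>y. \<sigma> * h y" and
            f' = "\<lambda>y. y * c" and g' = "\<lambda>y. y * (\<sigma> * u y)"])
        fix x assume "N < x"
        then show "x * c \<le> x * (\<sigma> * u x)" using N by (intro mult_left_mono) (auto simp: less_imp_le)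
      qed (use N that in \<open>auto intro!: derivative_eq_intros dh\<close>)
      then show ?thesis by (simp add: k_def)
    qed
    define M where "M = a + C\<^sub>0"
    have M: "\<bar>f y / y\<bar> \<le> M" if "1 \<le> y" for y
    proof -
      have "C\<^sub>0 / sqrt y \<le> C\<^sub>0 / 1" using that C\<^sub>0_nonneg by (intro divide_left_mono) auto
      then show ?thesis using slope[OF that] a_pos unfolding M_def by linarith
    qed
    define y where "y = N + 2 / c * (2 * M + 2 * \<bar>k\<bar> + 1)"
    have "0 \<le> M" using M[of 1] by simp
    then have y: "N \<le> y" using c by (simp add: y_def)
    have "(c / 2 * y - k / y) - (c / 2 * N - k / N) \<le> \<sigma> * (f y / y) - \<sigma> * (f N / N)"
    proof (rule compare_halfline[where f = "\<lambda>y. c / 2 * y - k / y" and g = "\<lambda>y. \<sigma> * (f y / y)" and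
          f' = "\<lambda>y. c / 2 + k / y\<^sup>2" and g' = "\<lambda>y. \<sigma> * (h y / y\<^sup>2)"])
      fix x assume x: "N < x"
      then have "(k + c * x\<^sup>2 / 2) / x\<^sup>2 \<le> \<sigma> * h x / x\<^sup>2" using h[of x] by (intro divide_right_mono) auto
      then show "c / 2 + k / x\<^sup>2 \<le> \<sigma> * (h x / x\<^sup>2)" using x N by (simp add: add_divide_distrib)
    next
      fix x assume "N \<le> x"
      then have x: "0 < x" using N by simp
      show "((\<lambda>y. \<sigma> * (f y / y)) has_real_derivative \<sigma> * (h x / x\<^sup>2)) (at x within {0..})"
        by (intro DERIV_cmult dF x)
      show "((\<lambda>y. c / 2 * y - k / y) has_real_derivative c / 2 + k / x\<^sup>2) (at x within {0..})"
        using x by (auto intro!: derivative_eq_intros simp: power2_eq_square)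
    qed (use N y in auto)
    moreover have "\<bar>\<sigma> * (f y / y)\<bar> \<le> M" "\<bar>\<sigma> * (f N / N)\<bar> \<le> M"
      using M[of y] M[of N] N y \<sigma>(2) by (auto simp: abs_mult)
    moreover have "\<bar>k / y\<bar> \<le> \<bar>k\<bar>" "\<bar>k / N\<bar> \<le> \<bar>k\<bar>"
      using N y by (auto simp: abs_div divide_le_eq mult_le_cancel_left1)
    moreover have "c / 2 * y - c / 2 * N = 2 * M + 2 * \<bar>k\<bar> + 1"
      using c by (simp add: y_def field_simps)
    ultimately show False by (simp only: abs_le_iff) linarith
  qed
  then show ?thesis using L(2) by (intro exI[of _ "- (D * C1) / (- (3/2))"]) simp
qed

text \<open>Plain boundedness is enough here: it excludes the mode growing like y^r from
  \<open>\<rho>\<close>.\<close>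

lemma v_bounded: "\<exists>C. \<forall>y\<ge>1. \<bar>v y\<bar> \<le> C \<and> \<bar>v\<^sub>1 y\<bar> \<le> C"
proof -
  obtain C where C: "\<And>y. 1 \<le> y \<Longrightarrow> \<bar>u y\<bar> \<le> C * y powr (- (3/2))" using u_bound by blast
  have C0: "0 \<le> C" using C[of 1] by simp
  have yu: "\<bar>y * u y\<bar> \<le> C * y powr (1/2 - 1)" if "1 \<le> y" for y
  proof -
    have "\<bar>y * u y\<bar> \<le> y * (C * y powr (- (3/2)))" using C[OF that] that by (simp add: abs_mult mult_left_mono)
    also have "\<dots> = C * y powr (1/2 - 1)" using that by (simp add: powr_mult_base mult.left_commute)
    finally show ?thesis .
  qed
  have "\<exists>D. \<forall>y\<ge>1. \<bar>h y\<bar> \<le> D * y powr (1/2)"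
    by (rule powr_growth[OF _ yu]) (auto intro!: dh)
  then obtain D where D: "\<And>y. 1 \<le> y \<Longrightarrow> \<bar>h y\<bar> \<le> D * y powr (1/2)" by blast
  have D0: "0 \<le> D" using D[of 1] by simp
  have v: "\<bar>v y\<bar> \<le> D" if "1 \<le> y" for y
  proof -
    have "\<bar>h y\<bar> \<le> D * y powr 1"
      using D[OF that] that D0 by (elim order_trans) (intro mult_left_mono powr_mono, auto)
    then show ?thesis using that by (simp add: v_def abs_div divide_le_eq)
  qed
  have "\<bar>v\<^sub>1 y\<bar> \<le> C + D" if "1 \<le> y" for y
  proof -
    have "y powr (1/2 - 1) \<le> y powr 0" using that by (intro powr_mono) auto
    then have "C * y powr (1/2 - 1) \<le> C * 1" using that C0 by (intro mult_left_mono) auto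
    then show ?thesis using yu[OF that] v[OF that] unfolding v\<^sub>1_def by linarith
  qed
  moreover have "\<bar>v y\<bar> \<le> C + D" if "1 \<le> y" for y using v[OF that] C0 by linarith
  ultimately show ?thesis by blast
qed


lemma \<rho>_bounded: "\<exists>C. \<forall>y\<ge>1. \<bar>\<rho> y\<bar> \<le> C"
proof -
  obtain C where C: "\<And>y. 1 \<le> y \<Longrightarrow> \<bar>v y\<bar> \<le> C" "\<And>y. 1 \<le> y \<Longrightarrow> \<bar>v\<^sub>1 y\<bar> \<le> C" using v_bounded by blast
  obtain D where D: "\<And>y. 1 \<le> y \<Longrightarrow> \<bar>q y\<bar> \<le> D * y powr (- (1/2))" using q_bound by blast
  have "0 \<le> D" using D[of 1] by simp
  have "\<bar>\<rho> y\<bar> \<le> r * C + C + (r\<^sup>2 - 1) * D" if y: "1 \<le> y" for y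
  proof -
    have "y powr (- (1/2)) \<le> y powr 0" using y by (intro powr_mono) auto
    then have "D * y powr (- (1/2)) \<le> D * 1" using \<open>0 \<le> D\<close> y by (intro mult_left_mono) auto
    then have "\<bar>q y\<bar> \<le> D" using D[OF y] by simp
    have r2: "0 \<le> r\<^sup>2 - 1" using r_gt by (simp add: power2_eq_square) (smt (verit) mult_le_cancel_left1)
    have "\<bar>\<rho> y\<bar> \<le> \<bar>r * v y\<bar> + \<bar>v\<^sub>1 y\<bar> + \<bar>(r\<^sup>2 - 1) * q y\<bar>" unfolding \<rho>_def by linarith
    also have "\<dots> \<le> r * C + C + (r\<^sup>2 - 1) * D"
      using C[OF y] \<open>\<bar>q y\<bar> \<le> D\<close> r_gt r2 by (intro add_mono) (auto simp: abs_mult intro!: mult_left_mono)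
    finally show ?thesis .
  qed
  then show ?thesis by blast
qed

text \<open>The error is a product of two small quantities, and \<open>W_bound\<close> supplies a
  gain of up to 1/2. A smaller gain \<delta> is allowed so that the exponents can be steered past
  \<open>s\<close>.\<close>

lemma e_decay:
  assumes "\<And>y. 1 \<le> y \<Longrightarrow> \<bar>q y\<bar> \<le> C * y powr (- k)" and \<delta>: "\<delta> \<le> 1/2"
  shows "\<exists>D. \<forall>y\<ge>1. \<bar>e y\<bar> \<le> D * y powr (- (k + \<delta>))"
proof -
  obtain K where K: "\<And>y. 1 \<le> y \<Longrightarrow> \<bar>W y - 1 / a^4\<bar> \<le> K * y powr (- (1/2))" using W_bound by blast
  have K0: "0 \<le> K" using K[of 1] by simp
  have "\<bar>e y\<bar> \<le> K * C * y powr (- (k + \<delta>))" if y: "1 \<le> y" for y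
  proof -
    have "y powr (- (1/2)) \<le> y powr (- \<delta>)" using y \<delta> by (intro powr_mono) auto
    then have "\<bar>W y - 1 / a^4\<bar> \<le> K * y powr (- \<delta>)"
      using K[OF y] K0 by (meson mult_left_mono order_trans)
    then have "\<bar>e y\<bar> \<le> (K * y powr (- \<delta>)) * (C * y powr (- k))"
      unfolding e_def abs_mult using assms(1)[OF y] K0 by (intro mult_mono) auto
    also have "\<dots> = K * C * (y powr (- k) * y powr (- \<delta>))" by simp
    also have "\<dots> = K * C * y powr (- (k + \<delta>))" by (simp flip: powr_add)
    finally show ?thesis .
  qed
  then show ?thesis by blast
qed

text \<open>Boundedness of \<open>\<rho>\<close> makes \<open>y powr (- r) * \<rho> y\<close> tend
  to 0, so the unstable component can be integrated from infinity and inherits the decay of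
  \<open>e\<close>.\<close>

lemma \<rho>_decay:
  assumes e: "\<And>y. 1 \<le> y \<Longrightarrow> \<bar>e y\<bar> \<le> D * y powr (- k)" and k: "0 < k"
  shows "\<exists>C. \<forall>y\<ge>1. \<bar>\<rho> y\<bar> \<le> C * y powr (- k)"
proof -
  define R where "R = (\<lambda>y. y powr (- r) * \<rho> y)"
  have "\<exists>L. (R \<longlongrightarrow> L) at_top \<and> (\<forall>y\<ge>1. \<bar>R y - L\<bar> \<le> - D / (- (r + k)) * y powr (- (r + k)))"
  proof (rule powr_decay)
    fix y :: real assume y: "1 \<le> y"
    have p: "((\<lambda>y. y powr (- r)) has_real_derivative - r * y powr (- r - 1)) (at y within {0..})"
      using has_field_derivative_at_within[OF has_real_derivative_powr[of y "- r"]] y by simp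
    have "y powr (- r) = y * y powr (- r - 1)" using y by (simp add: powr_mult_base)
    then have "- r * y powr (- r - 1) * \<rho> y + (r * \<rho> y + e y) / y * y powr (- r) = y powr (- r - 1) * e y"
      using y by (simp add: field_simps)
    then show "(R has_real_derivative y powr (- r - 1) * e y) (at y within {0..})"
      unfolding R_def using DERIV_mult[OF p d\<rho>[of y]] y by simp
    have "\<bar>y powr (- r - 1) * e y\<bar> \<le> y powr (- r - 1) * (D * y powr (- k))"
      unfolding abs_mult using e[OF y] by (intro mult_mono) auto
    also have "\<dots> = D * (y powr (- r - 1) * y powr (- k))" by simp
    also have "\<dots> = D * y powr (- (r + k) - 1)" by (simp flip: powr_add) (simp add: algebra_simps)
    finally show "\<bar>y powr (- r - 1) * e y\<bar> \<le> D * y powr (- (r + k) - 1)" .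
  qed (use r_gt k in simp)
  then obtain L where L: "(R \<longlongrightarrow> L) at_top" "\<And>y. 1 \<le> y \<Longrightarrow> \<bar>R y - L\<bar> \<le> - D / (- (r + k)) * y powr (- (r + k))"
    by blast
  obtain C where C: "\<And>y. 1 \<le> y \<Longrightarrow> \<bar>\<rho> y\<bar> \<le> C" using \<rho>_bounded by blast
  have "(R \<longlongrightarrow> 0) at_top"
  proof (rule Lim_null_comparison)
    show "((\<lambda>y. C * y powr (- r)) \<longlongrightarrow> 0) at_top"
      by (intro tendsto_mult_right_zero tendsto_neg_powr filterlim_ident) (use r_gt in simp)
    show "\<forall>\<^sub>F y in at_top. norm (R y) \<le> C * y powr (- r)"
      using eventually_ge_at_top[of 1]
      by eventually_elim (use C in \<open>auto simp: R_def abs_mult mult.commute intro!: mult_left_mono\<close>)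
  qed
  then have "L = 0" using L(1) tendsto_unique[OF trivial_limit_at_top_linorder] by blast
  have "\<bar>\<rho> y\<bar> \<le> D / (r + k) * y powr (- k)" if y: "1 \<le> y" for y
  proof -
    have "y powr r * y powr (- r) = 1" using y by (simp flip: powr_add)
    then have "\<rho> y = y powr r * R y" by (simp add: R_def flip: mult.assoc)
    then have "\<bar>\<rho> y\<bar> = y powr r * \<bar>R y\<bar>" by (simp add: abs_mult)
    also have "\<dots> \<le> y powr r * (D / (r + k) * y powr (- (r + k)))"
    proof (rule mult_left_mono)
      have "- D / (- (r + k)) = D / (r + k)" by (rule minus_divide_divide)
      then show "\<bar>R y\<bar> \<le> D / (r + k) * y powr (- (r + k))"
        using L(2)[OF y] unfolding \<open>L = 0\<close> by (simp only: diff_zero)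
    qed simp
    also have "\<dots> = D / (r + k) * (y powr r * y powr (- (r + k)))" by simp
    also have "\<dots> = D / (r + k) * y powr (- k)" by (simp flip: powr_add)
    finally show ?thesis .
  qed
  then show ?thesis by blast
qed

section \<open>Bootstrap of the decay rate\<close>

lemma PQ_derivative_bounds:
  assumes e: "\<And>y. 1 \<le> y \<Longrightarrow> \<bar>e y\<bar> \<le> D * y powr (- k)" and y: "1 \<le> y"
  shows "\<bar>y powr (s - 1) * e y * cos (\<omega> * ln y)\<bar> \<le> D * y powr ((s - k) - 1)"
    "\<bar>- (y powr (s - 1) * e y * sin (\<omega> * ln y))\<bar> \<le> D * y powr ((s - k) - 1)"
proof -
  have *: "\<bar>y powr (s - 1) * e y * t\<bar> \<le> D * y powr ((s - k) - 1)" if "\<bar>t\<bar> \<le> 1" for t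
  proof -
    have "\<bar>y powr (s - 1) * e y * t\<bar> \<le> y powr (s - 1) * \<bar>e y\<bar> * 1"
      unfolding abs_mult using that by (intro mult_mono) auto
    also have "\<dots> \<le> y powr (s - 1) * (D * y powr (- k))" using e[OF y] by (simp add: mult_left_mono)
    also have "\<dots> = D * (y powr (s - 1) * y powr (- k))" by simp
    also have "\<dots> = D * y powr ((s - k) - 1)" by (simp flip: powr_add) (simp add: algebra_simps)
    finally show ?thesis .
  qed
  show "\<bar>y powr (s - 1) * e y * cos (\<omega> * ln y)\<bar> \<le> D * y powr ((s - k) - 1)"
    "\<bar>- (y powr (s - 1) * e y * sin (\<omega> * ln y))\<bar> \<le> D * y powr ((s - k) - 1)"
    using *[of "cos (\<omega> * ln y)"] *[of "sin (\<omega> * ln y)"] by auto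
qed

lemma XY_eq:
  assumes "0 < y"
  shows "X y = y powr (- s) * (P y * cos (\<omega> * ln y) - Q y * sin (\<omega> * ln y))"
    "Y y = y powr (- s) * (Q y * cos (\<omega> * ln y) + P y * sin (\<omega> * ln y))"
proof -
  define c where "c = cos (\<omega> * ln y)"
  define n where "n = sin (\<omega> * ln y)"
  have cn: "c * c + n * n = 1" using sin_cos_squared_add3[of "\<omega> * ln y"] by (simp add: c_def n_def)
  have p: "y powr (- s) * y powr s = 1" using assms by (simp flip: powr_add)
  have "P y * c - Q y * n = y powr s * (X y * (c * c + n * n))"
    "Q y * c + P y * n = y powr s * (Y y * (c * c + n * n))"
    unfolding P_def Q_def c_def[symmetric] n_def[symmetric] by (simp_all add: algebra_simps)
  then have "y powr (- s) * (P y * c - Q y * n) = (y powr (- s) * y powr s) * X y"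
    "y powr (- s) * (Q y * c + P y * n) = (y powr (- s) * y powr s) * Y y"
    by (simp_all add: cn)
  then show "X y = y powr (- s) * (P y * cos (\<omega> * ln y) - Q y * sin (\<omega> * ln y))"
    "Y y = y powr (- s) * (Q y * cos (\<omega> * ln y) + P y * sin (\<omega> * ln y))"
    by (simp_all add: p c_def n_def)
qed

text \<open>The squared distance between the eigenvalues \<open>r\<close> and -s + i \<omega>; it is
  the denominator when the eigencoordinates are inverted.\<close>

definition "\<Delta> = (s + r)\<^sup>2 + \<omega>\<^sup>2"

lemma \<Delta>_pos: "0 < \<Delta>" using \<omega>_pos by (simp add: \<Delta>_def add_nonneg_pos)

lemma q_eq: "q y = - (X y - \<rho> y + (s + r) * (Y y / \<omega>)) / \<Delta>"
proof -
  have "X y - \<rho> y + (s + r) * (Y y / \<omega>) = - \<Delta> * q y"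
    using \<omega>_pos unfolding X_def Y_def \<rho>_def \<Delta>_def by (simp add: field_simps power2_eq_square)
  then show ?thesis using \<Delta>_pos by simp
qed

lemma v_eq: "v y = Y y / \<omega> + 2 * s * q y"
  using \<omega>_pos by (simp add: Y_def field_simps)

text \<open>The gain in \<open>e\<close> passes to \<open>\<rho>\<close> by integration from
  infinity and to \<open>X\<close>, \<open>Y\<close> by integration from 1, and \<open>q\<close> is
  a combination of the three. The condition \<open>k + \<delta> < s\<close> keeps the growth
  exponent of \<open>P\<close> and \<open>Q\<close> positive.\<close>

lemma q_decay_step:
  assumes q: "\<And>y. 1 \<le> y \<Longrightarrow> \<bar>q y\<bar> \<le> C * y powr (- k)" and k: "0 < k + \<delta>" "\<delta> \<le> 1/2" "k + \<delta> < s"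
  shows "\<exists>D. \<forall>y\<ge>1. \<bar>q y\<bar> \<le> D * y powr (- (k + \<delta>))"
proof -
  define j where "j = k + \<delta>"
  obtain D where D: "\<And>y. 1 \<le> y \<Longrightarrow> \<bar>e y\<bar> \<le> D * y powr (- j)" using e_decay[OF q k(2)] by (auto simp: j_def)
  obtain C1 where C1: "\<And>y. 1 \<le> y \<Longrightarrow> \<bar>\<rho> y\<bar> \<le> C1 * y powr (- j)" using \<rho>_decay[OF D] k by (auto simp: j_def)
  have "\<exists>K. \<forall>y\<ge>1. \<bar>P y\<bar> \<le> K * y powr (s - j)"
    by (rule powr_growth[OF _ PQ_derivative_bounds(1)[OF D]]) (use k dP in \<open>auto simp: j_def\<close>)
  then obtain C2 where C2: "\<And>y. 1 \<le> y \<Longrightarrow> \<bar>P y\<bar> \<le> C2 * y powr (s - j)" by blast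
  have "\<exists>K. \<forall>y\<ge>1. \<bar>Q y\<bar> \<le> K * y powr (s - j)"
    by (rule powr_growth[OF _ PQ_derivative_bounds(2)[OF D]]) (use k dQ in \<open>auto simp: j_def\<close>)
  then obtain C3 where C3: "\<And>y. 1 \<le> y \<Longrightarrow> \<bar>Q y\<bar> \<le> C3 * y powr (s - j)" by blast
  define E where "E = C2 + C3"
  have XY: "\<bar>X y\<bar> \<le> E * y powr (- j)" "\<bar>Y y\<bar> \<le> E * y powr (- j)" if y: "1 \<le> y" for y
  proof -
    have *: "\<bar>y powr (- s) * t\<bar> \<le> E * y powr (- j)" if t: "\<bar>t\<bar> \<le> \<bar>P y\<bar> + \<bar>Q y\<bar>" for t
    proof -
      have "\<bar>y powr (- s) * t\<bar> \<le> y powr (- s) * (E * y powr (s - j))"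
        unfolding abs_mult E_def using t C2[OF y] C3[OF y] by (intro mult_mono) (auto simp: distrib_right)
      also have "\<dots> = E * (y powr (- s) * y powr (s - j))" by simp
      also have "\<dots> = E * y powr (- j)" by (simp flip: powr_add)
      finally show ?thesis .
    qed
    have "\<bar>P y * cos (\<omega> * ln y) - Q y * sin (\<omega> * ln y)\<bar> \<le> \<bar>P y\<bar> + \<bar>Q y\<bar>"
      using abs_cos_sin_combination_le(2)[of "P y" "\<omega> * ln y" "Q y"] by simp
    then show "\<bar>X y\<bar> \<le> E * y powr (- j)" using XY_eq(1)[of y] *[of "P y * cos (\<omega> * ln y) - Q y * sin (\<omega> * ln y)"] y by simp
    have "\<bar>Q y * cos (\<omega> * ln y) + P y * sin (\<omega> * ln y)\<bar> \<le> \<bar>P y\<bar> + \<bar>Q y\<bar>"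
      using abs_cos_sin_combination_le(1)[of "Q y" "\<omega> * ln y" "P y"] by simp
    then show "\<bar>Y y\<bar> \<le> E * y powr (- j)" using XY_eq(2)[of y] *[of "Q y * cos (\<omega> * ln y) + P y * sin (\<omega> * ln y)"] y by simp
  qed
  have "\<bar>q y\<bar> \<le> (E + C1 + (s + r) / \<omega> * E) / \<Delta> * y powr (- j)" if y: "1 \<le> y" for y
  proof -
    have sr: "0 \<le> (s + r) / \<omega>" using s_gt r_gt \<omega>_pos by simp
    have "\<bar>X y - \<rho> y + (s + r) * (Y y / \<omega>)\<bar> \<le> \<bar>X y\<bar> + \<bar>\<rho> y\<bar> + \<bar>(s + r) / \<omega> * Y y\<bar>"
    proof -
      have tri: "\<bar>x - z + t\<bar> \<le> \<bar>x\<bar> + \<bar>z\<bar> + \<bar>t\<bar>" for x z t :: real by linarith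
      have eq: "(s + r) * (Y y / \<omega>) = (s + r) / \<omega> * Y y" by simp
      show ?thesis unfolding eq by (rule tri)
    qed
    also have "\<dots> \<le> E * y powr (- j) + C1 * y powr (- j) + (s + r) / \<omega> * (E * y powr (- j))"
      unfolding abs_mult using XY[OF y] C1[OF y] sr by (intro add_mono mult_mono) auto
    also have "\<dots> = (E + C1 + (s + r) / \<omega> * E) * y powr (- j)" by (simp add: algebra_simps)
    finally have "\<bar>X y - \<rho> y + (s + r) * (Y y / \<omega>)\<bar> / \<Delta> \<le> (E + C1 + (s + r) / \<omega> * E) * y powr (- j) / \<Delta>"
      using \<Delta>_pos by (intro divide_right_mono) auto
    moreover have "\<bar>q y\<bar> = \<bar>X y - \<rho> y + (s + r) * (Y y / \<omega>)\<bar> / \<Delta>"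
      using \<Delta>_pos by (simp only: q_eq abs_divide abs_minus_cancel abs_of_pos)
    ultimately show ?thesis by simp
  qed
  then show ?thesis unfolding j_def by blast
qed

text \<open>The step size avoids hitting the resonant exponent \<open>s\<close> exactly.\<close>

lemma q_decay: "\<exists>k \<delta> C. 0 < k \<and> 0 < \<delta> \<and> \<delta> \<le> 1/2 \<and> s < k + \<delta> \<and> (\<forall>y\<ge>1. \<bar>q y\<bar> \<le> C * y powr (- k))"
proof -
  define n where "n = nat \<lceil>2 * s\<rceil>"
  have n: "2 * s \<le> real n" unfolding n_def by linarith
  \<comment> \<open>Starting from 1/2, the exponent is s - \<delta> / 2 after \<open>n\<close>
    steps, and one further gain takes it to s + \<delta> / 2.\<close>
  define \<delta> where "\<delta> = (s - 1/2) / (real n + 1/2)"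
  have \<delta>: "0 < \<delta>" "\<delta> \<le> 1/2" using s_gt n by (auto simp: \<delta>_def field_simps)
  have "\<exists>C. \<forall>y\<ge>1. \<bar>q y\<bar> \<le> C * y powr (- (1/2 + real j * \<delta>))" if "j \<le> n" for j
    using that
  proof (induction j)
    case 0
    then show ?case using q_bound by simp
  next
    case (Suc j)
    then obtain C where C: "\<And>y. 1 \<le> y \<Longrightarrow> \<bar>q y\<bar> \<le> C * y powr (- (1/2 + real j * \<delta>))" by auto
    have "real (Suc j) * \<delta> \<le> real n * \<delta>" using Suc.prems \<delta> by (intro mult_right_mono) auto
    also have "\<dots> < (real n + 1/2) * \<delta>" using \<delta> by simp
    also have "\<dots> = s - 1/2" by (simp add: \<delta>_def)
    finally have "1/2 + real j * \<delta> + \<delta> < s" by (simp add: algebra_simps)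
    moreover have "0 < 1/2 + real j * \<delta> + \<delta>" using \<delta> by (intro add_pos_pos add_pos_nonneg) auto
    ultimately have "\<exists>D. \<forall>y\<ge>1. \<bar>q y\<bar> \<le> D * y powr (- (1/2 + real j * \<delta> + \<delta>))"
      using q_decay_step[OF C, of \<delta>] \<delta> by auto
    then show ?case by (simp add: algebra_simps)
  qed
  then obtain C where "\<And>y. 1 \<le> y \<Longrightarrow> \<bar>q y\<bar> \<le> C * y powr (- (1/2 + real n * \<delta>))" by blast
  moreover have "s < 1/2 + real n * \<delta> + \<delta>"
  proof -
    have "(real n + 1/2) * \<delta> = s - 1/2" by (simp add: \<delta>_def)
    then show ?thesis using \<delta> by (simp add: algebra_simps)
  qed
  moreover have "0 < 1/2 + real n * \<delta>" using \<delta> by (intro add_pos_nonneg) auto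
  ultimately show ?thesis using \<delta> by blast
qed

text \<open>Once \<open>e\<close> decays faster than y^(-s), the derivatives of \<open>P\<close> and
  \<open>Q\<close> are integrable at infinity; their limits are the amplitudes of the
  oscillation.\<close>

lemma v_asymptotics:
  "\<exists>c n j C. s < j \<and> (\<forall>y\<ge>1. \<bar>v y - y powr (- s) * (c * cos (\<omega> * ln y) + n * sin (\<omega> * ln y))\<bar> \<le> C * y powr (- j))"
proof -
  obtain k \<delta> C where k: "0 < k" "0 < \<delta>" "\<delta> \<le> 1/2" "s < k + \<delta>"
    and q: "\<And>y. 1 \<le> y \<Longrightarrow> \<bar>q y\<bar> \<le> C * y powr (- k)" using q_decay by blast
  define j where "j = k + \<delta>"
  obtain D where D: "\<And>y. 1 \<le> y \<Longrightarrow> \<bar>e y\<bar> \<le> D * y powr (- j)" using e_decay[OF q k(3)] by (auto simp: j_def)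
  obtain C1 where C1: "\<And>y. 1 \<le> y \<Longrightarrow> \<bar>\<rho> y\<bar> \<le> C1 * y powr (- j)" using \<rho>_decay[OF D] k by (auto simp: j_def)
  define E where "E = - D / (s - j)"
  have "\<exists>L. (P \<longlongrightarrow> L) at_top \<and> (\<forall>y\<ge>1. \<bar>P y - L\<bar> \<le> - D / (s - j) * y powr (s - j))"
    by (rule powr_decay[OF _ PQ_derivative_bounds(1)[OF D]]) (use k dP in \<open>auto simp: j_def\<close>)
  then obtain A where A: "\<And>y. 1 \<le> y \<Longrightarrow> \<bar>P y - A\<bar> \<le> E * y powr (s - j)" by (auto simp: E_def)
  have "\<exists>L. (Q \<longlongrightarrow> L) at_top \<and> (\<forall>y\<ge>1. \<bar>Q y - L\<bar> \<le> - D / (s - j) * y powr (s - j))"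
    by (rule powr_decay[OF _ PQ_derivative_bounds(2)[OF D]]) (use k dQ in \<open>auto simp: j_def\<close>)
  then obtain B where B: "\<And>y. 1 \<le> y \<Longrightarrow> \<bar>Q y - B\<bar> \<le> E * y powr (s - j)" by (auto simp: E_def)
  define \<alpha> where "\<alpha> = - 2 * s / \<Delta>"
  define \<beta> where "\<beta> = 1 / \<omega> - 2 * s * (s + r) / (\<omega> * \<Delta>)"
  have v: "v y = \<alpha> * X y + \<beta> * Y y - \<alpha> * \<rho> y" for y
    using \<Delta>_pos \<omega>_pos unfolding v_eq q_eq \<alpha>_def \<beta>_def by (simp add: field_simps)
  define M where "M = (\<bar>\<alpha>\<bar> + \<bar>\<beta>\<bar>) * (2 * E) + \<bar>\<alpha>\<bar> * C1"
  have "\<bar>v y - y powr (- s) * ((\<alpha> * A + \<beta> * B) * cos (\<omega> * ln y) + (\<beta> * A - \<alpha> * B) * sin (\<omega> * ln y))\<bar>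
      \<le> M * y powr (- j)" if y: "1 \<le> y" for y
  proof -
    define c where "c = cos (\<omega> * ln y)"
    define n where "n = sin (\<omega> * ln y)"
    define t1 where "t1 = (P y - A) * c - (Q y - B) * n"
    define t2 where "t2 = (Q y - B) * c + (P y - A) * n"
    have t: "\<bar>t1\<bar> \<le> 2 * E * y powr (s - j)" "\<bar>t2\<bar> \<le> 2 * E * y powr (s - j)"
      using A[OF y] B[OF y] abs_cos_sin_combination_le(2)[of "P y - A" "\<omega> * ln y" "Q y - B"]
        abs_cos_sin_combination_le(1)[of "Q y - B" "\<omega> * ln y" "P y - A"]
      by (simp_all add: t1_def t2_def c_def n_def)
    have T: "\<bar>z * (y powr (- s) * t)\<bar> \<le> \<bar>z\<bar> * (2 * E) * y powr (- j)" if "\<bar>t\<bar> \<le> 2 * E * y powr (s - j)" for z t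
    proof -
      have "\<bar>z * (y powr (- s) * t)\<bar> = \<bar>z\<bar> * (y powr (- s) * \<bar>t\<bar>)" by (simp add: abs_mult)
      also have "\<dots> \<le> \<bar>z\<bar> * (y powr (- s) * (2 * E * y powr (s - j)))"
        using that by (intro mult_left_mono) auto
      also have "\<dots> = \<bar>z\<bar> * (2 * E) * (y powr (- s) * y powr (s - j))" by simp
      finally show ?thesis by (simp flip: powr_add)
    qed
    have "v y - y powr (- s) * ((\<alpha> * A + \<beta> * B) * c + (\<beta> * A - \<alpha> * B) * n)
        = \<alpha> * (y powr (- s) * t1) + \<beta> * (y powr (- s) * t2) - \<alpha> * \<rho> y"
      using y unfolding v t1_def t2_def c_def n_def by (subst XY_eq(1), simp, subst XY_eq(2), simp) (simp add: algebra_simps)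
    also have "\<bar>\<dots>\<bar> \<le> \<bar>\<alpha> * (y powr (- s) * t1)\<bar> + \<bar>\<beta> * (y powr (- s) * t2)\<bar> + \<bar>\<alpha> * \<rho> y\<bar>" by linarith
    also have "\<dots> \<le> \<bar>\<alpha>\<bar> * (2 * E) * y powr (- j) + \<bar>\<beta>\<bar> * (2 * E) * y powr (- j) + \<bar>\<alpha>\<bar> * (C1 * y powr (- j))"
      using C1[OF y] by (intro add_mono T t) (auto simp: abs_mult intro!: mult_left_mono)
    also have "\<dots> = M * y powr (- j)" by (simp add: M_def algebra_simps)
    finally show ?thesis by (simp only: c_def n_def)
  qed
  then show ?thesis using k(4) unfolding j_def[symmetric] by blast
qed

theorem slope_asymptotics:
  "\<exists>m n j C. s < j \<and> (\<forall>y\<ge>1. \<bar>f y / y - a - y powr (- s) * (m * cos (\<omega> * ln y) + n * sin (\<omega> * ln y))\<bar> \<le> C * y powr (- j))"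
proof -
  obtain c d j C where j: "s < j"
    and v: "\<And>y. 1 \<le> y \<Longrightarrow> \<bar>v y - y powr (- s) * (c * cos (\<omega> * ln y) + d * sin (\<omega> * ln y))\<bar> \<le> C * y powr (- j)"
    using v_asymptotics by blast
  define N where "N = s\<^sup>2 + \<omega>\<^sup>2"
  have N: "0 < N" using \<omega>_pos by (simp add: N_def add_nonneg_pos)
  \<comment> \<open>The solution of the linear system \<open>mn\<close>, which makes the oscillating
    term with \<open>m\<close>, \<open>n\<close> an antiderivative of 1/y times the one with
    \<open>c\<close>, \<open>d\<close>, in accordance with (f / y)' = v / y.\<close>
  define m where "m = - (s * c + \<omega> * d) / N"
  define n where "n = (\<omega> * c - s * d) / N"
  have mn: "- s * m + \<omega> * n = c" "- s * n - \<omega> * m = d"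
  proof -
    have "- s * m + \<omega> * n = c * N / N" unfolding m_def n_def N_def by (simp add: add_divide_distrib[symmetric] algebra_simps power2_eq_square diff_divide_distrib[symmetric])
    then show "- s * m + \<omega> * n = c" using N by simp
    have "- s * n - \<omega> * m = d * N / N" unfolding m_def n_def N_def by (simp add: add_divide_distrib[symmetric] algebra_simps power2_eq_square diff_divide_distrib[symmetric])
    then show "- s * n - \<omega> * m = d" using N by simp
  qed
  define G where "G = (\<lambda>y. f y / y - y powr (- s) * (m * cos (\<omega> * ln y) + n * sin (\<omega> * ln y)))"
  define G' where "G' = (\<lambda>y. (v y - y powr (- s) * (c * cos (\<omega> * ln y) + d * sin (\<omega> * ln y))) / y)"
  have "\<exists>L. (G \<longlongrightarrow> L) at_top \<and> (\<forall>y\<ge>1. \<bar>G y - L\<bar> \<le> - C / (- j) * y powr (- j))"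
  proof (rule powr_decay)
    fix y :: real assume y: "1 \<le> y"
    have p: "((\<lambda>y. y powr (- s)) has_real_derivative - s * y powr (- s - 1)) (at y within {0..})"
      using has_field_derivative_at_within[OF has_real_derivative_powr[of y "- s"]] y by simp
    define p1 where "p1 = y powr (- s - 1)"
    have p1: "y powr (- s) = y * p1" using y by (simp add: powr_mult_base p1_def)
    define x where "x = cos (\<omega> * ln y)"
    define z where "z = sin (\<omega> * ln y)"
    have t: "((\<lambda>y. m * cos (\<omega> * ln y) + n * sin (\<omega> * ln y)) has_real_derivative
        n * (x * (\<omega> * (1 / y))) - m * (z * (\<omega> * (1 / y)))) (at y within {0..})"
      unfolding x_def z_def using y by (auto intro!: derivative_eq_intros simp: algebra_simps)
    have "(G has_real_derivative h y / y\<^sup>2 - (- s * p1 * (m * x + n * z)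
        + y powr (- s) * (n * (x * (\<omega> * (1 / y))) - m * (z * (\<omega> * (1 / y)))))) (at y within {0..})"
      using DERIV_diff[OF dF[of y] DERIV_mult[OF p t]] y
      unfolding G_def x_def z_def p1_def by (simp add: mult.commute)
    moreover have "h y / y\<^sup>2 - (- s * p1 * (m * x + n * z)
        + y powr (- s) * (n * (x * (\<omega> * (1 / y))) - m * (z * (\<omega> * (1 / y))))) = G' y"
    proof -
      have "y powr (- s) * (n * (x * (\<omega> * (1 / y))) - m * (z * (\<omega> * (1 / y)))) = p1 * (\<omega> * n * x - \<omega> * m * z)"
        unfolding p1 using y by (simp add: field_simps)
      then have "- s * p1 * (m * x + n * z) + y powr (- s) * (n * (x * (\<omega> * (1 / y))) - m * (z * (\<omega> * (1 / y))))
          = p1 * ((- s * m + \<omega> * n) * x + (- s * n - \<omega> * m) * z)" by (simp add: algebra_simps)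
      also have "\<dots> = y powr (- s) * (c * x + d * z) / y" unfolding mn p1 using y by simp
      finally show ?thesis
        unfolding G'_def x_def[symmetric] z_def[symmetric] v_def
        by (simp add: diff_divide_distrib power2_eq_square)
    qed
    ultimately show "(G has_real_derivative G' y) (at y within {0..})" by simp
    have "\<bar>G' y\<bar> \<le> C * y powr (- j) / y"
      unfolding G'_def abs_div using v[OF y] y by (simp add: divide_right_mono)
    also have "\<dots> = C * (y powr (- j) / y powr 1)" using y by simp
    also have "\<dots> = C * y powr (- j - 1)" by (simp only: powr_diff)
    finally show "\<bar>G' y\<bar> \<le> C * y powr (- j - 1)" .
  qed (use j s_gt in simp)
  then obtain L where L: "(G \<longlongrightarrow> L) at_top" "\<And>y. 1 \<le> y \<Longrightarrow> \<bar>G y - L\<bar> \<le> - C / (- j) * y powr (- j)" by blast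
  have "((\<lambda>y. y powr (- s) * (m * cos (\<omega> * ln y) + n * sin (\<omega> * ln y))) \<longlongrightarrow> 0) at_top"
  proof (rule Lim_null_comparison)
    show "((\<lambda>y. (\<bar>m\<bar> + \<bar>n\<bar>) * y powr (- s)) \<longlongrightarrow> 0) at_top"
      by (rule tendsto_mult_right_zero[OF tendsto_neg_powr[OF _ filterlim_ident]]) (use s_gt in simp)
    show "\<forall>\<^sub>F y in at_top. norm (y powr (- s) * (m * cos (\<omega> * ln y) + n * sin (\<omega> * ln y))) \<le> (\<bar>m\<bar> + \<bar>n\<bar>) * y powr (- s)"
    proof (intro always_eventually allI)
      fix y
      have "norm (y powr (- s) * (m * cos (\<omega> * ln y) + n * sin (\<omega> * ln y)))
          = \<bar>m * cos (\<omega> * ln y) + n * sin (\<omega> * ln y)\<bar> * y powr (- s)" by (simp add: abs_mult)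
      also have "\<dots> \<le> (\<bar>m\<bar> + \<bar>n\<bar>) * y powr (- s)"
        by (intro mult_right_mono abs_cos_sin_combination_le) auto
      finally show "norm (y powr (- s) * (m * cos (\<omega> * ln y) + n * sin (\<omega> * ln y))) \<le> (\<bar>m\<bar> + \<bar>n\<bar>) * y powr (- s)" .
    qed
  qed
  then have "(G \<longlongrightarrow> a - 0) at_top" unfolding G_def by (intro tendsto_diff slope_tendsto)
  then have "L = a" using L(1) tendsto_unique[OF trivial_limit_at_top_linorder] by fastforce
  then have "\<bar>f y / y - a - y powr (- s) * (m * cos (\<omega> * ln y) + n * sin (\<omega> * ln y))\<bar> \<le> - C / (- j) * y powr (- j)"
    if "1 \<le> y" for y
    using L(2)[OF that] by (simp add: G_def algebra_simps)
  then show ?thesis using j by blast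
qed

end

section \<open>The self-similar solutions\<close>

lemma trapped_solution:
  assumes m: "0 \<le> m"
  obtains f p u g \<kappa> where "\<kappa> < sqrt 12" "trapped_film f p u g (\<lambda>y. f y powr - m) \<kappa>"
proof -
  define W where "W = (\<lambda>x::real. max x (1/4) powr - m)"
  \<comment> \<open>One constant serves as upper bound and as Lipschitz constant; the slope of the
    truncated power is steepest at 1/4.\<close>
  define C where "C = max ((1/4) powr - m) (m * (1/4) powr (- m - 1))"
  have lip: "\<bar>W x - W z\<bar> \<le> C * \<bar>x - z\<bar>" if "x \<le> z" for x z
  proof (cases "max x (1/4) = max z (1/4)")
    case True
    then show ?thesis by (simp add: W_def C_def mult_nonneg_nonneg le_max_iff_disj)
  next
    case False
    define b where "b = max x (1/4)"
    define c where "c = max z (1/4)"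
    have bc: "1/4 \<le> b" "b < c" "c - b \<le> z - x" using that False by (auto simp: b_def c_def)
    have "\<exists>t>b. t < c \<and> c powr - m - b powr - m = (c - b) * (- m * t powr (- m - 1))"
      by (rule MVT2[OF bc(2)]) (use bc has_real_derivative_powr[of _ "- m"] in auto)
    then obtain t where t: "b < t" "c powr - m - b powr - m = (c - b) * (- m * t powr (- m - 1))" by blast
    have "W x - W z = (c - b) * (m * t powr (- m - 1))"
      using t(2) by (simp add: W_def flip: b_def c_def)
    then have "\<bar>W x - W z\<bar> = (c - b) * (m * t powr (- m - 1))"
      using bc m by simp
    also have "\<dots> \<le> (z - x) * (m * (1/4) powr (- m - 1))"
      using bc t m by (intro mult_mono powr_mono2') auto
    also have "\<dots> \<le> (z - x) * C" using that by (intro mult_left_mono) (auto simp: C_def)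
    finally show ?thesis using that by (simp add: mult.commute)
  qed
  have W: "0 < W x" "W x \<le> C" "\<bar>W x - W z\<bar> \<le> C * \<bar>x - z\<bar>" for x z
  proof -
    show "0 < W x" by (simp add: W_def less_max_iff_disj)
    have "W x \<le> (1/4) powr - m" unfolding W_def using m by (intro powr_mono2') auto
    then show "W x \<le> C" by (simp add: C_def)
    show "\<bar>W x - W z\<bar> \<le> C * \<bar>x - z\<bar>"
      using lip[of x z] lip[of z x] by (cases "x \<le> z") (auto simp: abs_minus_commute)
  qed
  have W1: "W x \<le> 1" if "1 \<le> x" for x
  proof -
    have "x powr - m \<le> x powr 0" using that m by (intro powr_mono) auto
    then show ?thesis using that by (simp add: W_def max_def)
  qed
  have "\<exists>f p u g \<kappa>. 0 < \<kappa> \<and> \<kappa> < sqrt 12 \<and> weighted_film f p u g (\<lambda>y. W (f y)) \<kappa> \<and>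
      (\<forall>y>0. weighted_film.\<Phi> f p u g y \<le> 0)"
    by (rule shooting[of W C]) (use W W1 in blast)+
  then obtain f p u g \<kappa> where \<kappa>: "0 < \<kappa>" "\<kappa> < sqrt 12" and film: "weighted_film f p u g (\<lambda>y. W (f y)) \<kappa>"
    and \<Phi>: "\<And>y. 0 < y \<Longrightarrow> weighted_film.\<Phi> f p u g y \<le> 0"
    by blast
  interpret weighted_film f p u g "\<lambda>y. W (f y)" \<kappa> by (rule film)
  interpret trapped_film f p u g "\<lambda>y. W (f y)" \<kappa> by unfold_locales (use \<kappa> \<Phi> in auto)
  \<comment> \<open>The orbit stays above 1/3, so the cut at 1/4 is never reached and the truncated
    equation is the true one.\<close>
  have Wf: "W (f y) = f y powr - m" if "0 \<le> y" for y
    using f_lower[OF that] by (simp add: W_def max_def)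
  have film': "weighted_film f p u g (\<lambda>y. f y powr - m) \<kappa>"
    by unfold_locales (use df dp du dg Wf f_lower init in \<open>force+\<close>)
  then have "trapped_film f p u g (\<lambda>y. f y powr - m) \<kappa>"
    unfolding trapped_film_def trapped_film_axioms_def using \<kappa> \<Phi> by auto
  then show ?thesis using that \<kappa> by blast
qed

section \<open>From the first-order system to the original problem\<close>

lemma dy_eqI:
  assumes "(G has_real_derivative d) (at y within {0..})" "0 \<le> y"
  shows "dy G y = d"
proof -
  have "closure {y<..} \<subseteq> closure ({0..} - {y})" using assms by (intro closure_mono) auto
  then have "at y within {0..} \<noteq> bot" by (auto simp: at_within_eq_bot_iff)
  then show ?thesis
    unfolding dy_def using assms
    by (intro vector_derivative_within) (auto simp: has_real_derivative_iff_has_vector_derivative)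
qed

lemma has_real_derivative_halfline_cong:
  fixes F G :: "real \<Rightarrow> real"
  assumes "(F has_real_derivative d) (at y within {0..})" "0 \<le> y" "\<And>x. 0 \<le> x \<Longrightarrow> G x = F x"
  shows "(G has_real_derivative d) (at y within {0..})"
  using has_vector_derivative_transform[of y "{0..}" G F d] assms
  by (auto simp: has_real_derivative_iff_has_vector_derivative)

text \<open>The algebra generated by the solution and its powers is closed under differentiation,
  which gives smoothness up to the boundary.\<close>

inductive generated :: "(real \<Rightarrow> real) \<Rightarrow> (real \<Rightarrow> real) \<Rightarrow> (real \<Rightarrow> real) \<Rightarrow> (real \<Rightarrow> real) \<Rightarrow> (real \<Rightarrow> real) \<Rightarrow> bool"
  for f p u g where
  gen_f: "generated f p u g f"
| gen_p: "generated f p u g p"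
| gen_u: "generated f p u g u"
| gen_g: "generated f p u g g"
| gen_id: "generated f p u g (\<lambda>y. y)"
| gen_const: "generated f p u g (\<lambda>y. c)"
| gen_powr: "generated f p u g (\<lambda>y. f y powr c)"
| gen_add: "generated f p u g F \<Longrightarrow> generated f p u g G \<Longrightarrow> generated f p u g (\<lambda>y. F y + G y)"
| gen_mult: "generated f p u g F \<Longrightarrow> generated f p u g G \<Longrightarrow> generated f p u g (\<lambda>y. F y * G y)"

locale film_solution =
  fixes f p u g :: "real \<Rightarrow> real" and m \<alpha> :: real
  assumes df: "0 \<le> y \<Longrightarrow> (f has_real_derivative p y) (at y within {0..})"
    and dp: "0 \<le> y \<Longrightarrow> (p has_real_derivative u y) (at y within {0..})"
    and du: "0 \<le> y \<Longrightarrow> (u has_real_derivative g y * f y powr - m) (at y within {0..})"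
    and dg: "0 \<le> y \<Longrightarrow> (g has_real_derivative \<alpha> * (y * p y - f y)) (at y within {0..})"
    and pos: "0 \<le> y \<Longrightarrow> 0 < f y"
begin

lemma generated_deriv:
  assumes "generated f p u g F"
  shows "\<exists>G. generated f p u g G \<and> (\<forall>y\<ge>0. (F has_real_derivative G y) (at y within {0..}))"
  using assms
proof induction
  case gen_f
  then show ?case using df generated.gen_p by blast
next
  case gen_p
  then show ?case using dp generated.gen_u by blast
next
  case gen_u
  have "generated f p u g (\<lambda>y. g y * f y powr - m)" by (intro generated.intros)
  then show ?case using du by blast
next
  case gen_g
  have "generated f p u g (\<lambda>y. \<alpha> * (y * p y + - 1 * f y))" by (intro generated.intros)
  then show ?case using dg by (intro exI[of _ "\<lambda>y. \<alpha> * (y * p y + - 1 * f y)"]) simp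
next
  case gen_id
  have "generated f p u g (\<lambda>y. 1)" by (intro generated.intros)
  then show ?case by (intro exI[of _ "\<lambda>y. 1"]) auto
next
  case (gen_const c)
  have "generated f p u g (\<lambda>y. 0)" by (intro generated.intros)
  then show ?case by (intro exI[of _ "\<lambda>y. 0"]) auto
next
  case (gen_powr c)
  have "generated f p u g (\<lambda>y. c * f y powr (c - 1) * p y)" by (intro generated.intros)
  moreover have "((\<lambda>y. f y powr c) has_real_derivative c * f y powr (c - 1) * p y) (at y within {0..})" if "0 \<le> y" for y
    using DERIV_chain2[OF has_real_derivative_powr[OF pos[OF that], of c] df[OF that]] .
  ultimately show ?case by blast
next
  case (gen_add F G)
  then obtain F' G' where FG: "generated f p u g F'" "generated f p u g G'"
    and d: "\<And>y. 0 \<le> y \<Longrightarrow> (F has_real_derivative F' y) (at y within {0..})"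
    "\<And>y. 0 \<le> y \<Longrightarrow> (G has_real_derivative G' y) (at y within {0..})" by blast
  show ?case
    by (rule exI[of _ "\<lambda>y. F' y + G' y"]) (use FG d in \<open>auto intro!: generated.intros DERIV_add\<close>)
next
  case (gen_mult F G)
  then obtain F' G' where FG: "generated f p u g F'" "generated f p u g G'"
    and d: "\<And>y. 0 \<le> y \<Longrightarrow> (F has_real_derivative F' y) (at y within {0..})"
    "\<And>y. 0 \<le> y \<Longrightarrow> (G has_real_derivative G' y) (at y within {0..})" by blast
  show ?case
    by (rule exI[of _ "\<lambda>y. F' y * G y + G' y * F y"])
       (use gen_mult.hyps FG d in \<open>auto intro!: generated.gen_add generated.gen_mult DERIV_mult\<close>)
qed

lemma smooth: "smooth_halfline f"
proof -
  have gen: "\<exists>F. generated f p u g F \<and> (\<forall>y\<ge>0. (dy ^^ n) f y = F y)" for n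
  proof (induction n)
    case 0
    show ?case by (intro exI[of _ f]) (simp add: generated.gen_f)
  next
    case (Suc n)
    then obtain F where F: "generated f p u g F" "\<And>y. 0 \<le> y \<Longrightarrow> (dy ^^ n) f y = F y" by blast
    then obtain G where G: "generated f p u g G" "\<And>y. 0 \<le> y \<Longrightarrow> (F has_real_derivative G y) (at y within {0..})"
      using generated_deriv by blast
    have "dy ((dy ^^ n) f) y = G y" if "0 \<le> y" for y
      by (rule dy_eqI[OF has_real_derivative_halfline_cong[OF G(2)[OF that] that F(2)] that])
    then show ?case using G(1) by (intro exI[of _ G]) simp
  qed
  have "(dy ^^ n) f differentiable at y within {0..}" if y: "0 \<le> y" for n y
  proof -
    obtain F where F: "generated f p u g F" "\<And>y. 0 \<le> y \<Longrightarrow> (dy ^^ n) f y = F y" using gen by blast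
    obtain G where "(F has_real_derivative G y) (at y within {0..})"
      using generated_deriv[OF F(1)] y by blast
    then have "((dy ^^ n) f has_real_derivative G y) (at y within {0..})"
      by (rule has_real_derivative_halfline_cong[OF _ y F(2)])
    then show ?thesis unfolding has_field_derivative_def by (rule differentiableI)
  qed
  then show ?thesis by (simp add: smooth_halfline_def differentiable_on_def)
qed

lemma dy_eqs:
  assumes "0 \<le> y"
  shows "dy f y = p y" "(dy ^^ 2) f y = u y" "(dy ^^ 3) f y = g y * f y powr - m"
    "dy (\<lambda>x. f x powr m * (dy ^^ 3) f x) y = \<alpha> * (y * p y - f y)"
proof -
  have 1: "dy f x = p x" if "0 \<le> x" for x by (rule dy_eqI[OF df[OF that] that])
  have 2: "(dy ^^ 2) f x = u x" if "0 \<le> x" for x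
    unfolding numeral_2_eq_2 using that
    by (auto intro!: dy_eqI[OF has_real_derivative_halfline_cong[OF dp]] simp: 1)
  have 3: "(dy ^^ 3) f x = g x * f x powr - m" if "0 \<le> x" for x
  proof -
    have "dy ((dy ^^ 2) f) x = g x * f x powr - m"
      using that by (auto intro!: dy_eqI[OF has_real_derivative_halfline_cong[OF du]] simp: 2)
    then show ?thesis by (simp add: eval_nat_numeral)
  qed
  show "dy f y = p y" "(dy ^^ 2) f y = u y" "(dy ^^ 3) f y = g y * f y powr - m"
    using 1 2 3 assms by auto
  have "f x powr m * (dy ^^ 3) f x = g x" if "0 \<le> x" for x
    using 3[OF that] pos[OF that] by (simp add: powr_minus)
  then show "dy (\<lambda>x. f x powr m * (dy ^^ 3) f x) y = \<alpha> * (y * p y - f y)"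
    using assms by (intro dy_eqI[OF has_real_derivative_halfline_cong[OF dg]]) auto
qed

lemma solves_problem:
  assumes "f 0 = 1" "p 0 = 0" "u 0 = \<kappa>" "g 0 = 0" "((\<lambda>y. f y / y) \<longlongrightarrow> a) at_top"
  shows "solves_problem m \<alpha> \<kappa> a f"
proof -
  have "\<alpha> * (f y - y * dy f y) + dy (\<lambda>x. f x powr m * (dy ^^ 3) f x) y = 0" if "0 < y" for y
    unfolding dy_eqs(1,4)[OF less_imp_le[OF that]] by (simp add: algebra_simps)
  moreover have "dy f 0 = 0" "(dy ^^ 2) f 0 = \<kappa>" "(dy ^^ 3) f 0 = 0"
    using dy_eqs(1-3)[of 0] assms(1-4) by simp_all
  ultimately show ?thesis unfolding solves_problem_def using smooth pos assms(1,5) by blast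
qed

end

section \<open>Scaling and the final expansion\<close>

lemma DERIV_scale_halfline:
  assumes "\<And>y. 0 \<le> y \<Longrightarrow> (F has_real_derivative F' y) (at y within {0..})" "0 \<le> c" "0 \<le> y"
  shows "((\<lambda>y. F (c * y)) has_real_derivative c * F' (c * y)) (at y within {0..})"
proof -
  have "(F has_real_derivative F' (c * y)) (at (c * y) within (*) c ` {0..})"
    by (rule DERIV_subset[OF assms(1)]) (use assms in auto)
  moreover have "((*) c has_real_derivative c) (at y within {0..})" by (auto intro!: derivative_eq_intros)
  ultimately show ?thesis using DERIV_image_chain[of F "F' (c * y)" "(*) c" y "{0..}" c] by (simp add: o_def mult.commute)
qed

text \<open>Each derivative of \<open>f (\<beta> * y)\<close> brings a factor \<beta>; the
  fourth-order term therefore turns the coefficient 1 into \<beta>^4.\<close>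

lemma scaled_solution:
  assumes film: "trapped_film f p u g (\<lambda>y. f y powr - m) \<kappa>" and \<beta>: "0 < \<beta>"
    and lim: "((\<lambda>y. f y / y) \<longlongrightarrow> a) at_top"
  shows "solves_problem m (\<beta>^4) (\<beta>\<^sup>2 * \<kappa>) (\<beta> * a) (\<lambda>y. f (\<beta> * y))"
proof -
  interpret trapped_film f p u g "\<lambda>y. f y powr - m" \<kappa> by (rule film)
  note sc = DERIV_scale_halfline[where c = \<beta>]
  interpret film_solution "\<lambda>y. f (\<beta> * y)" "\<lambda>y. \<beta> * p (\<beta> * y)" "\<lambda>y. \<beta>\<^sup>2 * u (\<beta> * y)" "\<lambda>y. \<beta>^3 * g (\<beta> * y)" m "\<beta>^4"
  proof
    fix y :: real assume y: "0 \<le> y"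
    have b: "0 \<le> \<beta>" using \<beta> by simp
    show "((\<lambda>y. f (\<beta> * y)) has_real_derivative \<beta> * p (\<beta> * y)) (at y within {0..})"
      by (rule sc[OF df b y])
    show "((\<lambda>y. \<beta> * p (\<beta> * y)) has_real_derivative \<beta>\<^sup>2 * u (\<beta> * y)) (at y within {0..})"
      using DERIV_cmult[OF sc[OF dp b y], of \<beta>] by (simp add: power2_eq_square mult.assoc)
    show "((\<lambda>y. \<beta>\<^sup>2 * u (\<beta> * y)) has_real_derivative \<beta>^3 * g (\<beta> * y) * f (\<beta> * y) powr - m) (at y within {0..})"
      using DERIV_cmult[OF sc[OF du b y], of "\<beta>\<^sup>2"] by (simp add: power2_eq_square power3_eq_cube mult.assoc)
    show "((\<lambda>y. \<beta>^3 * g (\<beta> * y)) has_real_derivative \<beta>^4 * (y * (\<beta> * p (\<beta> * y)) - f (\<beta> * y))) (at y within {0..})"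
      using DERIV_cmult[OF sc[OF dg b y], of "\<beta>^3"] by (simp add: eval_nat_numeral algebra_simps)
    show "0 < f (\<beta> * y)" using f_lower[of "\<beta> * y"] \<beta> y by simp
  qed
  show ?thesis
  proof (rule solves_problem)
    have "filterlim (\<lambda>y. \<beta> * y) at_top at_top"
      using \<beta> by (intro filterlim_tendsto_pos_mult_at_top[OF tendsto_const _ filterlim_ident])
    from tendsto_mult[OF tendsto_const filterlim_compose[OF lim this], of \<beta>]
    show "((\<lambda>y. f (\<beta> * y) / y) \<longlongrightarrow> \<beta> * a) at_top" using \<beta> by simp
  qed (simp_all add: init)
qed

lemma fourth_root:
  fixes \<alpha> :: real
  assumes "0 < \<alpha>"
  obtains \<beta> where "0 < \<beta>" "\<beta>^4 = \<alpha>" "\<beta>\<^sup>2 * sqrt 12 = sqrt (12 * \<alpha>)"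
proof (rule that[of "sqrt (sqrt \<alpha>)"])
  have "sqrt (sqrt \<alpha>) ^ 4 = ((sqrt (sqrt \<alpha>))\<^sup>2)\<^sup>2" by (simp flip: power_mult)
  then show "sqrt (sqrt \<alpha>) ^ 4 = \<alpha>" using assms by simp
  show "(sqrt (sqrt \<alpha>))\<^sup>2 * sqrt 12 = sqrt (12 * \<alpha>)" using assms by (simp add: real_sqrt_mult)
qed (use assms in simp)

lemma exists_solution:
  fixes m \<alpha> :: real
  assumes "0 < m" "0 < \<alpha>"
  shows "\<exists>\<kappa> a. \<kappa> \<in> {0<..<sqrt (12 * \<alpha>)} \<and> a > 0 \<and> (\<exists>f. solves_problem m \<alpha> \<kappa> a f)"
proof -
  obtain f p u g \<kappa> where \<kappa>: "\<kappa> < sqrt 12" and film: "trapped_film f p u g (\<lambda>y. f y powr - m) \<kappa>"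
    by (rule trapped_solution[OF less_imp_le[OF assms(1)]]) blast
  interpret trapped_film f p u g "\<lambda>y. f y powr - m" \<kappa> by (rule film)
  obtain a where a: "0 < a" "((\<lambda>y. f y / y) \<longlongrightarrow> a) at_top"
    by (rule slope_limit)
  obtain \<beta> where \<beta>: "0 < \<beta>" "\<beta>^4 = \<alpha>" "\<beta>\<^sup>2 * sqrt 12 = sqrt (12 * \<alpha>)" using fourth_root[OF assms(2)] by blast
  have "\<beta>\<^sup>2 * \<kappa> < sqrt (12 * \<alpha>)" using \<kappa> \<beta>(1) unfolding \<beta>(3)[symmetric] by simp
  then show ?thesis
    using scaled_solution[OF film \<beta>(1) a(2)] a \<beta> \<kappa>_pos by (intro exI[of _ "\<beta>\<^sup>2 * \<kappa>"] exI[of _ "\<beta> * a"]) auto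
qed

text \<open>The polynomial equals -(z - r) ((z + s)^2 + \<omega>^2), so its only roots with negative
  real part are the conjugate pair -s \<plusminus> i \<omega>, both of real part -s.\<close>

lemma leading_stable_root_char_poly:
  fixes r s \<omega> a b c :: real
  assumes r: "1 < r" and s: "s = (2 + r) / 2" and \<omega>: "0 < \<omega>" "\<omega>\<^sup>2 = r\<^sup>2 + 2 * r - 1 - s\<^sup>2"
    and root: "(r\<^sup>2 - 1) * (r + 2) = b / c^4"
  shows "leading_stable_root (char_poly_ba b c) (Complex (- s) \<omega>)"
proof -
  define R where "R = complex_of_real r"
  define S where "S = complex_of_real s"
  define T where "T = complex_of_real \<omega>"
  have S: "S = (2 + R) / 2" unfolding S_def R_def s by simp
  have T: "T\<^sup>2 = R\<^sup>2 + 2 * R - 1 - S\<^sup>2"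
    unfolding T_def R_def S_def of_real_power[symmetric] \<omega>(2) by simp
  have B: "complex_of_real (b / c^4) = (R\<^sup>2 - 1) * (R + 2)" unfolding root[symmetric] R_def by simp
  have fac: "poly (char_poly_ba b c) z = - ((z - R) * ((z + S)\<^sup>2 + T\<^sup>2))" for z
  proof -
    have "poly (char_poly_ba b c) z = (1 - z\<^sup>2) * (2 + z) + (R\<^sup>2 - 1) * (R + 2)"
      unfolding char_poly_ba_def B by (simp add: power2_eq_square algebra_simps)
    also have "\<dots> = - ((z - R) * ((z + S)\<^sup>2 + T\<^sup>2))"
      unfolding T S by (simp add: field_simps power2_eq_square)
    finally show ?thesis .
  qed
  have z0: "Complex (- s) \<omega> + S = \<i> * T" by (simp add: complex_eq_iff S_def T_def)
  have "poly (char_poly_ba b c) (Complex (- s) \<omega>) = 0"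
    unfolding fac z0 by (simp add: power_mult_distrib)
  moreover have "Re z \<le> - s" if z: "poly (char_poly_ba b c) z = 0" "Re z < 0" for z
  proof -
    have "z \<noteq> R" using z(2) r by (auto simp: R_def)
    then have "(z + S)\<^sup>2 + T\<^sup>2 = 0" using z(1) fac by auto
    then have "(z + S + \<i> * T) * (z + S - \<i> * T) = 0" by (simp add: algebra_simps power2_eq_square)
    then have "z + S + \<i> * T = 0 \<or> z + S - \<i> * T = 0" by (simp only: mult_eq_0_iff)
    then have "Re (z + S + \<i> * T) = 0 \<or> Re (z + S - \<i> * T) = 0" by (metis zero_complex.sel(1))
    then show ?thesis by (simp add: S_def T_def)
  qed
  moreover have "0 < s" using r s by simp
  ultimately show ?thesis using \<omega>(1) by (auto simp: leading_stable_root_def)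
qed

lemma Re_mult_powr:
  assumes "0 < y"
  shows "Re (Complex m (- n) * complex_of_real y powr (1 + Complex (- s) \<omega>))
    = y * (y powr (- s) * (m * cos (\<omega> * ln y) + n * sin (\<omega> * ln y)))"
proof -
  have "complex_of_real y powr (1 + Complex (- s) \<omega>) = exp ((1 + Complex (- s) \<omega>) * complex_of_real (ln y))"
    using assms by (simp add: powr_def Ln_of_real)
  moreover have "exp ((1 - s) * ln y) = y * y powr (- s)"
    using assms by (simp add: powr_def left_diff_distrib exp_diff exp_minus divide_inverse)
  ultimately show ?thesis
    by (simp add: Re_exp Im_exp algebra_simps)
qed

lemma exists_solution_quartic:
  fixes b :: real
  assumes b: "0 < b"
  shows "\<exists>\<kappa> a. \<kappa> \<in> {0<..<sqrt (12 * b)} \<and> a > 0 \<and>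
    (\<exists>f. solves_problem 4 b \<kappa> a f \<and>
      (\<exists>(z\<^sub>0 :: complex) (K :: complex).
         Re z\<^sub>0 < -1 \<and> leading_stable_root (char_poly_ba b a) z\<^sub>0 \<and>
         (\<lambda>y. f y - (a * y + Re (K * complex_of_real y powr (1 + z\<^sub>0))))
           \<in> o[at_top](\<lambda>y. y powr (1 + Re z\<^sub>0))))"
proof -
  obtain f p u g \<kappa> where \<kappa>: "\<kappa> < sqrt 12" and film: "trapped_film f p u g (\<lambda>y. f y powr - 4) \<kappa>"
    by (rule trapped_solution[of 4, OF zero_le_numeral]) blast
  interpret trapped_film f p u g "\<lambda>y. f y powr - 4" \<kappa> by (rule film)
  interpret quartic_film f p u g "\<lambda>y. f y powr - 4" \<kappa>
  proof
    show "f y powr - 4 = 1 / (f y)^4" if "0 \<le> y" for y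
      using f_lower[OF that] by (simp add: powr_minus_divide)
  qed
  obtain a C\<^sub>0 where a: "0 < a" "((\<lambda>y. f y / y) \<longlongrightarrow> a) at_top"
    and rate: "\<And>y. 1 \<le> y \<Longrightarrow> \<bar>f y / y - a\<bar> \<le> C\<^sub>0 / sqrt y"
    and osc: "\<And>y. 0 < y \<Longrightarrow> (a - f y / y)\<^sup>2 \<le> 2 * - \<Phi> y / y"
    using slope_limit by blast
  have "a \<le> 11/10" by (rule slope_bound[OF a(2) osc])
  then obtain r s \<omega> where r: "1 < r" "s = (2 + r) / 2" "0 < \<omega>" "\<omega>\<^sup>2 = r\<^sup>2 + 2 * r - 1 - s\<^sup>2"
    "(r\<^sup>2 - 1) * (r + 2) = 1 / a^4"
    using characteristic_roots[OF a(1)] by blast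
  interpret spectral_film f p u g "\<lambda>y. f y powr - 4" \<kappa> a r s \<omega> C\<^sub>0
    by unfold_locales (use a r rate in auto)
  obtain m n j C where j: "s < j"
    and asym: "\<And>y. 1 \<le> y \<Longrightarrow> \<bar>f y / y - a - y powr (- s) * (m * cos (\<omega> * ln y) + n * sin (\<omega> * ln y))\<bar> \<le> C * y powr (- j)"
    using slope_asymptotics by blast
  obtain \<beta> where \<beta>: "0 < \<beta>" "\<beta>^4 = b" "\<beta>\<^sup>2 * sqrt 12 = sqrt (12 * b)" using fourth_root[OF b] by blast
  have \<kappa>': "\<beta>\<^sup>2 * \<kappa> < sqrt (12 * b)" using \<kappa> \<beta>(1) unfolding \<beta>(3)[symmetric] by simp
  define z\<^sub>0 where "z\<^sub>0 = Complex (- s) \<omega>"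
  \<comment> \<open>The constant absorbs the factor \<beta>^(1 + z0) produced by scaling; the entry
    \<open>- n\<close> turns the real part into m cos + n sin.\<close>
  define K where "K = Complex m (- n) * complex_of_real \<beta> powr (1 + z\<^sub>0)"
  \<comment> \<open>The constant term of the polynomial is scale-invariant, so the roots found for
    coefficient 1 are those of the scaled problem.\<close>
  have "1 / a^4 = b / (\<beta> * a)^4" using \<beta> a(1) by (simp add: power_mult_distrib flip: \<beta>(2))
  then have root: "leading_stable_root (char_poly_ba b (\<beta> * a)) z\<^sub>0"
    unfolding z\<^sub>0_def using r by (intro leading_stable_root_char_poly) auto
  define E where "E = (\<lambda>y. f (\<beta> * y) - (\<beta> * a * y + Re (K * complex_of_real y powr (1 + z\<^sub>0))))"
  have E: "\<bar>E y\<bar> \<le> \<beta> * C * \<beta> powr (- j) * y powr (1 - j)" if y: "0 < y" "1 \<le> \<beta> * y" for y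
  proof -
    define x where "x = \<beta> * y"
    have x: "0 < x" "1 \<le> x" using y by (auto simp: x_def)
    have "complex_of_real x powr (1 + z\<^sub>0) = complex_of_real \<beta> powr (1 + z\<^sub>0) * complex_of_real y powr (1 + z\<^sub>0)"
      unfolding x_def of_real_mult using \<beta> y by (intro powr_times_real) auto
    then have "Re (K * complex_of_real y powr (1 + z\<^sub>0)) = Re (Complex m (- n) * complex_of_real x powr (1 + z\<^sub>0))"
      by (simp only: K_def mult.assoc)
    also have "\<dots> = x * (x powr (- s) * (m * cos (\<omega> * ln x) + n * sin (\<omega> * ln x)))"
      unfolding z\<^sub>0_def by (rule Re_mult_powr[OF x(1)])
    finally have "E y = x * (f x / x - a - x powr (- s) * (m * cos (\<omega> * ln x) + n * sin (\<omega> * ln x)))"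
      unfolding E_def using x by (simp add: x_def[symmetric] right_diff_distrib)
    then have "\<bar>E y\<bar> = x * \<bar>f x / x - a - x powr (- s) * (m * cos (\<omega> * ln x) + n * sin (\<omega> * ln x))\<bar>"
      using x by (simp add: abs_mult)
    also have "\<dots> \<le> x * (C * x powr (- j))" using asym[OF x(2)] x by (intro mult_left_mono) auto
    also have "\<dots> = \<beta> * C * \<beta> powr (- j) * (y * y powr (- j))"
      using \<beta> y by (simp add: x_def powr_mult)
    also have "y * y powr (- j) = y powr (1 - j)" using y by (simp add: powr_mult_base)
    finally show ?thesis .
  qed
  have "E \<in> O[at_top](\<lambda>y. y powr (1 - j))"
  proof (rule bigoI)
    show "\<forall>\<^sub>F y in at_top. norm (E y) \<le> (\<beta> * C * \<beta> powr (- j)) * norm (y powr (1 - j))"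
      using eventually_gt_at_top[of 0] eventually_ge_at_top[of "1 / \<beta>"]
      by eventually_elim (use E \<beta>(1) in \<open>auto simp: field_simps\<close>)
  qed
  also have "(\<lambda>y::real. y powr (1 - j)) \<in> o[at_top](\<lambda>y. y powr (1 + Re z\<^sub>0))"
    using j by (subst powr_smallo_iff[OF filterlim_ident]) (auto simp: z\<^sub>0_def)
  finally have smallo: "E \<in> o[at_top](\<lambda>y. y powr (1 + Re z\<^sub>0))" .
  have "Re z\<^sub>0 < -1" using s_gt by (simp add: z\<^sub>0_def)
  moreover have "solves_problem 4 b (\<beta>\<^sup>2 * \<kappa>) (\<beta> * a) (\<lambda>y. f (\<beta> * y))"
    using scaled_solution[OF film \<beta>(1) a(2)] \<beta>(2) by simp
  moreover have "\<beta>\<^sup>2 * \<kappa> \<in> {0<..<sqrt (12 * b)}" "0 < \<beta> * a" using \<kappa>' \<kappa>_pos \<beta>(1) a(1) by auto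
  ultimately show ?thesis using root smallo unfolding E_def by blast
qed

theorem theorem2p1:
  shows
    "(\<forall>m \<alpha> :: real. 0 < m \<and> m < 4 \<and> \<alpha> = 1 / (4 - m) \<longrightarrow>
        (\<exists>\<kappa> a. \<kappa> \<in> {0<..<sqrt (12 * \<alpha>)} \<and> a > 0 \<and>
           (\<exists>f. solves_problem m \<alpha> \<kappa> a f)))
     \<and>
     (\<forall>b \<alpha> :: real. b > 0 \<and> \<alpha> = b \<longrightarrow>
        (\<exists>\<kappa> a. \<kappa> \<in> {0<..<sqrt (12 * \<alpha>)} \<and> a > 0 \<and>
           (\<exists>f. solves_problem 4 \<alpha> \<kappa> a f \<and>
              (\<exists>(z\<^sub>0 :: complex) (K :: complex).
                 Re z\<^sub>0 < -1 \<and> leading_stable_root (char_poly_ba b a) z\<^sub>0 \<and>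
                 (\<lambda>y. f y - (a * y + Re (K * complex_of_real y powr (1 + z\<^sub>0))))
                   \<in> o[at_top](\<lambda>y. y powr (1 + Re z\<^sub>0))))))"
proof (intro conjI allI impI; elim conjE; hypsubst)
  fix m :: real assume "0 < m" "m < 4"
  then show "\<exists>\<kappa> a. \<kappa> \<in> {0<..<sqrt (12 * (1 / (4 - m)))} \<and> a > 0 \<and>
      (\<exists>f. solves_problem m (1 / (4 - m)) \<kappa> a f)"
    by (intro exists_solution) auto
qed (rule exists_solution_quartic)

end
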